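(* Let $G$ be a countable group. The class $\mathcal{E}(G)^\perp$ is closed under products: if $\mathbf{X}=(X,\mathcal{B},\mu,\{T_g\}_{g\in G})$ and $\mathbf{Y}=(Y,\mathcal{C},\nu,\{S_g\}_{g\in G})$ belong to $\mathcal{E}(G)^\perp$, then so does the product system $(X\times Y,\mathcal{B}\otimes\mathcal{C},\mu\times\nu,\{T_g\times S_g\}_{g\in G})$.
   Context: $\mathbb{A}(G)$ is the space of probability measure preserving actions of $G$ on the standard nonatomic probability space ($[0,1]$ with Lebesgue measure, up to isomorphism of the underlying space), and $\mathcal{E}(G)\subset\mathbb{A}(G)$ is the set of ergodic actions. A joining of two $G$-systems $(X,\mathcal B,\mu,\{T_g\})$ and $(Z,\mathcal D,\rho,\{R_g\})$ is a probability measure on $X\times Z$ with marginals $\mu$ and $\rho$ that is invariant under $T_g\times R_g$ for every $g\in G$. The systems are disjoint if $\mu\times\rho$ is their only joining. $\mathcal{E}(G)^\perp$ is the class of systems in $\mathbb{A}(G)$ that are disjoint from every element of $\mathcal{E}(G)$. *)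

theory Defs
  imports "HOL-Probability.Probability" "HOL-Algebra.Group_Action"
begin

text \<open>
  Measure spaces are considered up to isomorphism modulo null sets. The unit interval carries the
  Borel sigma-algebra rather than its completion, so that the pair measure of two standard spaces
  is again a standard space.
\<close>

definition unit_interval :: "real measure" where
  "unit_interval = restrict_space lborel {0..1}"

definition iso_mod0 :: "'a measure \<Rightarrow> 'b measure \<Rightarrow> bool" where
  "iso_mod0 M N \<longleftrightarrow>
     (\<exists>A\<in>sets M. \<exists>B\<in>sets N. \<exists>f h.
        emeasure M (space M - A) = 0 \<and> emeasure N (space N - B) = 0 \<and>
        f \<in> measurable (restrict_space M A) (restrict_space N B) \<and>
        h \<in> measurable (restrict_space N B) (restrict_space M A) \<and>
        (\<forall>x\<in>A. h (f x) = x) \<and> (\<forall>y\<in>B. f (h y) = y) \<and>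
        distr (restrict_space M A) (restrict_space N B) f = restrict_space N B)"

definition std_nonatomic_prob_space :: "'a measure \<Rightarrow> bool" where
  "std_nonatomic_prob_space M \<longleftrightarrow> prob_space M \<and> iso_mod0 M unit_interval"

type_synonym ('g, 'a) system = "'a measure \<times> ('g \<Rightarrow> 'a \<Rightarrow> 'a)"

text \<open>
  The library's group actions are by extensional bijections, hence the restriction to the
  space; the values of a transformation outside the space are irrelevant.
\<close>

definition pmp_systems :: "('g, 'm) monoid_scheme \<Rightarrow> ('g, 'a) system set" where
  "pmp_systems G =
     {(M, T). std_nonatomic_prob_space M \<and>
        group_action G (space M) (\<lambda>g. restrict (T g) (space M)) \<and>
        (\<forall>g\<in>carrier G. T g \<in> measurable M M \<and> distr M M (T g) = M)}"

definition ergodic_systems :: "('g, 'm) monoid_scheme \<Rightarrow> ('g, 'a) system set" where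
  "ergodic_systems G =
     {(M, T). (M, T) \<in> pmp_systems G \<and>
        (\<forall>A\<in>sets M. (\<forall>g\<in>carrier G. T g -` A \<inter> space M = A) \<longrightarrow>
           measure M A = 0 \<or> measure M A = 1)}"

fun product_system :: "('g, 'a) system \<Rightarrow> ('g, 'b) system \<Rightarrow> ('g, 'a \<times> 'b) system" where
  "product_system (M, T) (N, S) = (M \<Otimes>\<^sub>M N, \<lambda>g (x, y). (T g x, S g y))"

fun joinings ::
  "('g, 'm) monoid_scheme \<Rightarrow> ('g, 'a) system \<Rightarrow> ('g, 'b) system \<Rightarrow> ('a \<times> 'b) measure set" where
  "joinings G (M, T) (N, S) =
     {J. prob_space J \<and> sets J = sets (M \<Otimes>\<^sub>M N) \<and>
        distr J M fst = M \<and> distr J N snd = N \<and>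
        (\<forall>g\<in>carrier G. distr J J (\<lambda>(x, z). (T g x, S g z)) = J)}"

definition disjoint_systems ::
  "('g, 'm) monoid_scheme \<Rightarrow> ('g, 'a) system \<Rightarrow> ('g, 'b) system \<Rightarrow> bool" where
  "disjoint_systems G X Z \<longleftrightarrow> joinings G X Z = {fst X \<Otimes>\<^sub>M fst Z}"

text \<open>
  A definition cannot quantify over the type underlying the ergodic system, so it is taken to
  be \<^typ>\<open>real\<close>. Every system has an isomorphic copy there, on the unit interval.
\<close>

definition ergodic_perp :: "('g, 'm) monoid_scheme \<Rightarrow> ('g, 'a) system set" where
  "ergodic_perp G =
     {X \<in> pmp_systems G.
        \<forall>Z \<in> (ergodic_systems G :: ('g, real) system set). disjoint_systems G X Z}"

end

theory Submission
  imports Defs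
begin

text \<open>
  Let \<open>X\<close> and \<open>Y\<close> be disjoint from all ergodic systems and let \<open>J\<close> be a joining of \<open>X \<times> Y\<close> with an
  ergodic system \<open>Z\<close>. Since \<open>X\<close> and \<open>Z\<close> are disjoint, the projection of \<open>J\<close> to \<open>X \<times> Z\<close> is the product
  measure, and every invariant function on \<open>X \<times> Z\<close> is a function of the coordinate in \<open>X\<close> only.
  Hence disintegrating \<open>J\<close> over the invariant sigma-algebra of \<open>X\<close> decomposes \<open>X \<times> Z\<close> into ergodic
  components, while the marginal on \<open>Y\<close> of almost every fibre measure is still the measure of \<open>Y\<close>,
  because \<open>X\<close> and \<open>Y\<close> are independent under \<open>J\<close>. Almost every fibre measure is therefore a joining of
  \<open>Y\<close> with an ergodic system (nonatomic, as it has \<open>Z\<close> as a factor), so it is a product, and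
  integrating over the fibres shows that \<open>J\<close> is a product.
\<close>

text \<open>The group is an arbitrary countable one, so averages cannot run along a fixed exhausting
  sequence; invariant functions are obtained from convex combinations of translates instead. The
  delicate point is the ergodicity of a single fibre: knowing the invariant functions on
  \<open>X \<times> Z\<close> does not directly control the invariant sets of one fibre measure,
  which are uncountably many and depend on the fibre. The way out is to fix countably many test sets
  that determine measures and, for each, one sequence of averaged translates converging almost
  everywhere. Its limit is an invariant function of the coordinate in \<open>X\<close>, hence
  constant on almost every fibre, and this convergence is all that the proof of ergodicity within
  the fibre uses. Conditioning on invariant sets rather than on points of \<open>X\<close> is what
  makes the fibres invariant, since the group moves points but fixes each invariant set. The codings
  by real numbers serve three ends: they supply the countable test sets, they allow disintegration,
  and they transport the fibre systems, which live on products, to the reals.\<close>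

subsection \<open>Borel codings by real numbers\<close>

text \<open>
  Bits are digits in base 4, not 2: the tail then stays below 1/3, so every bit sequence is recovered from
  its value by taking integer parts.
\<close>

definition bits_to_real :: "(nat \<Rightarrow> bool) \<Rightarrow> real" where
  "bits_to_real b = (\<Sum>n. of_bool (b n) / 4 ^ Suc n)"

lemma summable_bits: "summable (\<lambda>n. of_bool (b n) / 4 ^ Suc n :: real)"
proof (rule summable_comparison_test')
  show "summable (\<lambda>n. (1 / 4) ^ n :: real)"
    by (rule summable_geometric) simp
  show "norm (of_bool (b n) / 4 ^ Suc n :: real) \<le> (1 / 4) ^ n" if "n \<ge> 0" for n
    by (auto simp: power_one_over field_simps)
qed

lemma bits_to_real_bounds: "0 \<le> bits_to_real b" "bits_to_real b \<le> 1 / 3"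
proof -
  show "0 \<le> bits_to_real b"
    unfolding bits_to_real_def by (rule suminf_nonneg[OF summable_bits]) simp
  have "(\<lambda>n. (1 / 4) * (1 / 4) ^ n :: real) sums ((1 / 4) * (1 / (1 - 1 / 4)))"
    by (intro sums_mult geometric_sums) simp
  then have s: "(\<lambda>n. 1 / 4 ^ Suc n :: real) sums (1 / 3)"
    by (simp add: power_one_over)
  show "bits_to_real b \<le> 1 / 3"
    unfolding bits_to_real_def sums_unique[OF s]
    by (rule suminf_le[OF _ summable_bits sums_summable[OF s]]) (simp add: divide_right_mono)
qed

lemma bits_to_real_shift:
  "4 * bits_to_real b = of_bool (b 0) + bits_to_real (\<lambda>n. b (Suc n))"
proof -
  have "bits_to_real b = (\<Sum>n. of_bool (b (Suc n)) / 4 ^ Suc (Suc n)) + of_bool (b 0) / 4"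
    unfolding bits_to_real_def using suminf_split_head[OF summable_bits[of b]] by simp
  also have "(\<Sum>n. of_bool (b (Suc n)) / 4 ^ Suc (Suc n) :: real)
      = (\<Sum>n. (1 / 4) * (of_bool (b (Suc n)) / 4 ^ Suc n))"
    by simp
  also have "\<dots> = (1 / 4) * bits_to_real (\<lambda>n. b (Suc n))"
    unfolding bits_to_real_def by (rule suminf_mult[OF summable_bits])
  finally show ?thesis by simp
qed

text \<open>After the scaling every earlier digit carries a positive power of 4, so together they
  form an even integer; the parity of the integer part thus isolates the digit
  \<open>b n\<close>.\<close>

lemma bits_to_real_prefix:
  "\<exists>m::int. 4 ^ Suc n * bits_to_real b
     = of_int (2 * m) + of_bool (b n) + bits_to_real (\<lambda>k. b (Suc (n + k)))"
proof (induction n)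
  case 0
  then show ?case using bits_to_real_shift[of b] by (intro exI[of _ 0]) simp
next
  case (Suc n)
  then obtain m :: int where m: "4 ^ Suc n * bits_to_real b
     = of_int (2 * m) + of_bool (b n) + bits_to_real (\<lambda>k. b (Suc (n + k)))" ..
  have "4 ^ Suc (Suc n) * bits_to_real b = 4 * (4 ^ Suc n * bits_to_real b)"
    by simp
  also have "\<dots> = 4 * (of_int (2 * m) + of_bool (b n)) + 4 * bits_to_real (\<lambda>k. b (Suc (n + k)))"
    unfolding m by (simp add: algebra_simps)
  also have "4 * bits_to_real (\<lambda>k. b (Suc (n + k)))
      = of_bool (b (Suc n)) + bits_to_real (\<lambda>k. b (Suc (Suc n + k)))"
    using bits_to_real_shift[of "\<lambda>k. b (Suc (n + k))"] by simp
  finally show ?case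
    by (intro exI[of _ "4 * m + 2 * of_bool (b n)"]) (simp add: algebra_simps)
qed

lemma odd_floor_bits_to_real: "odd \<lfloor>4 ^ Suc n * bits_to_real b\<rfloor> \<longleftrightarrow> b n"
proof -
  obtain m :: int where m: "4 ^ Suc n * bits_to_real b
     = of_int (2 * m) + of_bool (b n) + bits_to_real (\<lambda>k. b (Suc (n + k)))"
    using bits_to_real_prefix by blast
  have "\<lfloor>4 ^ Suc n * bits_to_real b\<rfloor> = 2 * m + of_bool (b n)"
    unfolding m by (rule floor_unique) (use bits_to_real_bounds[of "\<lambda>k. b (Suc (n + k))"] in auto)
  then show ?thesis by simp
qed

lemma measurable_bits_to_real:
  assumes "\<And>n. Measurable.pred M (\<lambda>x. b x n)"
  shows "(\<lambda>x. bits_to_real (b x)) \<in> borel_measurable M"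
  unfolding bits_to_real_def using assms by measurable

definition rat_enum :: "nat \<Rightarrow> real" where
  "rat_enum = from_nat_into \<rat>"

lemma rat_enum_between:
  assumes "x < y" obtains n where "x < rat_enum n" "rat_enum n < y"
  using Rats_dense_in_real[OF assms] from_nat_into_surj[OF countable_rat]
  unfolding rat_enum_def by metis

text \<open>The infimum is taken in the extended reals so that every bit sequence has a value,
  including those that are not cuts, and the map is measurable as a countable infimum.\<close>

definition cut_to_real :: "(nat \<Rightarrow> bool) \<Rightarrow> real" where
  "cut_to_real b = real_of_ereal (INF n. if b n then ereal (rat_enum n) else \<infinity>)"

lemma cut_to_real_cut: "cut_to_real (\<lambda>n. x \<le> rat_enum n) = x"
proof -
  have "(INF n. if x \<le> rat_enum n then ereal (rat_enum n) else \<infinity>) = ereal x"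
  proof (rule antisym)
    show "(INF n. if x \<le> rat_enum n then ereal (rat_enum n) else \<infinity>) \<le> ereal x"
    proof (rule dense_ge)
      fix z assume "ereal x < z"
      then obtain y where y: "x < y" "ereal y < z"
        by (metis ereal_dense2 ereal_less_eq(3) less_ereal.simps(1) order_less_le)
      obtain n where "x < rat_enum n" "rat_enum n < y" using rat_enum_between[OF y(1)] .
      then show "(INF n. if x \<le> rat_enum n then ereal (rat_enum n) else \<infinity>) \<le> z"
        using y order.trans[of "ereal (rat_enum n)" "ereal y" z]
        by (intro INF_lower2[of n]) auto
    qed
  qed (rule INF_greatest, simp)
  then show ?thesis by (simp add: cut_to_real_def)
qed

lemma measurable_cut_to_real:
  assumes [measurable]: "\<And>n. Measurable.pred M (\<lambda>x. b x n)"
  shows "(\<lambda>x. cut_to_real (b x)) \<in> borel_measurable M"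
  unfolding cut_to_real_def by measurable

text \<open>
  A real number is encoded by its cut in the rationals, and the two cuts are interleaved.
\<close>

definition pair_code :: "real \<times> real \<Rightarrow> real" where
  "pair_code p =
     bits_to_real (\<lambda>n. (if even n then fst p else snd p) \<le> rat_enum (n div 2))"

definition pair_decode :: "real \<Rightarrow> real \<times> real" where
  "pair_decode t =
     (cut_to_real (\<lambda>n. odd \<lfloor>4 ^ Suc (2 * n) * t\<rfloor>),
      cut_to_real (\<lambda>n. odd \<lfloor>4 ^ Suc (2 * n + 1) * t\<rfloor>))"

lemma pair_decode_code [simp]: "pair_decode (pair_code p) = p"
  by (cases p) (simp add: pair_decode_def pair_code_def odd_floor_bits_to_real cut_to_real_cut
      del: power_Suc)

lemma pair_code_bounds: "0 \<le> pair_code p" "pair_code p \<le> 1"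
  unfolding pair_code_def by (rule bits_to_real_bounds, rule order_trans[OF bits_to_real_bounds(2)]) simp

lemma measurable_pair_code [measurable]: "pair_code \<in> borel_measurable (borel \<Otimes>\<^sub>M borel)"
  unfolding pair_code_def by (intro measurable_bits_to_real) measurable

lemma measurable_pair_decode [measurable]: "pair_decode \<in> borel \<rightarrow>\<^sub>M borel \<Otimes>\<^sub>M borel"
proof -
  have "Measurable.pred borel (\<lambda>t::real. odd \<lfloor>4 ^ k * t\<rfloor>)" for k :: nat
    by measurable
  then show ?thesis
    unfolding pair_decode_def by (intro measurable_Pair measurable_cut_to_real)
qed

text \<open>
  Replaces the notion of a standard Borel space: \<open>M\<close> is identified with a Borel set of real numbers,
  but only on \<open>A\<close>, which is conull in all applications; outside \<open>A\<close> the sigma-algebra may be arbitrary.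
\<close>

definition borel_coding ::
  "'a measure \<Rightarrow> 'a set \<Rightarrow> ('a \<Rightarrow> real) \<Rightarrow> (real \<Rightarrow> 'a) \<Rightarrow> bool" where
  "borel_coding M A \<phi> \<psi> \<longleftrightarrow> A \<in> sets M \<and> \<phi> \<in> borel_measurable M \<and> \<psi> \<in> borel \<rightarrow>\<^sub>M M \<and>
     (\<forall>x\<in>space M. 0 \<le> \<phi> x \<and> \<phi> x \<le> 1) \<and> (\<forall>x\<in>A. \<psi> (\<phi> x) = x)"

lemma borel_codingD:
  assumes "borel_coding M A \<phi> \<psi>"
  shows "A \<in> sets M" "\<phi> \<in> borel_measurable M" "\<psi> \<in> borel \<rightarrow>\<^sub>M M"
    "\<And>x. x \<in> space M \<Longrightarrow> 0 \<le> \<phi> x" "\<And>x. x \<in> space M \<Longrightarrow> \<phi> x \<le> 1"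
    "\<And>x. x \<in> A \<Longrightarrow> \<psi> (\<phi> x) = x" "\<And>t. \<psi> t \<in> space M"
  using assms by (auto simp: borel_coding_def dest: measurable_space)

lemma borel_coding_cong:
  "sets M = sets N \<Longrightarrow> borel_coding M A \<phi> \<psi> \<longleftrightarrow> borel_coding N A \<phi> \<psi>"
  by (simp add: borel_coding_def cong: measurable_cong_sets) (auto dest: sets_eq_imp_space_eq)

lemma borel_coding_pair:
  assumes 1: "borel_coding M A \<phi> \<psi>" and 2: "borel_coding N B \<phi>' \<psi>'"
  shows "borel_coding (M \<Otimes>\<^sub>M N) (A \<times> B) (\<lambda>p. pair_code (\<phi> (fst p), \<phi>' (snd p)))
           (\<lambda>t. (\<psi> (fst (pair_decode t)), \<psi>' (snd (pair_decode t))))"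
proof -
  note [measurable] = borel_codingD(1-3)[OF 1] borel_codingD(1-3)[OF 2]
  show ?thesis
    unfolding borel_coding_def
    by (intro conjI ballI)
       (auto simp: pair_code_bounds borel_codingD(6)[OF 1] borel_codingD(6)[OF 2])
qed

text \<open>Null fibres are the form in which nonatomicity is kept: \<open>f\<close> carries the
  measure to Lebesgue measure, for which points are null.\<close>

lemma iso_mod0_unit_interval_coding:
  assumes "prob_space M" "iso_mod0 M unit_interval"
  obtains A \<phi> \<psi> where "borel_coding M A \<phi> \<psi>" "AE x in M. x \<in> A"
    "\<And>t. emeasure M {x \<in> A. \<phi> x = t} = 0"
proof -
  interpret prob_space M by fact
  obtain A B f h where A [measurable]: "A \<in> sets M" and B: "B \<in> sets unit_interval"
    and null: "emeasure M (space M - A) = 0"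
    and f: "f \<in> restrict_space M A \<rightarrow>\<^sub>M restrict_space unit_interval B"
    and h: "h \<in> restrict_space unit_interval B \<rightarrow>\<^sub>M restrict_space M A"
    and hf: "\<forall>x\<in>A. h (f x) = x"
    and d: "distr (restrict_space M A) (restrict_space unit_interval B) f
              = restrict_space unit_interval B"
    using assms(2) unfolding iso_mod0_def by blast
  obtain x0 where x0: "x0 \<in> space M" using not_empty by blast
  have B': "B \<in> sets borel" "B \<subseteq> {0..1}"
    using B by (auto simp: unit_interval_def sets_restrict_space)
  have sub: "A \<subseteq> space M" by (rule sets.sets_into_space[OF A])
  have id: "(\<lambda>x. x) \<in> borel_measurable (restrict_space unit_interval B)"
    unfolding unit_interval_def by (intro measurable_restrict_space1) simp
  have rr: "restrict_space unit_interval B = restrict_space lborel B"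
    unfolding unit_interval_def using B' by (simp add: restrict_restrict_space Int_absorb1)
  have fB: "f x \<in> B" if "x \<in> A" for x
    using measurable_space[OF f, of x] that sub B' by (auto simp: space_restrict_space unit_interval_def)
  \<comment> \<open>Both maps are made total by constants: 0 keeps \<open>\<phi>\<close> inside the
    unit interval, and \<open>x0\<close> is an arbitrary point of the space.\<close>
  define \<phi> where "\<phi> x = (if x \<in> A then f x else 0)" for x
  define \<psi> where "\<psi> t = (if t \<in> B then h t else x0)" for t
  have "f \<in> borel_measurable (restrict_space M A)"
    using measurable_compose[OF f id] .
  then have \<phi>: "\<phi> \<in> borel_measurable M"
    unfolding \<phi>_def using sub A by (subst (asm) measurable_restrict_space_iff[where c=0]) auto
  have "h \<in> restrict_space borel B \<rightarrow>\<^sub>M M"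
    using measurable_compose[OF h, of "\<lambda>x. x" M] rr
      measurable_cong_sets[OF restrict_space_sets_cong[OF refl sets_lborel, of B] refl, of M]
    by (simp add: measurable_restrict_space1)
  then have \<psi>: "\<psi> \<in> borel \<rightarrow>\<^sub>M M"
    unfolding \<psi>_def using B' x0 by (subst (asm) measurable_restrict_space_iff[where c=x0]) auto
  have "borel_coding M A \<phi> \<psi>"
    unfolding borel_coding_def using \<phi> \<psi> A fB B'(2) hf
    by (force simp: \<phi>_def \<psi>_def)
  moreover have "AE x in M. x \<in> A"
    using null A sub by (intro AE_I[of _ _ "space M - A"]) auto
  moreover have "emeasure M {x \<in> A. \<phi> x = t} = 0" for t
  proof (cases "t \<in> B")
    case True
    have "emeasure M {x \<in> A. \<phi> x = t} = emeasure (restrict_space M A) (f -` {t} \<inter> space (restrict_space M A))"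
      using sub by (subst emeasure_restrict_space)
        (auto simp: space_restrict_space \<phi>_def intro!: arg_cong[where f="emeasure M"])
    also have "\<dots> = emeasure (distr (restrict_space M A) (restrict_space unit_interval B) f) {t}"
      using True B' by (subst emeasure_distr[OF f]) (auto simp: rr sets_restrict_space intro!: image_eqI[of _ _ "{t}"])
    also have "\<dots> = 0"
      unfolding d unfolding rr using B' True by (subst emeasure_restrict_space) auto
    finally show ?thesis .
  next
    case False
    then have e: "{x \<in> A. \<phi> x = t} = {}" using fB by (auto simp: \<phi>_def)
    show ?thesis unfolding e by simp
  qed
  ultimately show thesis using that by blast
qed

lemma std_nonatomic_coding:
  assumes "std_nonatomic_prob_space M"
  obtains A \<phi> \<psi> where "borel_coding M A \<phi> \<psi>" "AE x in M. x \<in> A"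
    "\<And>t. emeasure M {x \<in> A. \<phi> x = t} = 0"
  using assms iso_mod0_unit_interval_coding unfolding std_nonatomic_prob_space_def by blast

text \<open>Only an atom at \<open>I u\<close> could make \<open>u \<le> C (I u)\<close> strict: to
  the left of \<open>I u\<close> the distribution function is at most \<open>u\<close>, and without
  the atom it is continuous there.\<close>

lemma (in cdf_distribution) cdf_quantile:
  assumes "measure M {I u} = 0" "0 < u" "u < 1"
  shows "C (I u) = u"
proof (rule antisym)
  show "u \<le> C (I u)" using pseudoinverse[of u "I u"] assms by simp
  have "(C \<longlongrightarrow> C (I u)) (at_left (I u))"
    using isCont_cdf[of "I u"] assms by (auto simp: isCont_def intro: filterlim_mono at_le)
  moreover have "C x \<le> u" if "x < I u" for x
    using pseudoinverse[OF assms(2,3), of x] that by linarith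
  then have "eventually (\<lambda>x. C x \<le> u) (at_left (I u))"
    by (intro eventually_at_leftI[of "I u - 1"]) auto
  ultimately show "C (I u) \<le> u"
    by (rule tendsto_upperbound) simp
qed

text \<open>The classical isomorphism for nonatomic laws on the line: the distribution function of
  the law of \<open>\<phi>\<close> carries it to Lebesgue measure and the quantile function inverts
  this almost everywhere. Composed with the coding, these are the two maps that
  \<open>iso_mod0\<close> asks for.\<close>

lemma std_nonatomicI:
  assumes "prob_space M" and cod: "borel_coding M A \<phi> \<psi>" and A_AE: "AE x in M. x \<in> A"
    and fib: "\<And>t. emeasure M {x \<in> A. \<phi> x = t} = 0"
  shows "std_nonatomic_prob_space M"
proof -
  interpret prob_space M by fact
  note [measurable] = borel_codingD(1-3)[OF cod]
  define \<mu> where "\<mu> = distr M borel \<phi>"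
  interpret \<mu>: cdf_distribution \<mu>
    unfolding \<mu>_def cdf_distribution_def by simp
  have sub: "A \<subseteq> space M" by (rule sets.sets_into_space) measurable
  have atom: "measure \<mu> {t} = 0" for t
  proof -
    have "measure \<mu> {t} = measure M {x \<in> space M. \<phi> x = t}"
      unfolding \<mu>_def by (subst measure_distr) (auto intro!: arg_cong[where f="measure M"])
    also have "\<dots> = measure M {x \<in> A. \<phi> x = t}"
      using A_AE sub by (intro finite_measure_eq_AE) auto
    finally show ?thesis using fib[of t] by (simp add: measure_def)
  qed
  have CI: "\<mu>.C (\<mu>.I u) = u" if "0 < u" "u < 1" for u
    using \<mu>.cdf_quantile[OF atom that] .
  \<comment> \<open>The quantile function is meaningful only on the open unit interval; the value 0
    elsewhere turns it into a total Borel function.\<close>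
  define q where "q u = (if u \<in> {0<..<1} then \<mu>.I u else 0)" for u
  have q [measurable]: "q \<in> borel_measurable borel"
    using \<mu>.measurable_CI unfolding q_def by (subst (asm) measurable_restrict_space_iff[where c=0]) auto
  have Cq: "\<mu>.C (q u) = u" if "u \<in> {0<..<1}" for u
    using CI that by (auto simp: q_def)
  have \<mu>_q: "\<mu> = distr (restrict_space lborel {0<..<1}) borel q"
    by (rule trans[OF \<mu>.distr_I_eq_M[symmetric] distr_cong]) (auto simp: q_def space_restrict_space)
  have q_meas: "q \<in> borel_measurable (restrict_space lborel {0<..<1})"
    by (intro measurable_restrict_space1) simp
  have em: "emeasure \<mu> Y = emeasure M (\<phi> -` Y \<inter> space M)" if "Y \<in> sets borel" for Y
    unfolding \<mu>_def using that by (intro emeasure_distr) auto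
  have emq: "emeasure \<mu> Y = emeasure lborel {u \<in> {0<..<1}. q u \<in> Y}" if "Y \<in> sets borel" for Y
  proof -
    have "emeasure \<mu> Y = emeasure (restrict_space lborel {0<..<1}) (q -` Y \<inter> {0<..<1})"
      by (subst \<mu>_q, subst emeasure_distr[OF q_meas]) (use that in \<open>auto simp: space_restrict_space\<close>)
    also have "\<dots> = emeasure lborel (q -` Y \<inter> {0<..<1})"
      by (rule emeasure_restrict_space) auto
    also have "q -` Y \<inter> {0<..<1} = {u \<in> {0<..<1}. q u \<in> Y}" by auto
    finally show ?thesis .
  qed
  \<comment> \<open>\<open>A'\<close> and \<open>B\<close> collect the points at which the two
    composed maps invert each other, so the maps restrict to bijections between them.\<close>
  define A' where "A' = {x \<in> A. \<mu>.C (\<phi> x) \<in> {0<..<1} \<and> q (\<mu>.C (\<phi> x)) = \<phi> x}"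
  define B where "B = {u \<in> {0<..<1}. \<psi> (q u) \<in> A \<and> \<phi> (\<psi> (q u)) = q u}"
  have A' [measurable]: "A' \<in> sets M"
  proof -
    have "A' = A \<inter> {x \<in> space M. \<mu>.C (\<phi> x) \<in> {0<..<1} \<and> q (\<mu>.C (\<phi> x)) = \<phi> x}"
      using sub by (auto simp: A'_def)
    also have "\<dots> \<in> sets M" by measurable
    finally show ?thesis .
  qed
  have B [measurable]: "B \<in> sets borel"
  proof -
    have "B = {u \<in> space borel. u \<in> {0<..<1} \<and> \<psi> (q u) \<in> A \<and> \<phi> (\<psi> (q u)) = q u}"
      by (auto simp: B_def)
    also have "\<dots> \<in> sets borel" by measurable
    finally show ?thesis .
  qed
  have B01: "B \<subseteq> {0..1}" by (auto simp: B_def)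
  have A'_AE: "AE x in M. x \<in> A'"
  proof -
    \<comment> \<open>The identities hold at every value \<open>q u\<close>, because
      \<open>C (q u) = u\<close>, and \<open>\<mu>\<close>-almost every number is such a value,
      because \<open>\<mu>\<close> is the image of Lebesgue measure under \<open>q\<close>.\<close>
    have "AE u in restrict_space lborel {0<..<1}. \<mu>.C (q u) \<in> {0<..<1} \<and> q (\<mu>.C (q u)) = q u"
      by (rule AE_I2) (auto simp: space_restrict_space Cq)
    then have "AE t in \<mu>. \<mu>.C t \<in> {0<..<1} \<and> q (\<mu>.C t) = t"
      unfolding \<mu>_q by (subst AE_distr_iff[OF q_meas]) (auto simp: \<mu>_q[symmetric])
    then have "AE x in M. \<mu>.C (\<phi> x) \<in> {0<..<1} \<and> q (\<mu>.C (\<phi> x)) = \<phi> x"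
      by (subst (asm) \<mu>_def, subst (asm) AE_distr_iff) auto
    with A_AE show ?thesis by eventually_elim (auto simp: A'_def)
  qed
  have B_AE: "AE u in lborel. u \<in> {0..1} \<longrightarrow> u \<in> B"
  proof -
    have "AE x in M. \<psi> (\<phi> x) \<in> A \<and> \<phi> (\<psi> (\<phi> x)) = \<phi> x"
      using A_AE by eventually_elim (simp add: borel_codingD(6)[OF cod])
    then have "AE t in \<mu>. \<psi> t \<in> A \<and> \<phi> (\<psi> t) = t"
      unfolding \<mu>_def by (subst AE_distr_iff) auto
    then have "AE u in restrict_space lborel {0<..<1}. \<psi> (q u) \<in> A \<and> \<phi> (\<psi> (q u)) = q u"
      unfolding \<mu>_q by (subst (asm) AE_distr_iff[OF q_meas]) auto
    then have "AE u in lborel. u \<in> {0<..<1} \<longrightarrow> \<psi> (q u) \<in> A \<and> \<phi> (\<psi> (q u)) = q u"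
      by (subst (asm) AE_restrict_space_iff) auto
    moreover have "AE u in lborel. u \<noteq> (0::real)" "AE u in lborel. u \<noteq> (1::real)"
      by (rule AE_lborel_singleton)+
    ultimately show ?thesis by eventually_elim (auto simp: B_def)
  qed
  let ?f = "\<lambda>x. \<mu>.C (\<phi> x)" and ?h = "\<lambda>u. \<psi> (q u)"
  have rr: "restrict_space unit_interval B = restrict_space lborel B"
    unfolding unit_interval_def using B01 by (simp add: restrict_restrict_space Int_absorb1)
  have fB: "?f x \<in> B" if "x \<in> A'" for x
    using that by (auto simp: A'_def B_def borel_codingD(6)[OF cod])
  have hA: "?h u \<in> A'" if "u \<in> B" for u
    using that Cq[of u] by (auto simp: A'_def B_def)
  have hf: "?h (?f x) = x" if "x \<in> A'" for x
    using that by (auto simp: A'_def borel_codingD(6)[OF cod])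
  have fh: "?f (?h u) = u" if "u \<in> B" for u
    using that Cq[of u] by (auto simp: B_def)
  have f: "?f \<in> restrict_space M A' \<rightarrow>\<^sub>M restrict_space unit_interval B"
    unfolding rr by (intro measurable_restrict_space2 measurable_restrict_space1)
      (auto simp: space_restrict_space fB)
  have h: "?h \<in> restrict_space unit_interval B \<rightarrow>\<^sub>M restrict_space M A'"
    unfolding rr by (intro measurable_restrict_space2 measurable_restrict_space1)
      (auto simp: space_restrict_space hA)
  have d: "distr (restrict_space M A') (restrict_space unit_interval B) ?f
             = restrict_space unit_interval B"
  proof (rule measure_eqI)
    fix X assume "X \<in> sets (distr (restrict_space M A') (restrict_space unit_interval B) ?f)"
    then have X: "X \<in> sets (restrict_space unit_interval B)" by simp
    then have XB: "X \<in> sets borel" "X \<subseteq> B"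
      using B unfolding rr by (auto simp: sets_restrict_space)
    note [measurable] = XB(1)
    have "emeasure (distr (restrict_space M A') (restrict_space unit_interval B) ?f) X
        = emeasure (restrict_space M A') (?f -` X \<inter> space (restrict_space M A'))"
      by (rule emeasure_distr[OF f X])
    also have "\<dots> = emeasure M (?f -` X \<inter> space (restrict_space M A'))"
      by (intro emeasure_restrict_space) (auto simp: space_restrict_space)
    also have "\<dots> = emeasure M {x \<in> space M. ?f x \<in> X}"
    proof (rule emeasure_eq_AE)
      have "?f -` X \<inter> space (restrict_space M A') = A' \<inter> {x \<in> space M. ?f x \<in> X}"
        using sub by (auto simp: space_restrict_space A'_def)
      also have "\<dots> \<in> sets M" by measurable
      finally show "?f -` X \<inter> space (restrict_space M A') \<in> sets M" .
      show "AE x in M. x \<in> ?f -` X \<inter> space (restrict_space M A')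
              \<longleftrightarrow> x \<in> {x \<in> space M. ?f x \<in> X}"
        using A'_AE by eventually_elim (use sub in \<open>auto simp: space_restrict_space A'_def\<close>)
    qed measurable
    also have "{x \<in> space M. ?f x \<in> X} = \<phi> -` {t. \<mu>.C t \<in> X} \<inter> space M"
      by auto
    also have "emeasure M \<dots> = emeasure \<mu> {t. \<mu>.C t \<in> X}"
      by (rule em[symmetric]) measurable
    also have "\<dots> = emeasure lborel {u \<in> {0<..<1}. \<mu>.C (q u) \<in> X}"
      by (subst emq) auto
    also have "{u \<in> {0<..<1}. \<mu>.C (q u) \<in> X} = X"
      using XB(2) by (auto simp: Cq B_def subset_eq)
    also have "emeasure lborel X = emeasure (restrict_space unit_interval B) X"
      unfolding rr using XB B by (subst emeasure_restrict_space) auto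
    finally show "emeasure (distr (restrict_space M A') (restrict_space unit_interval B) ?f) X
      = emeasure (restrict_space unit_interval B) X" .
  qed simp
  have "emeasure M (space M - A') = 0"
    using A'_AE by (subst (asm) AE_iff_measurable[of "space M - A'"]) auto
  moreover have "emeasure unit_interval (space unit_interval - B) = 0"
  proof -
    have "AE u in unit_interval. u \<in> B"
      unfolding unit_interval_def using B_AE by (subst AE_restrict_space_iff) auto
    moreover have "B \<in> sets unit_interval"
      using B B01 by (auto simp: unit_interval_def sets_restrict_space)
    ultimately show ?thesis
      by (subst (asm) AE_iff_measurable[of "space unit_interval - B"]) auto
  qed
  moreover have "B \<in> sets unit_interval"
    using B B01 by (auto simp: unit_interval_def sets_restrict_space)
  ultimately have "iso_mod0 M unit_interval"
    unfolding iso_mod0_def using A' f h hf fh d by blast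
  then show ?thesis
    using \<open>prob_space M\<close> by (simp add: std_nonatomic_prob_space_def)
qed

lemma group_action_restrictI:
  assumes "group G"
    and closed: "\<And>g x. g \<in> carrier G \<Longrightarrow> x \<in> E \<Longrightarrow> T g x \<in> E"
    and one: "\<And>x. x \<in> E \<Longrightarrow> T \<one>\<^bsub>G\<^esub> x = x"
    and mult: "\<And>g h x. g \<in> carrier G \<Longrightarrow> h \<in> carrier G \<Longrightarrow> x \<in> E \<Longrightarrow> T (g \<otimes>\<^bsub>G\<^esub> h) x = T g (T h x)"
  shows "group_action G E (\<lambda>g. restrict (T g) E)"
proof -
  interpret group G by fact
  have Bij: "restrict (T g) E \<in> Bij E" if g: "g \<in> carrier G" for g
  proof -
    have "bij_betw (T g) E E"
    proof (rule bij_betw_byWitness[where f'="T (inv\<^bsub>G\<^esub> g)"])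
      show "\<forall>x\<in>E. T (inv\<^bsub>G\<^esub> g) (T g x) = x"
        using g one mult[of "inv\<^bsub>G\<^esub> g" g] by simp
      show "\<forall>x\<in>E. T g (T (inv\<^bsub>G\<^esub> g) x) = x"
        using g one mult[of g "inv\<^bsub>G\<^esub> g"] by simp
    qed (use g closed in auto)
    then show ?thesis by (simp add: Bij_def)
  qed
  have "(\<lambda>g. restrict (T g) E) \<in> hom G (BijGroup E)"
  proof (rule homI)
    fix g h assume gh: "g \<in> carrier G" "h \<in> carrier G"
    have "restrict (T (g \<otimes>\<^bsub>G\<^esub> h)) E = compose E (restrict (T g) E) (restrict (T h) E)"
      using gh by (auto simp: compose_def closed mult)
    then show "restrict (T (g \<otimes>\<^bsub>G\<^esub> h)) E = restrict (T g) E \<otimes>\<^bsub>BijGroup E\<^esub> restrict (T h) E"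
      using Bij gh by (simp add: BijGroup_def)
  qed (simp add: BijGroup_def Bij)
  then show ?thesis
    by (simp add: group_action_def group_hom_def group_hom_axioms_def group_BijGroup assms(1))
qed

lemma group_action_restrictD:
  assumes act: "group_action G E (\<lambda>g. restrict (T g) E)"
  shows "\<And>g x. g \<in> carrier G \<Longrightarrow> x \<in> E \<Longrightarrow> T g x \<in> E"
    and "\<And>x. x \<in> E \<Longrightarrow> T \<one>\<^bsub>G\<^esub> x = x"
    and "\<And>g h x. g \<in> carrier G \<Longrightarrow> h \<in> carrier G \<Longrightarrow> x \<in> E \<Longrightarrow> T (g \<otimes>\<^bsub>G\<^esub> h) x = T g (T h x)"
proof -
  interpret group_action G E "\<lambda>g. restrict (T g) E" by fact
  show cl: "T g x \<in> E" if "g \<in> carrier G" "x \<in> E" for g x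
    using element_image[OF that refl] that by simp
  show "T \<one>\<^bsub>G\<^esub> x = x" if "x \<in> E" for x
    using id_eq_one that by (metis restrict_apply')
  show "T (g \<otimes>\<^bsub>G\<^esub> h) x = T g (T h x)" if "g \<in> carrier G" "h \<in> carrier G" "x \<in> E" for g h x
    using composition_rule[OF that(3,1,2)] that cl by simp
qed

subsection \<open>Systems and joinings\<close>

lemma distr_pair_snd:
  assumes "prob_space M" "sigma_finite_measure N"
  shows "distr (M \<Otimes>\<^sub>M N) N snd = N"
proof -
  interpret M: prob_space M by fact
  interpret N: sigma_finite_measure N by fact
  show ?thesis
  proof (rule measure_eqI)
    fix A assume A: "A \<in> sets (distr (M \<Otimes>\<^sub>M N) N snd)"
    then have "snd -` A \<inter> space (M \<Otimes>\<^sub>M N) = space M \<times> A"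
      by (auto simp: space_pair_measure dest: sets.sets_into_space)
    with A show "emeasure (distr (M \<Otimes>\<^sub>M N) N snd) A = emeasure N A"
      by (simp add: emeasure_distr N.emeasure_pair_measure_Times M.emeasure_space_1)
  qed simp
qed

lemma pmp_systemsD:
  assumes "(M, T) \<in> pmp_systems G"
  shows "std_nonatomic_prob_space M" "prob_space M"
    and "\<And>g. g \<in> carrier G \<Longrightarrow> T g \<in> M \<rightarrow>\<^sub>M M"
    and "\<And>g. g \<in> carrier G \<Longrightarrow> distr M M (T g) = M"
    and "\<And>g x. g \<in> carrier G \<Longrightarrow> x \<in> space M \<Longrightarrow> T g x \<in> space M"
    and "\<And>x. x \<in> space M \<Longrightarrow> T \<one>\<^bsub>G\<^esub> x = x"
    and "\<And>g h x. g \<in> carrier G \<Longrightarrow> h \<in> carrier G \<Longrightarrow> x \<in> space M \<Longrightarrow>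
           T (g \<otimes>\<^bsub>G\<^esub> h) x = T g (T h x)"
  using assms group_action_restrictD[of G "space M" T]
  unfolding pmp_systems_def std_nonatomic_prob_space_def by auto

lemma product_action:
  assumes "group G" "(M, T) \<in> pmp_systems G" "(N, S) \<in> pmp_systems G"
    and sp: "space K = space M \<times> space N"
  shows "group_action G (space K) (\<lambda>g. restrict (\<lambda>(x, y). (T g x, S g y)) (space K))"
  unfolding sp
proof (rule group_action_restrictI[OF assms(1)])
  fix g h p assume g: "g \<in> carrier G" and h: "h \<in> carrier G" and p: "p \<in> space M \<times> space N"
  then obtain x y where [simp]: "p = (x, y)" and xy: "x \<in> space M" "y \<in> space N" by auto
  show "(case p of (x, y) \<Rightarrow> (T (g \<otimes>\<^bsub>G\<^esub> h) x, S (g \<otimes>\<^bsub>G\<^esub> h) y))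
      = (case case p of (x, y) \<Rightarrow> (T h x, S h y) of (x, y) \<Rightarrow> (T g x, S g y))"
    using pmp_systemsD(7)[OF assms(2) g h xy(1)] pmp_systemsD(7)[OF assms(3) g h xy(2)] by simp
qed (auto simp: pmp_systemsD(5,6)[OF assms(2)] pmp_systemsD(5,6)[OF assms(3)])

lemma measurable_product_action:
  assumes "(M, T) \<in> pmp_systems G" "(N, S) \<in> pmp_systems G" "g \<in> carrier G"
  shows "(\<lambda>(x, y). (T g x, S g y)) \<in> M \<Otimes>\<^sub>M N \<rightarrow>\<^sub>M M \<Otimes>\<^sub>M N"
proof -
  note [measurable] = pmp_systemsD(3)[OF assms(1,3)] pmp_systemsD(3)[OF assms(2,3)]
  show ?thesis by measurable
qed

lemma distr_product_action:
  assumes "(M, T) \<in> pmp_systems G" "(N, S) \<in> pmp_systems G" "g \<in> carrier G"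
  shows "distr (M \<Otimes>\<^sub>M N) (M \<Otimes>\<^sub>M N) (\<lambda>(x, y). (T g x, S g y)) = M \<Otimes>\<^sub>M N"
proof -
  interpret N: prob_space N using pmp_systemsD(2)[OF assms(2)] .
  show ?thesis
    using pair_measure_distr[OF pmp_systemsD(3)[OF assms(1,3)] pmp_systemsD(3)[OF assms(2,3)]]
      pmp_systemsD(4)[OF assms(1,3)] pmp_systemsD(4)[OF assms(2,3)] N.sigma_finite_measure_axioms
    by simp
qed

lemma prob_space_pair:
  assumes "prob_space M" "prob_space N" shows "prob_space (M \<Otimes>\<^sub>M N)"
proof -
  interpret pair_prob_space M N
    using assms by (simp add: pair_prob_space_def pair_sigma_finite_def prob_space_imp_sigma_finite)
  show ?thesis by unfold_locales
qed

lemma product_in_joinings: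
  assumes "(M, T) \<in> pmp_systems G" "(N, S) \<in> pmp_systems G"
  shows "M \<Otimes>\<^sub>M N \<in> joinings G (M, T) (N, S)"
proof -
  note prob = pmp_systemsD(2)[OF assms(1)] pmp_systemsD(2)[OF assms(2)]
  show ?thesis
    unfolding joinings.simps
    by (intro CollectI conjI ballI prob_space_pair prob refl prob_space.distr_pair_fst distr_pair_snd
        prob_space_imp_sigma_finite distr_product_action[OF assms])
qed

lemma joiningsD:
  assumes "J \<in> joinings G (M, T) (N, S)"
  shows "prob_space J" "sets J = sets (M \<Otimes>\<^sub>M N)" "distr J M fst = M" "distr J N snd = N"
    and "\<And>g. g \<in> carrier G \<Longrightarrow> distr J J (\<lambda>(x, z). (T g x, S g z)) = J"
  using assms unfolding joinings.simps by blast+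

lemma disjoint_systemsD:
  "disjoint_systems G (M, T) (N, S) \<Longrightarrow> J \<in> joinings G (M, T) (N, S) \<Longrightarrow> J = M \<Otimes>\<^sub>M N"
  unfolding disjoint_systems_def fst_conv by blast

lemma AE_measure_preserving:
  assumes "f \<in> M \<rightarrow>\<^sub>M N" "distr M N f = N" "AE y in N. P y"
  shows "AE x in M. P (f x)"
  using assms(3) by (intro AE_distrD[OF assms(1)]) (simp only: assms(2))

text \<open>The coded set is cut down to the points whose whole orbit stays in it; countability of
  the group keeps the smaller set measurable and of full measure.\<close>

lemma invariant_coding:
  assumes "group G" "countable (carrier G)" and sys: "(P, R) \<in> pmp_systems G"
  obtains A \<phi> \<psi> where "borel_coding P A \<phi> \<psi>" "AE x in P. x \<in> A"
    "\<And>t. emeasure P {x \<in> A. \<phi> x = t} = 0" "\<And>g x. g \<in> carrier G \<Longrightarrow> x \<in> A \<Longrightarrow> R g x \<in> A"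
proof -
  interpret group G by fact
  note D = pmp_systemsD[OF sys]
  interpret prob_space P by (rule D)
  note [measurable] = D(3)
  obtain B \<phi> \<psi> where c: "borel_coding P B \<phi> \<psi>" and B_AE: "AE x in P. x \<in> B"
    and fib: "\<And>t. emeasure P {x \<in> B. \<phi> x = t} = 0"
    using std_nonatomic_coding[OF D(1)] by blast
  note [measurable] = borel_codingD(1-3)[OF c]
  define A where "A = {x \<in> space P. \<forall>g\<in>carrier G. R g x \<in> B}"
  have A: "A \<in> sets P"
  proof -
    have "A = (\<Inter>g\<in>carrier G. R g -` B \<inter> space P)" unfolding A_def using one_closed by blast
    also have "\<dots> \<in> sets P" using assms(2) one_closed by (intro sets.countable_INT') auto
    finally show ?thesis .
  qed
  have AB: "A \<subseteq> B" unfolding A_def using one_closed D(6) by force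
  have "AE x in P. \<forall>g\<in>carrier G. R g x \<in> B"
    using assms(2) AE_measure_preserving[OF D(3,4) B_AE] by (simp add: AE_ball_countable)
  then have "AE x in P. x \<in> A"
    by (rule AE_mp) (auto simp: A_def intro!: AE_I2)
  moreover have "borel_coding P A \<phi> \<psi>"
    using c A AB by (auto simp: borel_coding_def)
  moreover have "emeasure P {x \<in> A. \<phi> x = t} = 0" for t
  proof -
    have "{x \<in> B. \<phi> x = t} = B \<inter> {x \<in> space P. \<phi> x = t}"
      using borel_codingD(1)[OF c] sets.sets_into_space by blast
    then have "{x \<in> B. \<phi> x = t} \<in> sets P" by simp
    then have "emeasure P {x \<in> A. \<phi> x = t} \<le> emeasure P {x \<in> B. \<phi> x = t}"
      using AB by (intro emeasure_mono) auto
    then show ?thesis by (simp add: fib)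
  qed
  moreover have "R g x \<in> A" if "g \<in> carrier G" "x \<in> A" for g x
  proof -
    have "x \<in> space P" using that(2) by (simp add: A_def)
    moreover have "R h (R g x) \<in> B" if "h \<in> carrier G" for h
    proof -
      have "R (h \<otimes>\<^bsub>G\<^esub> g) x \<in> B" using that \<open>g \<in> carrier G\<close> \<open>x \<in> A\<close> by (auto simp: A_def)
      then show ?thesis using D(7)[OF that \<open>g \<in> carrier G\<close> \<open>x \<in> space P\<close>] by simp
    qed
    ultimately show ?thesis using D(5) that(1) by (auto simp: A_def)
  qed
  ultimately show thesis using that by blast
qed

text \<open>A coding must take values in the unit interval at every point of the space, hence the
  clamping in place of the identity.\<close>

lemma borel_coding_clamp:
  "borel_coding borel {0..1} (\<lambda>t. max 0 (min 1 t)) (\<lambda>t. t)"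
  unfolding borel_coding_def by auto

text \<open>The law of a coding lives on the real line and is therefore among the systems that
  \<open>ergodic_perp\<close> quantifies over. Starting from an invariant coded set makes the
  conjugated maps obey the group law exactly, not merely almost everywhere.\<close>

lemma real_copy:
  assumes "group G" "countable (carrier G)" and erg: "(P, R) \<in> ergodic_systems G"
  obtains \<phi> \<psi> P' R' where "(P', R') \<in> ergodic_systems G"
    "\<phi> \<in> P \<rightarrow>\<^sub>M P'" "\<psi> \<in> P' \<rightarrow>\<^sub>M P" "distr P P' \<phi> = P'"
    "AE x in P. \<psi> (\<phi> x) = x"
    "\<And>g. g \<in> carrier G \<Longrightarrow> AE x in P. R' g (\<phi> x) = \<phi> (R g x)"
    "sets P' = sets (borel :: real measure)"
proof -
  interpret group G by fact
  have sys: "(P, R) \<in> pmp_systems G"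
    and erg': "\<And>A. A \<in> sets P \<Longrightarrow> \<forall>g\<in>carrier G. R g -` A \<inter> space P = A \<Longrightarrow>
      measure P A = 0 \<or> measure P A = 1"
    using erg unfolding ergodic_systems_def by auto
  note D = pmp_systemsD[OF sys]
  interpret prob_space P by (rule D)
  obtain A \<phi> \<psi> where c: "borel_coding P A \<phi> \<psi>" and A_AE: "AE x in P. x \<in> A"
    and fib: "\<And>t. emeasure P {x \<in> A. \<phi> x = t} = 0"
    and inv: "\<And>g x. g \<in> carrier G \<Longrightarrow> x \<in> A \<Longrightarrow> R g x \<in> A"
    by (rule invariant_coding[OF assms(1,2) sys]) (rule that)
  note C = borel_codingD[OF c]
  note [measurable] = C(1-3) D(3)
  have sub: "A \<subseteq> space P" by (rule sets.sets_into_space) measurable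
  define P' where "P' = distr P borel \<phi>"
  \<comment> \<open>This is the image of \<open>A\<close> under \<open>\<phi>\<close>, written so
    that it is visibly Borel. Off \<open>L\<close> the copy acts as the identity, so the action laws
    hold at every real number.\<close>
  define L where "L = {t. \<psi> t \<in> A \<and> \<phi> (\<psi> t) = t}"
  define R' where "R' g t = (if t \<in> L then \<phi> (R g (\<psi> t)) else t)" for g t
  interpret P': prob_space P' unfolding P'_def by (rule prob_space_distr) measurable
  have sets_P' [measurable_cong]: "sets P' = sets borel" and space_P': "space P' = UNIV"
    by (simp_all add: P'_def)
  have L [measurable]: "L \<in> sets borel"
  proof -
    have "L = {t \<in> space borel. \<psi> t \<in> A \<and> \<phi> (\<psi> t) = t}" by (simp add: L_def)
    also have "\<dots> \<in> sets borel" by measurable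
    finally show ?thesis .
  qed
  have \<phi>_L: "\<phi> x \<in> L" if "x \<in> A" for x using that C(6) by (simp add: L_def)
  have L_\<psi>: "\<psi> t \<in> A" "\<phi> (\<psi> t) = t" if "t \<in> L" for t using that by (auto simp: L_def)
  have R'_\<phi>: "R' g (\<phi> x) = \<phi> (R g x)" if "x \<in> A" for g x
    using that by (simp add: R'_def \<phi>_L C(6))
  have act: "group_action G (space P') (\<lambda>g. restrict (R' g) (space P'))"
  proof (rule group_action_restrictI[OF assms(1)])
    show "R' \<one>\<^bsub>G\<^esub> t = t" for t
      using D(6) by (simp add: R'_def L_\<psi> C(7))
    fix g h t assume gh: "g \<in> carrier G" "h \<in> carrier G"
    show "R' (g \<otimes>\<^bsub>G\<^esub> h) t = R' g (R' h t)"
    proof (cases "t \<in> L")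
      case True
      then have "R' h t = \<phi> (R h (\<psi> t))" "R h (\<psi> t) \<in> A"
        using gh inv L_\<psi> by (auto simp: R'_def)
      then show ?thesis
        using True R'_\<phi>[of "R h (\<psi> t)" g] D(7)[OF gh C(7)] by (simp add: R'_def)
    qed (simp add: R'_def)
  qed (simp add: space_P')
  have R'_meas: "R' g \<in> P' \<rightarrow>\<^sub>M P'" if "g \<in> carrier G" for g
  proof -
    have [measurable]: "R g \<in> P \<rightarrow>\<^sub>M P" using D(3) that .
    show ?thesis unfolding R'_def by measurable
  qed
  have eqv: "AE x in P. R' g (\<phi> x) = \<phi> (R g x)" for g
    using A_AE by eventually_elim (rule R'_\<phi>)
  have R'_inv: "distr P' P' (R' g) = P'" if g: "g \<in> carrier G" for g
  proof -
    note [measurable] = D(3)[OF g]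
    have [measurable]: "R' g \<in> borel_measurable borel"
      using R'_meas[OF g] measurable_cong_sets[OF sets_P' sets_P'] by simp
    have "distr P' P' (R' g) = distr P' borel (R' g)"
      by (rule distr_cong) (simp_all add: sets_P')
    also have "\<dots> = distr P borel (R' g \<circ> \<phi>)"
      unfolding P'_def by (rule distr_distr) measurable
    also have "\<dots> = distr P borel (\<phi> \<circ> R g)"
    proof (rule distr_cong_AE)
      show "AE x in P. (R' g \<circ> \<phi>) x = (\<phi> \<circ> R g) x"
        using eqv by (simp add: comp_def)
    qed measurable
    also have "\<dots> = distr (distr P P (R g)) borel \<phi>"
      by (rule distr_distr[symmetric]) measurable
    finally show ?thesis by (simp add: D(4)[OF g] P'_def)
  qed
  have "std_nonatomic_prob_space P'"
  proof (rule std_nonatomicI)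
    show "borel_coding P' {0..1} (\<lambda>t. max 0 (min 1 t)) (\<lambda>t. t)"
      using borel_coding_clamp borel_coding_cong[OF sets_P'] by blast
    show "AE t in P'. t \<in> {0..1}"
      unfolding P'_def by (subst AE_distr_iff) (auto intro!: AE_I2 C(4,5))
    show "emeasure P' {x \<in> {0..1}. max 0 (min 1 x) = t} = 0" for t
    proof -
      have "emeasure P' {x \<in> {0..1}. max 0 (min 1 x) = t} \<le> emeasure P' {t}"
        by (intro emeasure_mono) (auto simp: sets_P')
      also have "\<dots> = emeasure P (\<phi> -` {t} \<inter> space P)"
        unfolding P'_def by (intro emeasure_distr) auto
      also have "\<dots> = emeasure P {x \<in> A. \<phi> x = t}"
      proof (rule emeasure_eq_AE)
        show "AE x in P. x \<in> \<phi> -` {t} \<inter> space P \<longleftrightarrow> x \<in> {x \<in> A. \<phi> x = t}"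
          using A_AE by eventually_elim (use sub in auto)
        have "{x \<in> A. \<phi> x = t} = A \<inter> {x \<in> space P. \<phi> x = t}" using sub by auto
        also have "\<dots> \<in> sets P" by measurable
        finally show "{x \<in> A. \<phi> x = t} \<in> sets P" .
      qed measurable
      finally show ?thesis by (simp add: fib)
    qed
  qed (rule P'.prob_space_axioms)
  with act R'_meas R'_inv have pmp': "(P', R') \<in> pmp_systems G"
    unfolding pmp_systems_def by blast
  have "measure P' B = 0 \<or> measure P' B = 1"
    if B: "B \<in> sets P'" and B_inv: "\<forall>g\<in>carrier G. R' g -` B \<inter> space P' = B" for B
  proof -
    have [measurable]: "B \<in> sets borel" using B by (simp add: sets_P')
    \<comment> \<open>Intersecting with \<open>A\<close> makes the pullback of \<open>B\<close>
      exactly invariant, as the definition of ergodicity demands, and changes it only by a null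
      set.\<close>
    define E where "E = {x \<in> A. \<phi> x \<in> B}"
    have E: "E = A \<inter> (\<phi> -` B \<inter> space P)" using sub by (auto simp: E_def)
    have "E \<in> sets P" unfolding E by measurable
    moreover have "R g -` E \<inter> space P = E" if g: "g \<in> carrier G" for g
    proof -
      have *: "\<phi> (R g x) \<in> B \<longleftrightarrow> \<phi> x \<in> B" if "x \<in> A" for x
      proof -
        have "R' g -` B = B" using B_inv g by (simp add: space_P')
        then have "\<phi> x \<in> B \<longleftrightarrow> R' g (\<phi> x) \<in> B" by blast
        then show ?thesis by (simp add: R'_\<phi>[OF that])
      qed
      have "x \<in> A" if "x \<in> space P" "R g x \<in> A" for x
      proof -
        have "R (inv\<^bsub>G\<^esub> g) (R g x) \<in> A" using inv that g by simp
        then show ?thesis using D(7)[of "inv\<^bsub>G\<^esub> g" g x] D(6) that g by simp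
      qed
      then show ?thesis using * inv[OF g] sub by (auto simp: E_def)
    qed
    ultimately have "measure P E = 0 \<or> measure P E = 1" using erg' by blast
    moreover have "measure P' B = measure P (\<phi> -` B \<inter> space P)"
      unfolding P'_def by (intro measure_distr) auto
    moreover have "measure P (\<phi> -` B \<inter> space P) = measure P E"
      by (rule finite_measure_eq_AE)
        (use A_AE \<open>E \<in> sets P\<close> in \<open>auto simp: E elim: eventually_mono\<close>)
    ultimately show ?thesis by simp
  qed
  with pmp' have "(P', R') \<in> ergodic_systems G" unfolding ergodic_systems_def by blast
  moreover have "\<phi> \<in> P \<rightarrow>\<^sub>M P'" "\<psi> \<in> P' \<rightarrow>\<^sub>M P" "distr P P' \<phi> = P'"
    by (measurable, simp add: P'_def cong: distr_cong)
  moreover have "AE x in P. \<psi> (\<phi> x) = x"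
    using A_AE by eventually_elim (rule C(6))
  ultimately show thesis using that eqv sets_P' by blast
qed

text \<open>Frees the type of the ergodic system, which will be needed for ergodic components on a
  product type. A joining is coded into a joining with the real copy, is a product there by
  hypothesis, and is decoded again.\<close>

lemma ergodic_perp_disjoint:
  fixes G :: "('g, 'm) monoid_scheme" and P :: "'b measure" and N :: "'a measure"
  assumes "group G" "countable (carrier G)" and erg: "(P, R) \<in> ergodic_systems G"
    and perp: "(N, S) \<in> ergodic_perp G"
  shows "disjoint_systems G (N, S) (P, R)"
proof -
  have sys: "(P, R) \<in> pmp_systems G" using erg unfolding ergodic_systems_def by auto
  have sysN: "(N, S) \<in> pmp_systems G" using perp unfolding ergodic_perp_def by auto
  note D = pmp_systemsD[OF sys] and DN = pmp_systemsD[OF sysN]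
  interpret P: prob_space P by (rule D)
  obtain \<phi> \<psi> P' R' where erg': "(P', R') \<in> ergodic_systems G"
    and [measurable]: "\<phi> \<in> P \<rightarrow>\<^sub>M P'" "\<psi> \<in> P' \<rightarrow>\<^sub>M P"
    and P': "distr P P' \<phi> = P'" and inverse: "AE x in P. \<psi> (\<phi> x) = x"
    and eqv: "\<And>g. g \<in> carrier G \<Longrightarrow> AE x in P. R' g (\<phi> x) = \<phi> (R g x)"
    and borel: "sets P' = sets (borel :: real measure)"
    by (rule real_copy[OF assms(1,2) erg]) (rule that)
  have sys': "(P', R') \<in> pmp_systems G" using erg' unfolding ergodic_systems_def by auto
  note D' = pmp_systemsD[OF sys']
  have "disjoint_systems G (N, S) (P', R')"
    using perp erg' unfolding ergodic_perp_def by blast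
  then have disj: "J = N \<Otimes>\<^sub>M P'" if "J \<in> joinings G (N, S) (P', R')" for J
    using that by (rule disjoint_systemsD)
  have "J = N \<Otimes>\<^sub>M P" if J: "J \<in> joinings G (N, S) (P, R)" for J
  proof -
    note JD = joiningsD[OF J]
    interpret J: prob_space J by (rule JD)
    note [measurable_cong] = JD(2)
    have snd: "snd \<in> J \<rightarrow>\<^sub>M P" by measurable
    note AE_snd = AE_measure_preserving[OF snd JD(4)]
    define code where "code = (\<lambda>p. (fst p :: 'a, \<phi> (snd p)))"
    define J' where "J' = distr J (N \<Otimes>\<^sub>M P') code"
    have [measurable]: "code \<in> J \<rightarrow>\<^sub>M N \<Otimes>\<^sub>M P'"
      unfolding code_def by measurable
    have "J' \<in> joinings G (N, S) (P', R')"
      unfolding joinings.simps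
    proof (intro CollectI conjI ballI)
      show "prob_space J'" unfolding J'_def by (rule J.prob_space_distr) measurable
      show sets_J': "sets J' = sets (N \<Otimes>\<^sub>M P')" by (simp add: J'_def)
      have "distr J' N fst = distr J N (fst \<circ> code)"
        unfolding J'_def by (rule distr_distr) measurable
      also have "fst \<circ> code = fst" by (auto simp: code_def)
      finally show "distr J' N fst = N" by (simp add: JD(3))
      have "distr J' P' snd = distr J P' (snd \<circ> code)"
        unfolding J'_def by (rule distr_distr) measurable
      also have "snd \<circ> code = \<phi> \<circ> snd" by (auto simp: code_def)
      also have "distr J P' (\<phi> \<circ> snd) = distr (distr J P snd) P' \<phi>"
        by (rule distr_distr[symmetric]) measurable
      finally show "distr J' P' snd = P'" by (simp add: JD(4) P')
      fix g assume g: "g \<in> carrier G"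
      note [measurable] = DN(3)[OF g] D(3)[OF g] D'(3)[OF g]
      have "distr J' J' (\<lambda>(x, z). (S g x, R' g z))
          = distr J' (N \<Otimes>\<^sub>M P') (\<lambda>(x, z). (S g x, R' g z))"
        by (rule distr_cong) (simp_all add: sets_J')
      also have "\<dots> = distr J (N \<Otimes>\<^sub>M P') ((\<lambda>(x, z). (S g x, R' g z)) \<circ> code)"
        unfolding J'_def by (rule distr_distr) measurable
      also have "\<dots> = distr J (N \<Otimes>\<^sub>M P') (code \<circ> (\<lambda>(x, z). (S g x, R g z)))"
      proof (rule distr_cong_AE)
        show "AE p in J. ((\<lambda>(x, z). (S g x, R' g z)) \<circ> code) p
            = (code \<circ> (\<lambda>(x, z). (S g x, R g z))) p"
          using AE_snd[OF eqv[OF g]] by eventually_elim (auto simp: code_def)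
      qed (simp_all, measurable)
      also have "\<dots> = distr (distr J J (\<lambda>(x, z). (S g x, R g z))) (N \<Otimes>\<^sub>M P') code"
        by (rule distr_distr[symmetric]) measurable
      finally show "distr J' J' (\<lambda>(x, z). (S g x, R' g z)) = J'"
        unfolding JD(5)[OF g] J'_def .
    qed
    then have J': "J' = N \<Otimes>\<^sub>M P'" by (rule disj)
    have P_copy: "distr P' P \<psi> = P"
    proof -
      have "distr P' P \<psi> = distr P P (\<psi> \<circ> \<phi>)"
        by (subst P'[symmetric], rule distr_distr) measurable
      also have "\<dots> = distr P P (\<lambda>x. x)"
        by (rule distr_cong_AE) (use inverse in auto)
      finally show ?thesis by simp
    qed
    have "J = distr J (N \<Otimes>\<^sub>M P) (\<lambda>p. p)"
      using JD(2) by (simp add: distr_id2)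
    also have "\<dots> = distr J (N \<Otimes>\<^sub>M P) ((\<lambda>(x, z). (x, \<psi> z)) \<circ> code)"
    proof (rule distr_cong_AE)
      show "AE p in J. p = ((\<lambda>(x, z). (x, \<psi> z)) \<circ> code) p"
        using AE_snd[OF inverse] by eventually_elim (auto simp: code_def)
    qed (simp_all, measurable)
    also have "\<dots> = distr J' (N \<Otimes>\<^sub>M P) (\<lambda>(x, z). (x, \<psi> z))"
      unfolding J'_def by (rule distr_distr[symmetric]) measurable
    also have "\<dots> = N \<Otimes>\<^sub>M P"
      unfolding J' using pair_measure_distr[of "\<lambda>x. x" N N \<psi> P' P] P_copy
      by (simp add: P.sigma_finite_measure_axioms)
    finally show ?thesis .
  qed
  with product_in_joinings[OF sysN sys] show ?thesis
    unfolding disjoint_systems_def by auto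
qed

subsection \<open>Disintegration of measures\<close>

text \<open>Testing on the set where \<open>h < f\<close> forces \<open>f - h\<close> to have
  integral 0 there; the finite integral of \<open>f\<close> is what permits the subtraction.\<close>

lemma AE_le_if_set_nn_integral_le:
  assumes [measurable]: "f \<in> borel_measurable M" "h \<in> borel_measurable M"
    and fin: "(\<integral>\<^sup>+x. f x \<partial>M) \<noteq> \<infinity>"
    and le: "\<And>B. B \<in> sets M \<Longrightarrow> (\<integral>\<^sup>+x\<in>B. f x \<partial>M) \<le> (\<integral>\<^sup>+x\<in>B. h x \<partial>M)"
  shows "AE x in M. f x \<le> h x"
proof -
  define B where "B = {x \<in> space M. h x < f x}"
  have [measurable]: "B \<in> sets M" unfolding B_def by measurable
  have "(\<integral>\<^sup>+x\<in>B. h x \<partial>M) \<le> (\<integral>\<^sup>+x. f x \<partial>M)"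
    by (intro nn_integral_mono) (auto simp: B_def indicator_def)
  with fin have fin': "(\<integral>\<^sup>+x\<in>B. h x \<partial>M) \<noteq> \<infinity>"
    by (auto simp: top_unique)
  have "(\<integral>\<^sup>+x. f x * indicator B x - h x * indicator B x \<partial>M)
      = (\<integral>\<^sup>+x\<in>B. f x \<partial>M) - (\<integral>\<^sup>+x\<in>B. h x \<partial>M)"
    using fin' by (intro nn_integral_diff) (auto intro!: AE_I2 simp: B_def indicator_def)
  also have "\<dots> = 0"
  proof -
    have "(\<integral>\<^sup>+x\<in>B. f x \<partial>M) \<le> (\<integral>\<^sup>+x. f x \<partial>M)"
      by (intro nn_integral_mono) (auto simp: indicator_def)
    with fin have "(\<integral>\<^sup>+x\<in>B. f x \<partial>M) \<noteq> \<infinity>" by (auto simp: top_unique)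
    then show ?thesis using le[of B] by (simp add: diff_eq_0_iff_ennreal less_top[symmetric])
  qed
  finally have "AE x in M. f x * indicator B x - h x * indicator B x = 0"
    by (subst (asm) nn_integral_0_iff_AE) auto
  moreover have "AE x in M. f x \<noteq> \<infinity>"
    using fin by (intro nn_integral_PInf_AE) auto
  ultimately show ?thesis
  proof (rule AE_mp[OF AE_conjI], intro AE_I2 impI)
    fix x assume x: "x \<in> space M"
      and *: "f x * indicator B x - h x * indicator B x = 0 \<and> f x \<noteq> \<infinity>"
    show "f x \<le> h x"
    proof (rule ccontr)
      assume "\<not> f x \<le> h x"
      then have "x \<in> B" using x by (simp add: B_def)
      with * have "f x - h x = 0" "f x \<noteq> \<infinity>" by auto
      then show False using \<open>\<not> f x \<le> h x\<close> by (simp add: diff_eq_0_iff_ennreal)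
    qed
  qed
qed

text \<open>Distribution functions are right continuous, so their values at rational points
  approaching from above decide.\<close>

lemma finite_borel_measure_eqI_rat:
  fixes K K' :: "real measure"
  assumes "finite_borel_measure K" "finite_borel_measure K'"
    and eq: "\<And>q. q \<in> \<rat> \<Longrightarrow> emeasure K {..q} = emeasure K' {..q}"
  shows "K = K'"
proof (rule cdf_unique'[OF assms(1,2)], rule ext)
  fix u :: real
  interpret K: finite_borel_measure K by fact
  interpret K': finite_borel_measure K' by fact
  have "\<forall>n. \<exists>q\<in>\<rat>. u < q \<and> q < u + 1 / real (Suc n)"
    by (intro allI Rats_dense_in_real) simp
  then obtain r where r: "\<And>n. r n \<in> \<rat>" "\<And>n. u < r n" "\<And>n. r n < u + 1 / real (Suc n)"
    by metis
  have "(\<lambda>n. u + 1 / real (Suc n)) \<longlonglongrightarrow> u + 0"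
    by (intro tendsto_intros LIMSEQ_Suc[OF lim_1_over_n])
  then have "r \<longlonglongrightarrow> u"
    using r by (intro tendsto_sandwich[of "\<lambda>_. u" r _ "\<lambda>n. u + 1 / real (Suc n)" u])
      (auto intro!: always_eventually less_imp_le)
  then have r': "filterlim r (at_right u) sequentially"
    using r(2) by (auto simp: filterlim_at less_imp_neq[symmetric])
  have "(\<lambda>n. cdf K (r n)) \<longlonglongrightarrow> cdf K u"
    using K.cdf_is_right_cont[of u] filterlim_compose[OF _ r'] by (simp add: continuous_within)
  moreover have "(\<lambda>n. cdf K' (r n)) \<longlonglongrightarrow> cdf K' u"
    using K'.cdf_is_right_cont[of u] filterlim_compose[OF _ r'] by (simp add: continuous_within)
  moreover have "cdf K (r n) = cdf K' (r n)" for n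
    using eq[OF r(1)] by (simp add: cdf_def measure_def)
  ultimately show "cdf K u = cdf K' u"
    using LIMSEQ_unique by simp
qed

text \<open>Countably many test sets decide equality, so almost-everywhere equalities proved for one
  test set at a time combine into an equality of measures. The coding moves both measures to the
  line and back.\<close>

lemma borel_coding_eqI:
  assumes "finite_measure K" "finite_measure K'" and sets: "sets K = sets Y" "sets K' = sets Y"
    and c: "borel_coding Y A \<phi> \<psi>" and AE: "AE y in K. y \<in> A" "AE y in K'. y \<in> A"
    and eq: "\<And>q. q \<in> \<rat> \<Longrightarrow> emeasure K {y \<in> space Y. \<phi> y \<le> q} = emeasure K' {y \<in> space Y. \<phi> y \<le> q}"
  shows "K = K'"
proof -
  note C = borel_codingD[OF c]
  note [measurable_cong] = sets
  note [measurable] = C(1-3)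
  note space = sets_eq_imp_space_eq[OF sets(1)] sets_eq_imp_space_eq[OF sets(2)]
  have fb: "finite_borel_measure (distr L borel \<phi>)"
    if "finite_measure L" "sets L = sets Y" for L
  proof -
    have "\<phi> \<in> borel_measurable L" using C(2) that(2) by (simp cong: measurable_cong_sets)
    then show ?thesis
      using finite_measure.finite_measure_distr[OF that(1)]
      by (auto simp: finite_borel_measure_def finite_borel_measure_axioms_def)
  qed
  have "distr K borel \<phi> = distr K' borel \<phi>"
  proof (rule finite_borel_measure_eqI_rat)
    show "emeasure (distr K borel \<phi>) {..q} = emeasure (distr K' borel \<phi>) {..q}" if "q \<in> \<rat>" for q
    proof -
      have "\<phi> -` {..q} \<inter> space Y = {y \<in> space Y. \<phi> y \<le> q}" by auto
      then show ?thesis using eq[OF that] by (simp add: emeasure_distr space)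
    qed
  qed (use assms(1,2) sets in \<open>auto intro: fb\<close>)
  moreover have "L = distr (distr L borel \<phi>) Y \<psi>"
    if L: "sets L = sets Y" "AE y in L. y \<in> A" for L
  proof -
    note [measurable_cong] = L(1)
    have "L = distr L Y (\<lambda>y. y)" using L(1) by (simp add: distr_id2)
    also have "\<dots> = distr L Y (\<psi> \<circ> \<phi>)"
    proof (rule distr_cong_AE)
      show "AE y in L. y = (\<psi> \<circ> \<phi>) y" using L(2) by eventually_elim (simp add: C(6))
    qed (simp_all, measurable)
    also have "\<dots> = distr (distr L borel \<phi>) Y \<psi>"
      by (rule distr_distr[symmetric]) measurable
    finally show ?thesis .
  qed
  ultimately show ?thesis using sets AE by metis
qed

text \<open>The composition product of a measure and a Markov kernel: first marginal
  \<open>M\<close>, conditional laws \<open>\<kappa> x\<close>. Disintegrating a measure means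
  bringing it into this form.\<close>

definition semidirect :: "'a measure \<Rightarrow> ('a \<Rightarrow> 'b measure) \<Rightarrow> 'b measure \<Rightarrow> ('a \<times> 'b) measure" where
  "semidirect M \<kappa> Y = M \<bind> (\<lambda>x. distr (\<kappa> x) (M \<Otimes>\<^sub>M Y) (Pair x))"

context
  fixes M :: "'a measure" and Y :: "'b measure" and \<kappa>
  assumes M: "prob_space M" and \<kappa>: "\<kappa> \<in> M \<rightarrow>\<^sub>M prob_algebra Y"
begin

lemma kernelD:
  assumes "x \<in> space M"
  shows "prob_space (\<kappa> x)" "sets (\<kappa> x) = sets Y" "space (\<kappa> x) = space Y"
  using measurable_space[OF \<kappa> assms] by (auto simp: space_prob_algebra dest: sets_eq_imp_space_eq)

lemma kernel_subprob [measurable]: "\<kappa> \<in> M \<rightarrow>\<^sub>M subprob_algebra Y"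
  using \<kappa> by (rule measurable_prob_algebraD)

lemma measurable_distr_Pair:
  "(\<lambda>x. distr (\<kappa> x) (M \<Otimes>\<^sub>M Y) (Pair x)) \<in> M \<rightarrow>\<^sub>M subprob_algebra (M \<Otimes>\<^sub>M Y)"
  by (rule measurable_distr2[where M=Y]) measurable

lemma Pair_kernel_measurable: "x \<in> space M \<Longrightarrow> Pair x \<in> \<kappa> x \<rightarrow>\<^sub>M M \<Otimes>\<^sub>M Y"
  using kernelD(2)[of x] by (simp add: measurable_Pair1' cong: measurable_cong_sets)

lemma space_M_nonempty: "space M \<noteq> {}"
  using prob_space.not_empty[OF M] .

lemma sets_semidirect: "sets (semidirect M \<kappa> Y) = sets (M \<Otimes>\<^sub>M Y)"
  unfolding semidirect_def by (rule sets_bind) (simp_all add: space_M_nonempty)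

lemma emeasure_semidirect:
  assumes "X \<in> sets (M \<Otimes>\<^sub>M Y)"
  shows "emeasure (semidirect M \<kappa> Y) X = (\<integral>\<^sup>+x. emeasure (\<kappa> x) (Pair x -` X) \<partial>M)"
proof -
  have "emeasure (semidirect M \<kappa> Y) X
      = (\<integral>\<^sup>+x. emeasure (distr (\<kappa> x) (M \<Otimes>\<^sub>M Y) (Pair x)) X \<partial>M)"
    unfolding semidirect_def
    using space_M_nonempty measurable_distr_Pair assms by (rule emeasure_bind)
  also have "\<dots> = (\<integral>\<^sup>+x. emeasure (\<kappa> x) (Pair x -` X) \<partial>M)"
  proof (rule nn_integral_cong)
    fix x assume x: "x \<in> space M"
    have "Pair x -` X \<inter> space Y = Pair x -` X"
      using sets.sets_into_space[OF assms] by (auto simp: space_pair_measure)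
    then show "emeasure (distr (\<kappa> x) (M \<Otimes>\<^sub>M Y) (Pair x)) X = emeasure (\<kappa> x) (Pair x -` X)"
      using emeasure_distr[OF Pair_kernel_measurable[OF x] assms] kernelD(3)[OF x] by simp
  qed
  finally show ?thesis .
qed

lemma emeasure_semidirect_Times:
  assumes B: "B \<in> sets M" and A: "A \<in> sets Y"
  shows "emeasure (semidirect M \<kappa> Y) (B \<times> A) = (\<integral>\<^sup>+x\<in>B. emeasure (\<kappa> x) A \<partial>M)"
  using A B by (subst emeasure_semidirect) (auto intro!: nn_integral_cong simp: indicator_def)

lemma emeasure_semidirect_space_Times:
  assumes "A \<in> sets Y"
  shows "emeasure (semidirect M \<kappa> Y) (space M \<times> A) = (\<integral>\<^sup>+x. emeasure (\<kappa> x) A \<partial>M)"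
  unfolding emeasure_semidirect_Times[OF sets.top assms] by (intro nn_integral_cong) simp

lemma prob_space_semidirect: "prob_space (semidirect M \<kappa> Y)"
proof
  have "emeasure (semidirect M \<kappa> Y) (space (semidirect M \<kappa> Y))
      = emeasure (semidirect M \<kappa> Y) (space M \<times> space Y)"
    using sets_eq_imp_space_eq[OF sets_semidirect] by (simp add: space_pair_measure)
  also have "\<dots> = (\<integral>\<^sup>+x. 1 \<partial>M)"
    unfolding emeasure_semidirect_space_Times[OF sets.top]
  proof (rule nn_integral_cong)
    fix x assume "x \<in> space M"
    then show "emeasure (\<kappa> x) (space Y) = 1"
      using prob_space.emeasure_space_1[OF kernelD(1)] kernelD(3) by metis
  qed
  also have "\<dots> = 1" using prob_space.emeasure_space_1[OF M] by simp
  finally show "emeasure (semidirect M \<kappa> Y) (space (semidirect M \<kappa> Y)) = 1" .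
qed

lemma AE_semidirect:
  assumes "Measurable.pred (M \<Otimes>\<^sub>M Y) P"
  shows "(AE p in semidirect M \<kappa> Y. P p) \<longleftrightarrow> (AE x in M. AE y in \<kappa> x. P (x, y))"
proof -
  have "(AE p in semidirect M \<kappa> Y. P p)
      \<longleftrightarrow> (AE x in M. AE p in distr (\<kappa> x) (M \<Otimes>\<^sub>M Y) (Pair x). P p)"
    unfolding semidirect_def by (rule AE_bind[OF measurable_distr_Pair assms])
  also have "\<dots> \<longleftrightarrow> (AE x in M. AE y in \<kappa> x. P (x, y))"
  proof (rule AE_cong)
    fix x assume x: "x \<in> space M"
    show "(AE p in distr (\<kappa> x) (M \<Otimes>\<^sub>M Y) (Pair x). P p) \<longleftrightarrow> (AE y in \<kappa> x. P (x, y))"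
      using assms by (intro AE_distr_iff Pair_kernel_measurable x) (simp add: pred_def)
  qed
  finally show ?thesis .
qed

lemma measurable_kernel_distr:
  assumes T: "T \<in> Y \<rightarrow>\<^sub>M Y'"
  shows "(\<lambda>x. distr (\<kappa> x) Y' T) \<in> M \<rightarrow>\<^sub>M prob_algebra Y'"
  using measurable_compose[OF \<kappa> measurable_distr_prob_space[OF T]] .

lemma distr_semidirect:
  assumes T [measurable]: "T \<in> Y \<rightarrow>\<^sub>M Y'"
  shows "distr (semidirect M \<kappa> Y) (M \<Otimes>\<^sub>M Y') (\<lambda>(x, y). (x, T y))
    = semidirect M (\<lambda>x. distr (\<kappa> x) Y' T) Y'"
proof -
  have m: "(\<lambda>(x, y). (x, T y)) \<in> M \<Otimes>\<^sub>M Y \<rightarrow>\<^sub>M M \<Otimes>\<^sub>M Y'" by measurable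
  have "distr (semidirect M \<kappa> Y) (M \<Otimes>\<^sub>M Y') (\<lambda>(x, y). (x, T y))
      = M \<bind> (\<lambda>x. distr (distr (\<kappa> x) (M \<Otimes>\<^sub>M Y) (Pair x)) (M \<Otimes>\<^sub>M Y') (\<lambda>(x, y). (x, T y)))"
    unfolding semidirect_def by (rule distr_bind[OF measurable_distr_Pair space_M_nonempty m])
  also have "\<dots> = semidirect M (\<lambda>x. distr (\<kappa> x) Y' T) Y'"
    unfolding semidirect_def
  proof (rule bind_cong[OF refl])
    fix x assume x: "x \<in> space M"
    have T': "T \<in> \<kappa> x \<rightarrow>\<^sub>M Y'"
      using T kernelD(2)[OF x] by (simp cong: measurable_cong_sets)
    show "distr (distr (\<kappa> x) (M \<Otimes>\<^sub>M Y) (Pair x)) (M \<Otimes>\<^sub>M Y') (\<lambda>(x, y). (x, T y))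
        = distr (distr (\<kappa> x) Y' T) (M \<Otimes>\<^sub>M Y') (Pair x)"
      using x by (simp add: distr_distr[OF m Pair_kernel_measurable[OF x]] distr_distr[OF _ T'] comp_def)
  qed
  finally show ?thesis .
qed

end

lemma semidirect_const:
  assumes "prob_space M" and N: "prob_space N"
  shows "semidirect M (\<lambda>_. N) N = M \<Otimes>\<^sub>M N"
proof -
  interpret M: prob_space M by fact
  interpret N: prob_space N by fact
  have \<kappa>: "(\<lambda>_. N) \<in> M \<rightarrow>\<^sub>M prob_algebra N"
    using N by (intro measurable_const) (simp add: space_prob_algebra)
  show ?thesis
  proof (rule pair_measure_eqI[symmetric])
    show "emeasure M A * emeasure N B = emeasure (semidirect M (\<lambda>_. N) N) (A \<times> B)"
      if "A \<in> sets M" "B \<in> sets N" for A B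
      using that by (subst emeasure_semidirect_Times[OF M.prob_space_axioms \<kappa>])
        (simp_all add: nn_integral_cmult_indicator mult.commute[of "emeasure M A"])
  qed (simp_all add: M.sigma_finite_measure_axioms N.sigma_finite_measure_axioms
      sets_semidirect[OF M.prob_space_axioms \<kappa>])
qed

text \<open>For each test set the fibre masses are densities of one and the same measure on the
  base, hence agree almost everywhere; countably many test sets identify the fibres. That almost
  every fibre of \<open>\<kappa>'\<close> is carried by \<open>A\<close> follows from the equality
  of the two total measures.\<close>

lemma semidirect_unique:
  assumes M: "prob_space M" and c: "borel_coding Y A \<phi> \<psi>"
    and \<kappa>: "\<kappa> \<in> M \<rightarrow>\<^sub>M prob_algebra Y" and \<kappa>': "\<kappa>' \<in> M \<rightarrow>\<^sub>M prob_algebra Y"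
    and eq: "semidirect M \<kappa> Y = semidirect M \<kappa>' Y"
    and A: "AE x in M. AE y in \<kappa> x. y \<in> A"
  shows "AE x in M. \<kappa> x = \<kappa>' x"
proof -
  interpret M: prob_space M by fact
  note C = borel_codingD[OF c]
  note [measurable] = C(1-3) kernel_subprob[OF M \<kappa>] kernel_subprob[OF M \<kappa>']
  have "AE p in semidirect M \<kappa> Y. snd p \<in> A"
    using A by (subst AE_semidirect[OF M \<kappa>]) auto
  then have A': "AE x in M. AE y in \<kappa>' x. y \<in> A"
    unfolding eq by (subst (asm) AE_semidirect[OF M \<kappa>']) auto
  have "AE x in M. \<forall>q\<in>\<rat>. emeasure (\<kappa> x) {y \<in> space Y. \<phi> y \<le> q} = emeasure (\<kappa>' x) {y \<in> space Y. \<phi> y \<le> q}"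
  proof (rule AE_ball_countable[THEN iffD2, OF countable_rat], rule ballI)
    fix q :: real assume "q \<in> \<rat>"
    have [measurable]: "{y \<in> space Y. \<phi> y \<le> q} \<in> sets Y" by measurable
    show "AE x in M. emeasure (\<kappa> x) {y \<in> space Y. \<phi> y \<le> q} = emeasure (\<kappa>' x) {y \<in> space Y. \<phi> y \<le> q}"
      by (rule M.density_unique2, measurable)
        (simp flip: emeasure_semidirect_Times[OF M \<kappa>] emeasure_semidirect_Times[OF M \<kappa>'] add: eq)
  qed
  with A A' AE_space show ?thesis
  proof eventually_elim
    case (elim x)
    then show "\<kappa> x = \<kappa>' x"
      using kernelD(1,2)[OF M \<kappa>, of x] kernelD(1,2)[OF M \<kappa>', of x]
      by (auto intro!: borel_coding_eqI[OF _ _ _ _ c] simp: prob_space.finite_measure)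
  qed
qed

lemma measure_eqI_Times:
  assumes "prob_space H" "prob_space K"
    and sets: "sets H = sets (M \<Otimes>\<^sub>M N)" "sets K = sets (M \<Otimes>\<^sub>M N)"
    and Times: "\<And>B A. B \<in> sets M \<Longrightarrow> A \<in> sets N \<Longrightarrow> emeasure H (B \<times> A) = emeasure K (B \<times> A)"
  shows "H = K"
proof -
  interpret H: prob_space H by fact
  show ?thesis
  proof (rule measure_eqI_generator_eq[OF Int_stable_pair_measure_generator pair_measure_closed,
        of M N _ _ "\<lambda>_. space M \<times> space N"])
    show "emeasure H X = emeasure K X"
      if "X \<in> {a \<times> b |a b. a \<in> sets M \<and> b \<in> sets N}" for X
      using that Times by auto
    have "space M \<times> space N \<in> {a \<times> b |a b. a \<in> sets M \<and> b \<in> sets N}"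
      using sets.top[of M] sets.top[of N] by blast
    then show "range (\<lambda>_::nat. space M \<times> space N)
        \<subseteq> {a \<times> b |a b. a \<in> sets M \<and> b \<in> sets N}"
      by blast
  qed (auto simp: sets sets_pair_measure)
qed

text \<open>For fixed \<open>B\<close> the slice over \<open>B\<close> is a finite measure on the
  line, which its distribution function determines.\<close>

lemma measure_eqI_Times_atMost:
  fixes H K :: "('a \<times> real) measure"
  assumes "prob_space H" "prob_space K"
    and sets: "sets H = sets (M \<Otimes>\<^sub>M borel)" "sets K = sets (M \<Otimes>\<^sub>M borel)"
    and eq: "\<And>B q. B \<in> sets M \<Longrightarrow> emeasure H (B \<times> {..q}) = emeasure K (B \<times> {..q})"
  shows "H = K"
proof -
  interpret H: prob_space H by fact
  interpret K: prob_space K by fact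
  have Times: "emeasure H (B \<times> A) = emeasure K (B \<times> A)" if B: "B \<in> sets M" and A: "A \<in> sets borel" for A B
  proof -
    define slice where "slice L = distr (restrict_space L (B \<times> UNIV)) borel snd" for L :: "('a \<times> real) measure"
    have slice: "emeasure (slice L) A = emeasure L (B \<times> A)"
      if L: "sets L = sets (M \<Otimes>\<^sub>M borel)" and A: "A \<in> sets borel" for L A
    proof -
      have BU: "B \<times> UNIV \<in> sets L" unfolding L using B by (intro pair_measureI) auto
      have sp: "B \<subseteq> space M" using sets.sets_into_space[OF B] .
      have snd: "snd \<in> restrict_space L (B \<times> UNIV) \<rightarrow>\<^sub>M borel"
        by (intro measurable_restrict_space1) (simp cong: measurable_cong_sets[OF L])
      have "emeasure (slice L) A
          = emeasure (restrict_space L (B \<times> UNIV)) (snd -` A \<inter> space (restrict_space L (B \<times> UNIV)))"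
        unfolding slice_def using snd A by (rule emeasure_distr)
      also have "snd -` A \<inter> space (restrict_space L (B \<times> UNIV)) = B \<times> A"
        using sp by (auto simp: space_restrict_space space_pair_measure sets_eq_imp_space_eq[OF L])
      also have "emeasure (restrict_space L (B \<times> UNIV)) (B \<times> A) = emeasure L (B \<times> A)"
        using BU by (intro emeasure_restrict_space) auto
      finally show ?thesis .
    qed
    have fin: "finite_borel_measure (slice L)" if "prob_space L" "sets L = sets (M \<Otimes>\<^sub>M borel)" for L
    proof -
      interpret L: prob_space L by fact
      have "emeasure (slice L) (space (slice L)) = emeasure L (B \<times> UNIV)"
        using slice[OF that(2), of UNIV] by (simp add: slice_def)
      then have "finite_measure (slice L)" by (intro finite_measureI) simp
      then show ?thesis
        by (simp add: finite_borel_measure_def finite_borel_measure_axioms_def slice_def)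
    qed
    have "slice H = slice K"
      by (rule finite_borel_measure_eqI_rat) (use assms B in \<open>auto intro: fin simp: slice\<close>)
    then show ?thesis using slice[OF sets(1) A] slice[OF sets(2) A] by simp
  qed
  show ?thesis
    by (rule measure_eqI_Times[OF assms(1,2) sets Times])
qed

text \<open>Regular conditional distributions on the line: the conditional probability of
  \<open>{..q}\<close> is a Radon-Nikodym derivative, known for each \<open>q\<close> only up to a
  null set, and the versions for rational \<open>q\<close> are regularised into a distribution
  function for every \<open>x\<close>. Concentration on the unit interval fixes the behaviour at
  both ends.\<close>

lemma real_disintegration:
  fixes H :: "('a \<times> real) measure"
  assumes "prob_space H" and sets: "sets H = sets (M \<Otimes>\<^sub>M borel)" and M: "distr H M fst = M"
    and unit: "AE p in H. snd p \<in> {0..1}"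
  obtains \<kappa> where "\<kappa> \<in> M \<rightarrow>\<^sub>M prob_algebra borel" "H = semidirect M \<kappa> borel"
proof -
  interpret H: prob_space H by fact
  note [measurable_cong] = sets
  have fst: "fst \<in> H \<rightarrow>\<^sub>M M" by measurable
  interpret M: prob_space M
    using H.prob_space_distr[OF fst] unfolding M .
  have Times: "B \<times> A \<in> sets H" if "B \<in> sets M" "A \<in> sets borel" for A B
    unfolding sets using that by (rule pair_measureI)
  have emeasure_fst: "emeasure H (B \<times> UNIV) = emeasure M B" if "B \<in> sets M" for B
  proof -
    have "emeasure M B = emeasure (distr H M fst) B" by (simp add: M)
    also have "\<dots> = emeasure H (fst -` B \<inter> space H)" by (rule emeasure_distr[OF fst that])
    also have "fst -` B \<inter> space H = B \<times> UNIV"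
      using sets.sets_into_space[OF that]
      by (auto simp: sets_eq_imp_space_eq[OF sets] space_pair_measure)
    finally show ?thesis by simp
  qed
  have "\<exists>g. g \<in> borel_measurable M \<and>
      (\<forall>B\<in>sets M. (\<integral>\<^sup>+x\<in>B. g x \<partial>M) = emeasure H (B \<times> {..q}))" for q
  proof -
    define D where "D = distr (density H (indicator (space M \<times> {..q}))) M fst"
    have [measurable]: "space M \<times> {..q} \<in> sets H" by (intro Times) auto
    have D: "emeasure D B = emeasure H (B \<times> {..q})" if "B \<in> sets M" for B
    proof -
      have "emeasure D B = (\<integral>\<^sup>+p. indicator (space M \<times> {..q}) p * indicator (fst -` B \<inter> space H) p \<partial>H)"
        unfolding D_def using that by (subst emeasure_distr) (auto simp: emeasure_density)
      also have "\<dots> = (\<integral>\<^sup>+p. indicator (B \<times> {..q}) p \<partial>H)"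
        using sets.sets_into_space[OF that]
        by (intro nn_integral_cong)
          (auto simp: indicator_def sets_eq_imp_space_eq[OF sets] space_pair_measure)
      also have "\<dots> = emeasure H (B \<times> {..q})"
        using that by (intro nn_integral_indicator Times) auto
      finally show ?thesis .
    qed
    have "absolutely_continuous M D"
      unfolding absolutely_continuous_def
    proof
      fix B assume "B \<in> null_sets M"
      then have B: "B \<in> sets M" "emeasure M B = 0" by auto
      have "emeasure H (B \<times> {..q}) \<le> emeasure H (B \<times> UNIV)"
        using B by (intro emeasure_mono Times) auto
      then show "B \<in> null_sets D" using B D by (auto simp: emeasure_fst D_def)
    qed
    then have "density M (RN_deriv M D) = D"
      by (rule M.density_RN_deriv) (simp add: D_def)
    then have "(\<integral>\<^sup>+x\<in>B. RN_deriv M D x \<partial>M) = emeasure H (B \<times> {..q})" if "B \<in> sets M" for B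
      using that D[OF that] emeasure_density[of "RN_deriv M D" M B] by simp
    then show ?thesis by (intro exI[of _ "RN_deriv M D"]) auto
  qed
  then obtain g where [measurable]: "\<And>q. g q \<in> borel_measurable M"
    and g: "\<And>q B. B \<in> sets M \<Longrightarrow> (\<integral>\<^sup>+x\<in>B. g q x \<partial>M) = emeasure H (B \<times> {..q})"
    by metis
  have total: "(\<integral>\<^sup>+x. g q x \<partial>M) = emeasure H (space M \<times> {..q})" for q
    using g[of "space M" q] by (simp add: nn_set_integral_space)
  have g_mono: "AE x in M. g q x \<le> g r x" if "q \<le> r" for q r
  proof (rule AE_le_if_set_nn_integral_le)
    show "(\<integral>\<^sup>+x\<in>B. g q x \<partial>M) \<le> (\<integral>\<^sup>+x\<in>B. g r x \<partial>M)" if "B \<in> sets M" for B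
      using that \<open>q \<le> r\<close> by (auto simp: g intro!: emeasure_mono Times)
  qed (auto simp: total)
  have g_le: "AE x in M. g q x \<le> 1" for q
  proof (rule AE_le_if_set_nn_integral_le)
    show "(\<integral>\<^sup>+x\<in>B. g q x \<partial>M) \<le> (\<integral>\<^sup>+x\<in>B. 1 \<partial>M)" if "B \<in> sets M" for B
      using that by (auto simp: g emeasure_fst[symmetric] intro!: emeasure_mono Times)
  qed (auto simp: total)
  have g_neg: "AE x in M. g q x = 0" if "q < 0" for q
  proof -
    have "emeasure H (space M \<times> {..q}) = 0"
    proof -
      have "emeasure H (space M \<times> {..q}) = emeasure H {}"
        using unit that by (intro emeasure_eq_AE Times) (auto elim!: eventually_mono)
      then show ?thesis by simp
    qed
    then have "(\<integral>\<^sup>+x. g q x \<partial>M) = 0" by (simp only: total)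
    then show ?thesis by (subst (asm) nn_integral_0_iff_AE) auto
  qed
  have g_big: "AE x in M. 1 \<le> g q x" if "1 \<le> q" for q
  proof (rule AE_le_if_set_nn_integral_le)
    fix B assume B: "B \<in> sets M"
    have "emeasure H (B \<times> {..q}) = emeasure H (B \<times> UNIV)"
    proof (rule emeasure_eq_AE)
      show "AE p in H. p \<in> B \<times> {..q} \<longleftrightarrow> p \<in> B \<times> UNIV"
        using unit by eventually_elim (use that in auto)
    qed (use B Times in auto)
    then show "(\<integral>\<^sup>+x\<in>B. 1 \<partial>M) \<le> (\<integral>\<^sup>+x\<in>B. g q x \<partial>M)"
      using B by (simp add: g emeasure_fst)
  qed (auto simp: M.emeasure_space_1)
  \<comment> \<open>This version has values in the unit interval and the right constants outside
    \<open>[0, 1)\<close> at every \<open>x\<close>, so the limits at both infinities hold without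
    exceptional points.\<close>
  define G where "G q x = (if q < 0 then 0 else if 1 \<le> q then 1 else min 1 (enn2real (g q x)))" for q :: real and x
  have [measurable]: "G q \<in> borel_measurable M" for q unfolding G_def by measurable
  have G01: "0 \<le> G q x" "G q x \<le> 1" for q x by (auto simp: G_def)
  have G_g: "AE x in M. ennreal (G q x) = g q x" for q
  proof -
    consider "q < 0" | "1 \<le> q" | "0 \<le> q" "q < 1" by linarith
    then show ?thesis
    proof cases
      case 1
      then show ?thesis using g_neg[OF 1] by (auto simp: G_def elim!: eventually_mono)
    next
      case 2
      show ?thesis using g_big[OF 2] g_le[of q] by eventually_elim (use 2 in \<open>auto simp: G_def\<close>)
    next
      case 3
      show ?thesis using g_le[of q]
      proof eventually_elim
        case (elim x)
        then have "g q x < \<infinity>" by (auto simp: le_less_trans)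
        moreover from elim have "enn2real (g q x) \<le> 1"
          using enn2real_mono[OF elim] by simp
        ultimately show ?case using 3 by (simp add: G_def)
      qed
    qed
  qed
  \<comment> \<open>The strict inequality makes \<open>F x\<close> right continuous, and the infimum
    over shrinking index sets makes it monotone, even at those \<open>x\<close> where the chosen
    versions \<open>G q x\<close> are not monotone in \<open>q\<close>.\<close>
  define I where "I u = {q \<in> \<rat>. u < q}" for u :: real
  define F where "F x u = (INF q\<in>I u. G q x)" for x u
  have I_cnt: "countable (I u)" for u
    unfolding I_def using countable_rat by (rule countable_subset[rotated]) auto
  have I_ne: "I u \<noteq> {}" for u
    using Rats_dense_in_real[of u "u + 1"] by (auto simp: I_def)
  have bdd: "bdd_below ((\<lambda>q. G q x) ` S)" for x S
    using G01 by (intro bdd_belowI[of _ 0]) auto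
  have F_le: "F x u \<le> G q x" if "q \<in> I u" for x u q
    unfolding F_def using bdd that by (rule cINF_lower)
  have F_ge: "c \<le> F x u" if "\<And>q. q \<in> I u \<Longrightarrow> c \<le> G q x" for c x u
    unfolding F_def using I_ne that by (rule cINF_greatest)
  have F_meas [measurable]: "(\<lambda>x. F x u) \<in> borel_measurable M" for u
    unfolding F_def using I_cnt bdd by (intro borel_measurable_cINF) auto
  have F_mono: "F x u \<le> F x v" if "u \<le> v" for x u v
    using that by (intro F_ge F_le) (auto simp: I_def)
  have F0: "0 \<le> F x u" for x u using G01 by (intro F_ge)
  have F_right: "continuous (at_right a) (F x)" for x a
    unfolding continuous_within
  proof (rule order_tendstoI)
    fix c assume "c < F x a"
    then show "eventually (\<lambda>y. c < F x y) (at_right a)"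
      using F_mono by (intro eventually_at_rightI[of a "a + 1"]) (auto intro: less_le_trans[of c "F x a"])
  next
    fix c assume c: "F x a < c"
    then obtain q where q: "q \<in> I a" "G q x < c"
      unfolding F_def using cINF_less_iff[OF I_ne bdd] by blast
    have "F x y < c" if "y < q" for y
      using F_le[of q y x] q that by (auto simp: I_def)
    then show "eventually (\<lambda>y. F x y < c) (at_right a)"
      using q by (intro eventually_at_rightI[of a q]) (auto simp: I_def)
  qed
  have F_neg: "F x u = 0" if "u < 0" for x u
  proof (rule antisym)
    obtain q where "q \<in> \<rat>" "u < q" "q < 0" using Rats_dense_in_real[OF \<open>u < 0\<close>] by auto
    then show "F x u \<le> 0" using F_le[of q u x] by (simp add: I_def G_def)
  qed (rule F0)
  have F_bot: "(F x \<longlongrightarrow> 0) at_bot" for x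
    by (rule tendsto_eventually) (auto simp: eventually_at_bot_linorder F_neg intro!: exI[of _ "-1"])
  have F_one: "F x u = 1" if "1 \<le> u" for x u
  proof (rule antisym)
    obtain q where "q \<in> I u" using I_ne by blast
    then show "F x u \<le> 1" using F_le G01(2) order_trans by blast
    show "1 \<le> F x u" using that by (intro F_ge) (auto simp: I_def G_def)
  qed
  have F_top: "(F x \<longlongrightarrow> 1) at_top" for x
    by (rule tendsto_eventually) (auto simp: eventually_at_top_linorder F_one intro!: exI[of _ 1])
  \<comment> \<open>The regularised function is still the conditional probability: the upper bound
    uses continuity of \<open>H\<close> along shrinking rays, the lower bound uses that almost
    everywhere \<open>g u\<close> lies below all of the countably many \<open>g q\<close> with
    rational \<open>q > u\<close>.\<close>
  have F_int: "(\<integral>\<^sup>+x\<in>B. ennreal (F x u) \<partial>M) = emeasure H (B \<times> {..u})" if B: "B \<in> sets M" for B u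
  proof (rule antisym)
    have "(\<integral>\<^sup>+x\<in>B. ennreal (F x u) \<partial>M) \<le> emeasure H (B \<times> {..u + 1 / real (Suc n)})" for n
    proof -
      obtain q where q: "q \<in> \<rat>" "u < q" "q < u + 1 / real (Suc n)"
        using Rats_dense_in_real[of u "u + 1 / real (Suc n)"] by auto
      have "(\<integral>\<^sup>+x\<in>B. ennreal (F x u) \<partial>M) \<le> (\<integral>\<^sup>+x\<in>B. ennreal (G q x) \<partial>M)"
        using q by (intro nn_integral_mono mult_right_mono ennreal_leI F_le) (auto simp: I_def)
      also have "\<dots> = (\<integral>\<^sup>+x\<in>B. g q x \<partial>M)"
        using G_g[of q] by (intro nn_integral_cong_AE) (auto elim: eventually_mono)
      also have "\<dots> = emeasure H (B \<times> {..q})" by (rule g[OF B])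
      also have "\<dots> \<le> emeasure H (B \<times> {..u + 1 / real (Suc n)})"
        using q B by (intro emeasure_mono Times) auto
      finally show ?thesis .
    qed
    moreover have "(\<lambda>n. emeasure H (B \<times> {..u + 1 / real (Suc n)}))
        \<longlonglongrightarrow> emeasure H (\<Inter>n. B \<times> {..u + 1 / real (Suc n)})"
    proof (rule Lim_emeasure_decseq)
      show "range (\<lambda>n. B \<times> {..u + 1 / real (Suc n)}) \<subseteq> sets H" using Times[OF B] by auto
      show "decseq (\<lambda>n. B \<times> {..u + 1 / real (Suc n)})"
      proof (rule decseq_SucI)
        fix n
        have "1 / real (Suc (Suc n)) \<le> 1 / real (Suc n)" by (simp add: frac_le)
        then show "B \<times> {..u + 1 / real (Suc (Suc n))} \<subseteq> B \<times> {..u + 1 / real (Suc n)}" by auto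
      qed
    qed simp
    moreover have "(\<Inter>n. B \<times> {..u + 1 / real (Suc n)}) = B \<times> {..u}"
    proof -
      have "v \<le> u" if "\<forall>n. v \<le> u + 1 / real (Suc n)" for v
      proof (rule LIMSEQ_le_const)
        show "(\<lambda>n. u + 1 / real (Suc n)) \<longlonglongrightarrow> u"
          using tendsto_add[OF tendsto_const[of u] LIMSEQ_Suc[OF lim_1_over_n]] by simp
      qed (use that in auto)
      moreover have "v \<le> u + 1 / real (Suc n)" if "v \<le> u" for v n
        using that by (rule order_trans) simp
      ultimately show ?thesis by auto
    qed
    ultimately show "(\<integral>\<^sup>+x\<in>B. ennreal (F x u) \<partial>M) \<le> emeasure H (B \<times> {..u})"
      using LIMSEQ_le_const by (metis (no_types, lifting))
    have "AE x in M. \<forall>q\<in>I u. g u x \<le> ennreal (G q x)"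
    proof (rule AE_ball_countable[THEN iffD2, OF I_cnt], rule ballI)
      fix q assume "q \<in> I u"
      then have "AE x in M. g u x \<le> g q x" by (intro g_mono) (auto simp: I_def)
      with G_g[of q] show "AE x in M. g u x \<le> ennreal (G q x)" by eventually_elim simp
    qed
    with G_g[of u] have "AE x in M. g u x \<le> ennreal (F x u)"
    proof eventually_elim
      case (elim x)
      have "G u x \<le> F x u"
        by (rule F_ge) (use elim G01 in \<open>auto simp flip: elim(1)\<close>)
      then show ?case unfolding elim(1)[symmetric] by (rule ennreal_leI)
    qed
    then have "(\<integral>\<^sup>+x\<in>B. g u x \<partial>M) \<le> (\<integral>\<^sup>+x\<in>B. ennreal (F x u) \<partial>M)"
      by (intro nn_integral_mono_AE) (auto elim!: eventually_mono intro: mult_right_mono)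
    then show "emeasure H (B \<times> {..u}) \<le> (\<integral>\<^sup>+x\<in>B. ennreal (F x u) \<partial>M)"
      by (simp add: g[OF B])
  qed
  define \<kappa> where "\<kappa> x = interval_measure (F x)" for x
  have rd: "real_distribution (\<kappa> x)" for x
    unfolding \<kappa>_def using F_mono F_right F_bot F_top by (rule real_distribution_interval_measure)
  have Iic: "emeasure (\<kappa> x) {..u} = ennreal (F x u)" for x u
    unfolding \<kappa>_def using F_mono F_right F_bot by (rule emeasure_interval_measure_Iic)
  have prob: "prob_space (\<kappa> x)" for x using rd by (rule real_distribution.axioms)
  have sets_\<kappa>: "sets (\<kappa> x) = sets borel" for x by (simp add: \<kappa>_def)
  have \<kappa>: "\<kappa> \<in> M \<rightarrow>\<^sub>M prob_algebra borel"
  proof (rule measurable_prob_algebraI)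
    show "\<kappa> \<in> M \<rightarrow>\<^sub>M subprob_algebra borel"
    proof (rule measurable_subprob_algebra_generated[where \<Omega>=UNIV and G="range atMost"])
      show "sets borel = sigma_sets UNIV (range (atMost :: real \<Rightarrow> real set))"
        by (simp add: borel_eq_atMost)
      show "Int_stable (range (atMost :: real \<Rightarrow> real set))"
        by (auto simp: Int_stable_def)
      show "(\<lambda>x. emeasure (\<kappa> x) A) \<in> borel_measurable M" if "A \<in> range atMost" for A
        using that by (auto simp: Iic)
      have "emeasure (\<kappa> x) UNIV = 1" for x
        using prob_space.emeasure_space_1[OF prob[of x]] by (simp add: \<kappa>_def)
      then show "(\<lambda>x. emeasure (\<kappa> x) UNIV) \<in> borel_measurable M" by simp
    qed (auto simp: sets_\<kappa> prob prob_space_imp_subprob_space)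
  qed (rule prob)
  have "H = semidirect M \<kappa> borel"
  proof (rule measure_eqI_Times_atMost[where M=M])
    show "emeasure H (B \<times> {..q}) = emeasure (semidirect M \<kappa> borel) (B \<times> {..q})"
      if "B \<in> sets M" for B q
      using that by (subst emeasure_semidirect_Times[OF M.prob_space_axioms \<kappa>]) (auto simp: Iic F_int)
  qed (auto simp: sets sets_semidirect[OF M.prob_space_axioms \<kappa>] H.prob_space_axioms
      prob_space_semidirect[OF M.prob_space_axioms \<kappa>])
  with \<kappa> show thesis by (rule that)
qed

text \<open>The second coordinate is coded by a real number, the coded measure is disintegrated, and
  the fibre measures are decoded with \<open>\<psi>\<close>.\<close>

lemma disintegration:
  assumes "prob_space H" and sets: "sets H = sets (M \<Otimes>\<^sub>M Y)" and M: "distr H M fst = M"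
    and c: "borel_coding Y A \<phi> \<psi>" and A: "AE p in H. snd p \<in> A"
  obtains \<kappa> where "\<kappa> \<in> M \<rightarrow>\<^sub>M prob_algebra Y" "H = semidirect M \<kappa> Y"
proof -
  interpret H: prob_space H by fact
  note C = borel_codingD[OF c]
  note [measurable_cong] = sets
  note [measurable] = C(1-3)
  have fst: "fst \<in> H \<rightarrow>\<^sub>M M" by measurable
  interpret M: prob_space M
    using H.prob_space_distr[OF fst] unfolding M .
  define code where "code = (\<lambda>(x, y). (x :: 'a, \<phi> y))"
  have [measurable]: "code \<in> M \<Otimes>\<^sub>M Y \<rightarrow>\<^sub>M M \<Otimes>\<^sub>M borel"
    unfolding code_def by measurable
  define H' where "H' = distr H (M \<Otimes>\<^sub>M borel) code"
  have AE': "AE p in H'. snd p \<in> {0..1}"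
    unfolding H'_def
  proof (subst AE_distr_iff)
    show "AE p in H. snd (code p) \<in> {0..1}"
      using C(4,5) by (intro AE_I2)
        (auto simp: code_def sets_eq_imp_space_eq[OF sets] space_pair_measure)
  qed measurable
  have fst': "distr H' M fst = M"
  proof -
    have "distr H' M fst = distr H M (fst \<circ> code)"
      unfolding H'_def by (rule distr_distr) measurable
    also have "fst \<circ> code = fst" by (auto simp: code_def)
    finally show ?thesis by (simp add: M)
  qed
  have prob': "prob_space H'" unfolding H'_def by (rule H.prob_space_distr) measurable
  have sets': "sets H' = sets (M \<Otimes>\<^sub>M borel)" by (simp add: H'_def)
  obtain \<kappa> where \<kappa>: "\<kappa> \<in> M \<rightarrow>\<^sub>M prob_algebra borel" "H' = semidirect M \<kappa> borel"
    by (rule real_disintegration[OF prob' sets' fst' AE']) (rule that)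
  have "H = distr H (M \<Otimes>\<^sub>M Y) (\<lambda>p. p)" using sets by (simp add: distr_id2)
  also have "\<dots> = distr H (M \<Otimes>\<^sub>M Y) ((\<lambda>(x, t). (x, \<psi> t)) \<circ> code)"
  proof (rule distr_cong_AE)
    show "AE p in H. p = ((\<lambda>(x, t). (x, \<psi> t)) \<circ> code) p"
      using A by eventually_elim (auto simp: code_def C(6))
  qed (simp_all, measurable)
  also have "\<dots> = distr H' (M \<Otimes>\<^sub>M Y) (\<lambda>(x, t). (x, \<psi> t))"
    unfolding H'_def by (rule distr_distr[symmetric]) measurable
  also have "\<dots> = semidirect M (\<lambda>x. distr (\<kappa> x) Y \<psi>) Y"
    unfolding \<kappa>(2) by (rule distr_semidirect[OF M.prob_space_axioms \<kappa>(1)]) measurable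
  finally show thesis
    using that measurable_kernel_distr[OF M.prob_space_axioms \<kappa>(1) C(3)] by blast
qed

subsection \<open>Invariant functions\<close>

text \<open>Replaces the convex hull of the orbit: midpoints are the only convex combinations that
  the parallelogram law uses. The elements are functions, not classes modulo null sets, and no
  measure enters, so the same averages can be evaluated under every fibre measure.\<close>

inductive_set orbit_hull ::
  "('g, 'm) monoid_scheme \<Rightarrow> ('g \<Rightarrow> 'w \<Rightarrow> 'w) \<Rightarrow> ('w \<Rightarrow> real) \<Rightarrow> ('w \<Rightarrow> real) set"
  for G R f where
  base: "f \<in> orbit_hull G R f"
| translate: "c \<in> orbit_hull G R f \<Longrightarrow> g \<in> carrier G \<Longrightarrow> (\<lambda>w. c (R g w)) \<in> orbit_hull G R f"
| midpoint: "c \<in> orbit_hull G R f \<Longrightarrow> c' \<in> orbit_hull G R f \<Longrightarrow>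
    (\<lambda>w. (c w + c' w) / 2) \<in> orbit_hull G R f"

lemma orbit_hull_bounds:
  assumes "c \<in> orbit_hull G R f" "\<And>w. 0 \<le> f w" "\<And>w. f w \<le> 1"
  shows "0 \<le> c w \<and> c w \<le> 1"
  using assms(1)
proof (induction arbitrary: w)
  case (midpoint c c')
  from midpoint.IH(1)[of w] midpoint.IH(2)[of w] show ?case by auto
qed (use assms(2,3) in auto)

lemma orbit_hull_measurable:
  assumes "c \<in> orbit_hull G R f" "f \<in> borel_measurable P"
    and R: "\<And>g. g \<in> carrier G \<Longrightarrow> R g \<in> P \<rightarrow>\<^sub>M P"
  shows "c \<in> borel_measurable P"
  using assms(1)
proof induction
  case (translate c g)
  then show ?case using measurable_compose[OF R] by blast
qed (use assms(2) in auto)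

lemma (in finite_measure) integrable_unit_bounded:
  fixes f :: "'a \<Rightarrow> real"
  assumes "f \<in> borel_measurable M" "\<And>w. w \<in> space M \<Longrightarrow> \<bar>f w\<bar> \<le> 1"
  shows "integrable M f"
  using assms by (intro integrable_const_bound[of _ 1] AE_I2) auto

lemma orbit_hull_integral:
  assumes c: "c \<in> orbit_hull G R f" and f [measurable]: "f \<in> borel_measurable P"
    and bd: "\<And>w. 0 \<le> f w" "\<And>w. f w \<le> 1" and P: "prob_space P"
    and R: "\<And>g. g \<in> carrier G \<Longrightarrow> R g \<in> P \<rightarrow>\<^sub>M P"
    and inv: "\<And>g. g \<in> carrier G \<Longrightarrow> distr P P (R g) = P"
    and B [measurable]: "B \<in> sets P" and B_inv: "\<And>g. g \<in> carrier G \<Longrightarrow> R g -` B \<inter> space P = B"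
  shows "(\<integral>w. indicat_real B w * c w \<partial>P) = (\<integral>w. indicat_real B w * f w \<partial>P)"
  using c
proof induction
  case (translate c g)
  note [measurable] = orbit_hull_measurable[OF translate.hyps(1) f R] R[OF translate.hyps(2)]
  have "(\<integral>w. indicat_real B w * c (R g w) \<partial>P) = (\<integral>w. indicat_real B (R g w) * c (R g w) \<partial>P)"
    using B_inv[OF translate.hyps(2)] by (intro Bochner_Integration.integral_cong) (auto simp: indicator_def)
  also have "\<dots> = (\<integral>w. indicat_real B w * c w \<partial>distr P P (R g))"
    by (subst integral_distr) auto
  also have "\<dots> = (\<integral>w. indicat_real B w * f w \<partial>P)"
    unfolding inv[OF translate.hyps(2)] by (rule translate.IH)
  finally show ?case .
next
  case (midpoint c c')
  interpret prob_space P by fact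
  have int: "integrable P (\<lambda>w. indicat_real B w * b w)" if "b \<in> orbit_hull G R f" for b
  proof (rule integrable_unit_bounded)
    note [measurable] = orbit_hull_measurable[OF that f R]
    show "(\<lambda>w. indicat_real B w * b w) \<in> borel_measurable P" by measurable
  qed (use orbit_hull_bounds[OF that bd] in \<open>auto simp: indicator_def\<close>)
  have "(\<integral>w. indicat_real B w * ((c w + c' w) / 2) \<partial>P)
      = (\<integral>w. (indicat_real B w * c w + indicat_real B w * c' w) / 2 \<partial>P)"
    by (intro Bochner_Integration.integral_cong) (auto simp: algebra_simps add_divide_distrib)
  also have "\<dots> = ((\<integral>w. indicat_real B w * c w \<partial>P) + (\<integral>w. indicat_real B w * c' w \<partial>P)) / 2"
    using int midpoint.hyps by simp
  finally show ?case using midpoint.IH by simp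
qed simp

lemma AE_summable_if_nn_integral_le:
  fixes X :: "nat \<Rightarrow> 'a \<Rightarrow> real"
  assumes [measurable]: "\<And>n. X n \<in> borel_measurable P" and nonneg: "\<And>n w. 0 \<le> X n w"
    and le: "\<And>n. (\<integral>\<^sup>+w. X n w \<partial>P) \<le> ennreal (b n)" and b: "summable b" "\<And>n. 0 \<le> b n"
  shows "AE w in P. summable (\<lambda>n. X n w)"
proof -
  have "(\<integral>\<^sup>+w. (\<Sum>n. ennreal (X n w)) \<partial>P) = (\<Sum>n. \<integral>\<^sup>+w. X n w \<partial>P)"
    by (rule nn_integral_suminf) measurable
  also have "\<dots> \<le> (\<Sum>n. ennreal (b n))" using le by (intro suminf_le) auto
  also have "\<dots> = ennreal (\<Sum>n. b n)" using b by (intro suminf_ennreal2) auto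
  also have "\<dots> < \<infinity>" by simp
  finally have "(\<integral>\<^sup>+w. (\<Sum>n. ennreal (X n w)) \<partial>P) \<noteq> \<infinity>" by simp
  then have "AE w in P. (\<Sum>n. ennreal (X n w)) \<noteq> \<infinity>"
    by (intro nn_integral_PInf_AE) measurable
  then show ?thesis
    by eventually_elim (auto intro: summable_suminf_not_top nonneg)
qed

text \<open>
  The elements of the hull of almost minimal norm converge to its element of minimal norm, which is
  invariant by uniqueness (Alaoglu--Birkhoff).
\<close>

lemma orbit_hull_invariant_limit:
  assumes "group G" "countable (carrier G)" and P: "prob_space P"
    and R: "\<And>g. g \<in> carrier G \<Longrightarrow> R g \<in> P \<rightarrow>\<^sub>M P"
    and inv: "\<And>g. g \<in> carrier G \<Longrightarrow> distr P P (R g) = P"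
    and R_one: "\<And>w. w \<in> space P \<Longrightarrow> R \<one>\<^bsub>G\<^esub> w = w"
    and R_mult: "\<And>g h w. g \<in> carrier G \<Longrightarrow> h \<in> carrier G \<Longrightarrow> w \<in> space P \<Longrightarrow>
          R (g \<otimes>\<^bsub>G\<^esub> h) w = R g (R h w)"
    and f: "f \<in> borel_measurable P" and bd: "\<And>w. 0 \<le> f w" "\<And>w. f w \<le> 1"
  obtains c h where "\<And>n. c n \<in> orbit_hull G R f" "h \<in> borel_measurable P"
    "\<And>w. w \<in> space P \<Longrightarrow> 0 \<le> h w" "\<And>w. w \<in> space P \<Longrightarrow> h w \<le> 1"
    "\<And>g w. g \<in> carrier G \<Longrightarrow> w \<in> space P \<Longrightarrow> h (R g w) = h w"
    "AE w in P. (\<lambda>n. c n w) \<longlonglongrightarrow> h w"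
proof -
  interpret group G by fact
  interpret prob_space P by fact
  let ?H = "orbit_hull G R f"
  have meas: "b \<in> borel_measurable P" if "b \<in> ?H" for b
    using orbit_hull_measurable[OF that f R] .
  have unit: "0 \<le> b w" "b w \<le> 1" if "b \<in> ?H" for b w
    using orbit_hull_bounds[OF that bd] by auto
  define E where "E b = (\<integral>w. (b w)\<^sup>2 \<partial>P)" for b :: "_ \<Rightarrow> real"
  define d where "d = (INF b\<in>?H. E b)"
  have int: "integrable P (\<lambda>w. (b w)\<^sup>2)" if "b \<in> ?H" for b
    using meas[OF that] unit[OF that] by (intro integrable_unit_bounded) (auto simp: power_le_one)
  have d: "d \<le> E b" if "b \<in> ?H" for b
    unfolding d_def using that by (intro cINF_lower bdd_belowI[of _ 0]) (auto simp: E_def)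
  \<comment> \<open>Parallelogram law: the midpoint stays in the hull, so its squared norm is at
    least \<open>d\<close>, and two almost minimal elements have to be close.\<close>
  have close: "(\<integral>\<^sup>+w. (b w - b' w)\<^sup>2 \<partial>P) \<le> ennreal (4 * e)"
    if b: "b \<in> ?H" "b' \<in> ?H" and e: "E b \<le> d + e" "E b' \<le> d + e" for b b' e
  proof -
    let ?m = "\<lambda>w. (b w + b' w) / 2"
    have m: "?m \<in> ?H" using b by (rule orbit_hull.midpoint)
    have eq: "(\<lambda>w. (b w - b' w)\<^sup>2) = (\<lambda>w. 2 * (b w)\<^sup>2 + 2 * (b' w)\<^sup>2 - 4 * (?m w)\<^sup>2)"
      by (auto simp: power2_eq_square field_simps)
    have i: "integrable P (\<lambda>w. (b w - b' w)\<^sup>2)"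
      unfolding eq using int[OF b(1)] int[OF b(2)] int[OF m] by simp
    have "(\<integral>w. (b w - b' w)\<^sup>2 \<partial>P) = 2 * E b + 2 * E b' - 4 * E ?m"
      unfolding eq E_def using int[OF b(1)] int[OF b(2)] int[OF m] by simp
    also have "\<dots> \<le> 4 * e" using d[OF m] e by simp
    finally show ?thesis
      by (subst nn_integral_eq_integral[OF i]) (auto intro: ennreal_leI)
  qed
  \<comment> \<open>The excess \<open>(1 / 16) ^ n\<close> bounds squared distances by
    \<open>4 * (1 / 16) ^ n\<close>, which remains summable after multiplication by the weight
    \<open>4 ^ n\<close> used below to pass from squares to absolute values.\<close>
  have "\<exists>b\<in>?H. E b < d + (1 / 16) ^ n" for n :: nat
  proof -
    have "d < d + (1 / 16) ^ n" by simp
    then show ?thesis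
      unfolding d_def using orbit_hull.base[of f G R]
      by (subst (asm) (1) cINF_less_iff) (auto intro!: bdd_belowI[of _ 0] simp: E_def)
  qed
  then obtain c where c: "\<And>n. c n \<in> ?H" and c_E: "\<And>n. E (c n) < d + (1 / 16) ^ n" by metis
  note [measurable] = meas[OF c] R
  \<comment> \<open>Stated for two sequences because it is used twice: with consecutive terms it
    yields convergence, with terms and their translates it yields invariance of the limit.\<close>
  have small: "AE w in P. summable (\<lambda>n. \<bar>b n w - b' n w\<bar>)"
    if b: "\<And>n. b n \<in> ?H" "\<And>n. b' n \<in> ?H"
      and e: "\<And>n. E (b n) \<le> d + (1 / 16) ^ n" "\<And>n. E (b' n) \<le> d + (1 / 16) ^ n" for b b'
  proof -
    note [measurable] = meas[OF b(1)] meas[OF b(2)]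
    have geo: "summable (\<lambda>n. (1 / 4) ^ n :: real)" by (rule summable_geometric) simp
    have "AE w in P. summable (\<lambda>n. 4 ^ n * (b n w - b' n w)\<^sup>2)"
    proof (rule AE_summable_if_nn_integral_le)
      fix n :: nat
      have "(\<integral>\<^sup>+w. ennreal (4 ^ n * (b n w - b' n w)\<^sup>2) \<partial>P)
          = (\<integral>\<^sup>+w. ennreal (4 ^ n) * ennreal ((b n w - b' n w)\<^sup>2) \<partial>P)"
        by (intro nn_integral_cong ennreal_mult) auto
      also have "\<dots> = ennreal (4 ^ n) * (\<integral>\<^sup>+w. (b n w - b' n w)\<^sup>2 \<partial>P)"
        by (rule nn_integral_cmult) measurable
      also have "\<dots> \<le> ennreal (4 ^ n) * ennreal (4 * (1 / 16) ^ n)"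
        using close[OF b e] by (rule mult_left_mono) simp
      also have "\<dots> = ennreal (4 ^ n * (4 * (1 / 16) ^ n))"
        by (rule ennreal_mult[symmetric]) auto
      also have "4 ^ n * (4 * (1 / 16) ^ n) = 4 * (1 / 4 :: real) ^ n"
        by (simp flip: power_mult_distrib)
      finally show "(\<integral>\<^sup>+w. ennreal (4 ^ n * (b n w - b' n w)\<^sup>2) \<partial>P) \<le> ennreal (4 * (1 / 4) ^ n)" .
    qed (use geo in \<open>auto intro: summable_mult\<close>)
    then show ?thesis
    proof eventually_elim
      case (elim w)
      \<comment> \<open>Completing the square: the linear term is paid for by the weighted square
        and a summable remainder.\<close>
      have bound: "\<bar>x\<bar> \<le> 4 ^ n * x\<^sup>2 + (1 / 4) ^ n" for x :: real and n :: nat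
      proof -
        have "0 \<le> (2 ^ n * \<bar>x\<bar> - (1 / 2) ^ n / 2)\<^sup>2" by simp
        also have "\<dots> = (2 ^ n)\<^sup>2 * x\<^sup>2 - (2 ^ n * (1 / 2) ^ n) * \<bar>x\<bar> + ((1 / 2) ^ n)\<^sup>2 / 4"
          by (simp add: power2_eq_square algebra_simps)
        also have "(2 ^ n)\<^sup>2 = (4 :: real) ^ n" by (simp add: power2_eq_square flip: power_mult_distrib)
        also have "((1 / 2) ^ n)\<^sup>2 = (1 / 4 :: real) ^ n" by (simp add: power2_eq_square flip: power_mult_distrib)
        also have "2 ^ n * (1 / 2) ^ n = (1 :: real)" by (simp flip: power_mult_distrib)
        finally show ?thesis by (simp add: add.commute) (use zero_le_power[of "1/4 :: real" n] in linarith)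
      qed
      show ?case
      proof (rule summable_comparison_test'[OF summable_add[OF elim geo]])
        show "norm \<bar>b n w - b' n w\<bar> \<le> 4 ^ n * (b n w - b' n w)\<^sup>2 + (1 / 4) ^ n" for n
          using bound[of "b n w - b' n w" n] by simp
      qed
    qed
  qed
  have E_le: "E (c n) \<le> d + (1 / 16) ^ m" if "m \<le> n" for m n
  proof -
    have "(1 / 16 :: real) ^ n \<le> (1 / 16) ^ m" using that by (intro power_decreasing) auto
    then show ?thesis using c_E[of n] by linarith
  qed
  have conv: "AE w in P. convergent (\<lambda>n. c n w)"
    using small[of c "\<lambda>n. c (Suc n)", OF c c E_le[OF order_refl] E_le[OF le_SucI[OF order_refl]]]
  proof eventually_elim
    case (elim w)
    then have "summable (\<lambda>n. c n w - c (Suc n) w)" by (simp add: summable_rabs_cancel)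
    then have "convergent (\<lambda>n. \<Sum>i<n. c i w - c (Suc i) w)" by (simp add: summable_iff_convergent)
    moreover have "(\<lambda>n. \<Sum>i<n. c i w - c (Suc i) w) = (\<lambda>n. c 0 w - c n w)"
      by (rule ext) (rule sum_lessThan_telescope'[of "\<lambda>i. c i w" for w])
    ultimately have "convergent (\<lambda>n. c 0 w - c n w)" by simp
    then show ?case using convergent_diff[OF convergent_const[of "c 0 w"]] by fastforce
  qed
  \<comment> \<open>Translation preserves the norm, so the translate of \<open>c n\<close> is as
    nearly minimal as \<open>c n\<close> itself, and the difference of the two tends to 0.\<close>
  have shift: "AE w in P. \<forall>g\<in>carrier G. (\<lambda>n. c n w - c n (R g w)) \<longlonglongrightarrow> 0"
  proof (rule AE_ball_countable[THEN iffD2, OF assms(2)], rule ballI)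
    fix g assume g: "g \<in> carrier G"
    note [measurable] = R[OF g]
    have "E (\<lambda>w. c n (R g w)) = E (c n)" for n
    proof -
      have "E (c n) = (\<integral>w. (c n w)\<^sup>2 \<partial>distr P P (R g))" by (simp add: E_def inv[OF g])
      also have "\<dots> = E (\<lambda>w. c n (R g w))" unfolding E_def by (rule integral_distr) measurable
      finally show ?thesis by simp
    qed
    then have "AE w in P. summable (\<lambda>n. \<bar>c n w - c n (R g w)\<bar>)"
      using c g E_le by (intro small orbit_hull.translate) auto
    then show "AE w in P. (\<lambda>n. c n w - c n (R g w)) \<longlonglongrightarrow> 0"
      by eventually_elim (rule summable_LIMSEQ_zero[OF summable_rabs_cancel])
  qed
  define L where "L w = lim (\<lambda>n. c n w)" for w
  have [measurable]: "L \<in> borel_measurable P" unfolding L_def by measurable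
  \<comment> \<open>Imposing the conditions along the whole orbit makes \<open>W\<close> exactly
    invariant; with the value 0 off \<open>W\<close> the limit becomes invariant at every
    point.\<close>
  define W where "W = {w \<in> space P. \<forall>g\<in>carrier G. Cauchy (\<lambda>n. c n (R g w)) \<and> L (R g w) = L w}"
  have W [measurable]: "W \<in> sets P"
  proof -
    have "{w \<in> space P. Cauchy (\<lambda>n. c n (R g w)) \<and> L (R g w) = L w} \<in> sets P" if "g \<in> carrier G" for g
    proof -
      note [measurable] = R[OF that]
      show ?thesis by measurable
    qed
    moreover have "W = (\<Inter>g\<in>carrier G. {w \<in> space P. Cauchy (\<lambda>n. c n (R g w)) \<and> L (R g w) = L w})"
      unfolding W_def using one_closed by blast
    ultimately show ?thesis
      using assms(2) one_closed by (simp only:) (intro sets.countable_INT', auto)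
  qed
  have R_space: "R g w \<in> space P" if "g \<in> carrier G" "w \<in> space P" for g w
    using measurable_space[OF R] that by blast
  have W_R: "R k w \<in> W" if "w \<in> W" and k: "k \<in> carrier G" for k w
  proof -
    have w: "w \<in> space P" using that by (simp add: W_def)
    have "Cauchy (\<lambda>n. c n (R g (R k w))) \<and> L (R g (R k w)) = L (R k w)" if g: "g \<in> carrier G" for g
    proof -
      have "Cauchy (\<lambda>n. c n (R (g \<otimes>\<^bsub>G\<^esub> k) w)) \<and> L (R (g \<otimes>\<^bsub>G\<^esub> k) w) = L w" "L (R k w) = L w"
        using \<open>w \<in> W\<close> g k unfolding W_def by auto
      then show ?thesis by (simp add: R_mult[OF g k w])
    qed
    then show ?thesis using R_space[OF k w] by (simp add: W_def)
  qed
  have W_iff: "R k w \<in> W \<longleftrightarrow> w \<in> W" if k: "k \<in> carrier G" and w: "w \<in> space P" for k w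
  proof
    assume "R k w \<in> W"
    then have "R (inv\<^bsub>G\<^esub> k) (R k w) \<in> W" by (rule W_R[OF _ inv_closed[OF k]])
    moreover have "R (inv\<^bsub>G\<^esub> k) (R k w) = w"
      using R_mult[of "inv\<^bsub>G\<^esub> k" k w] k w R_one by simp
    ultimately show "w \<in> W" by simp
  qed (rule W_R[OF _ k])
  define h where "h w = (if w \<in> W then L w else 0)" for w
  have L_lim: "(\<lambda>n. c n w) \<longlonglongrightarrow> L w" if "w \<in> W" for w
  proof -
    have "Cauchy (\<lambda>n. c n (R \<one>\<^bsub>G\<^esub> w))" "w \<in> space P" using that by (auto simp: W_def)
    then show ?thesis
      by (simp add: R_one L_def real_Cauchy_convergent convergent_LIMSEQ_iff[symmetric])
  qed
  have W_AE: "AE w in P. w \<in> W"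
    using conv shift AE_space
  proof eventually_elim
    case (elim w)
    then have *: "(\<lambda>n. c n w) \<longlonglongrightarrow> L w" by (simp add: L_def convergent_LIMSEQ_iff)
    have **: "(\<lambda>n. c n (R g w)) \<longlonglongrightarrow> L w" if "g \<in> carrier G" for g
      using tendsto_diff[OF * bspec[OF elim(2) that]] by simp
    have "Cauchy (\<lambda>n. c n (R g w)) \<and> L (R g w) = L w" if "g \<in> carrier G" for g
      using LIMSEQ_imp_Cauchy[OF **[OF that]] limI[OF **[OF that]] by (simp add: L_def)
    then show ?case using elim by (simp add: W_def)
  qed
  show thesis
  proof
    show "h \<in> borel_measurable P" unfolding h_def by measurable
    show "0 \<le> h w" for w
      using LIMSEQ_le_const[OF L_lim, of w 0] unit[OF c] by (auto simp: h_def)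
    show "h w \<le> 1" for w
      using LIMSEQ_le_const2[OF L_lim, of w 1] unit[OF c] by (auto simp: h_def)
    show "h (R g w) = h w" if "g \<in> carrier G" "w \<in> space P" for g w
      using W_iff[OF that] that unfolding h_def W_def by auto
    show "AE w in P. (\<lambda>n. c n w) \<longlonglongrightarrow> h w"
      using W_AE by eventually_elim (simp add: h_def L_lim)
  qed (rule c)
qed

text \<open>The invariant set where \<open>k z < 1\<close> suffices: if it is null then
  \<open>k \<ge> 1\<close>, if it is full then \<open>k \<le> 1\<close>, and in both cases the
  integral 1 excludes strict inequality on a set of positive measure.\<close>

lemma ergodic_AE_const:
  assumes erg: "(Q, R) \<in> ergodic_systems G" and [measurable]: "k \<in> borel_measurable Q"
    and inv: "\<And>g z. g \<in> carrier G \<Longrightarrow> z \<in> space Q \<Longrightarrow> k (R g z) = k z"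
    and total: "(\<integral>\<^sup>+z. k z \<partial>Q) = 1"
  shows "AE z in Q. k z = (1 :: ennreal)"
proof -
  have sys: "(Q, R) \<in> pmp_systems G" using erg unfolding ergodic_systems_def by auto
  note D = pmp_systemsD[OF sys]
  interpret prob_space Q by (rule D)
  define A where "A = {z \<in> space Q. k z < 1}"
  have "A \<in> sets Q" unfolding A_def by measurable
  moreover have "R g -` A \<inter> space Q = A" if "g \<in> carrier G" for g
    using inv[OF that] D(5)[OF that] by (auto simp: A_def)
  ultimately have "prob A = 0 \<or> prob A = 1"
    using erg unfolding ergodic_systems_def by blast
  then show ?thesis
  proof
    assume "prob A = 0"
    then have "AE z in Q. z \<notin> A"
      using \<open>A \<in> sets Q\<close> by (subst (asm) prob_eq_0) auto
    then have ge: "AE z in Q. 1 \<le> k z"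
      using AE_space by eventually_elim (auto simp: A_def)
    have "(\<integral>\<^sup>+z. k z - 1 \<partial>Q) = (\<integral>\<^sup>+z. k z \<partial>Q) - (\<integral>\<^sup>+z. 1 \<partial>Q)"
      using ge by (intro nn_integral_diff) (auto simp: emeasure_space_1)
    then have "AE z in Q. k z - 1 = 0"
      by (subst (asm) total) (simp add: emeasure_space_1 nn_integral_0_iff_AE)
    with ge show ?thesis by eventually_elim (auto simp: diff_eq_0_iff_ennreal intro: antisym)
  next
    assume "prob A = 1"
    then have "AE z in Q. z \<in> A"
      using \<open>A \<in> sets Q\<close> by (subst (asm) prob_eq_1) auto
    then have le: "AE z in Q. k z \<le> 1"
      by eventually_elim (auto simp: A_def)
    have "(\<integral>\<^sup>+z. 1 - k z \<partial>Q) = (\<integral>\<^sup>+z. 1 \<partial>Q) - (\<integral>\<^sup>+z. k z \<partial>Q)"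
      using le by (intro nn_integral_diff) (auto simp: total)
    then have "AE z in Q. 1 - k z = 0"
      by (subst (asm) total) (simp add: emeasure_space_1 nn_integral_0_iff_AE)
    with le show ?thesis by eventually_elim (auto simp: diff_eq_0_iff_ennreal intro: antisym)
  qed
qed

lemma nn_integral_measure_preserving:
  assumes "T \<in> M \<rightarrow>\<^sub>M M" "distr M M T = M" "f \<in> borel_measurable M"
  shows "(\<integral>\<^sup>+x. f (T x) \<partial>M) = (\<integral>\<^sup>+x. f x \<partial>M)"
  using nn_integral_distr[of T M M f] assms by simp

text \<open>
  An invariant function \<open>h \<ge> 1\<close> on the product, divided by its average over the ergodic fibre
  coordinate, is the density of a joining; disjointness forces this density to be 1.
\<close>

lemma disjoint_invariant_function:
  assumes sys: "(M, T) \<in> pmp_systems G" and erg: "(Q, R) \<in> ergodic_systems G"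
    and disj: "disjoint_systems G (M, T) (Q, R)"
    and h [measurable]: "h \<in> borel_measurable (M \<Otimes>\<^sub>M Q)"
    and h01: "\<And>p. p \<in> space (M \<Otimes>\<^sub>M Q) \<Longrightarrow> 0 \<le> h p" "\<And>p. p \<in> space (M \<Otimes>\<^sub>M Q) \<Longrightarrow> h p \<le> 1"
    and h_inv: "\<And>g x z. g \<in> carrier G \<Longrightarrow> x \<in> space M \<Longrightarrow> z \<in> space Q \<Longrightarrow>
          h (T g x, R g z) = (h (x, z) :: real)"
  obtains f where "f \<in> borel_measurable M"
    "\<And>g x. g \<in> carrier G \<Longrightarrow> x \<in> space M \<Longrightarrow> f (T g x) = f x"
    "AE p in M \<Otimes>\<^sub>M Q. h p = f (fst p)"
proof -
  have sysQ: "(Q, R) \<in> pmp_systems G" using erg unfolding ergodic_systems_def by auto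
  note D = pmp_systemsD[OF sys] and DQ = pmp_systemsD[OF sysQ]
  interpret M: prob_space M by (rule D)
  interpret Q: prob_space Q by (rule DQ)
  interpret P: prob_space "M \<Otimes>\<^sub>M Q" by (rule prob_space_pair[OF D(2) DQ(2)])
  interpret pair_sigma_finite M Q by unfold_locales
  \<comment> \<open>Adding 1 keeps the values between 1 and 2, so that the fibre average
    \<open>F\<close> is neither 0 nor infinite and can be divided by.\<close>
  define H where "H p = ennreal (1 + h p)" for p
  have [measurable]: "H \<in> borel_measurable (M \<Otimes>\<^sub>M Q)" unfolding H_def by measurable
  have H: "1 \<le> H (x, z)" "H (x, z) \<le> 2" if "x \<in> space M" "z \<in> space Q" for x z
  proof -
    have "(x, z) \<in> space (M \<Otimes>\<^sub>M Q)" using that by (simp add: space_pair_measure)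
    note * = h01[OF this]
    from * show "1 \<le> H (x, z)" unfolding H_def using ennreal_leI[of 1 "1 + h (x, z)"] by simp
    have "ennreal (1 + h (x, z)) \<le> ennreal 2" using * by (intro ennreal_leI) simp
    then show "H (x, z) \<le> 2" by (simp add: H_def)
  qed
  define F where "F x = (\<integral>\<^sup>+z. H (x, z) \<partial>Q)" for x
  have [measurable]: "F \<in> borel_measurable M" unfolding F_def by measurable
  have F: "1 \<le> F x" "F x \<le> 2" if "x \<in> space M" for x
  proof -
    have "(\<integral>\<^sup>+z. 1 \<partial>Q) \<le> F x"
      unfolding F_def by (rule nn_integral_mono) (rule H(1)[OF that])
    moreover have "F x \<le> (\<integral>\<^sup>+z. 2 \<partial>Q)"
      unfolding F_def by (rule nn_integral_mono) (rule H(2)[OF that])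
    ultimately show "1 \<le> F x" "F x \<le> 2" by (simp_all add: Q.emeasure_space_1)
  qed
  have F_fin: "F x \<noteq> 0" "F x \<noteq> \<top>" if "x \<in> space M" for x
    using F[OF that] by (auto simp: top_unique)
  have F_inv: "F (T g x) = F x" if g: "g \<in> carrier G" and x: "x \<in> space M" for g x
  proof -
    have [measurable]: "T g x \<in> space M" by (rule D(5)[OF g x])
    have "F (T g x) = (\<integral>\<^sup>+z. H (T g x, R g z) \<partial>Q)"
      unfolding F_def by (rule nn_integral_measure_preserving[symmetric, OF DQ(3,4)[OF g]]) measurable
    also have "\<dots> = F x"
      unfolding F_def using h_inv[OF g x] by (intro nn_integral_cong) (simp add: H_def)
    finally show ?thesis .
  qed
  define d where "d p = H p / F (fst p)" for p
  have d_meas [measurable]: "d \<in> borel_measurable (M \<Otimes>\<^sub>M Q)" unfolding d_def by measurable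
  have d_inv: "d (T g x, R g z) = d (x, z)" if "g \<in> carrier G" "x \<in> space M" "z \<in> space Q" for g x z
    using F_inv h_inv that by (simp add: d_def H_def)
  have d_fibre: "(\<integral>\<^sup>+z. d (x, z) \<partial>Q) = 1" if x: "x \<in> space M" for x
  proof -
    have "(\<integral>\<^sup>+z. d (x, z) \<partial>Q) = F x / F x"
      unfolding d_def fst_conv F_def using x by (intro nn_integral_divide) measurable
    then show ?thesis using F_fin[OF x] by (simp add: ennreal_divide_self less_top)
  qed
  have d_total: "(\<integral>\<^sup>+p. d p \<partial>(M \<Otimes>\<^sub>M Q)) = 1"
    by (subst Q.nn_integral_fst[symmetric]) (simp_all add: d_fibre M.emeasure_space_1 cong: nn_integral_cong)
  \<comment> \<open>The normalisation by \<open>F\<close> takes care of the marginal on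
    \<open>M\<close>; \<open>k\<close> is the density of the marginal on \<open>Q\<close>. It is
    invariant, so ergodicity of \<open>Q\<close> makes it constant.\<close>
  define k where "k z = (\<integral>\<^sup>+x. d (x, z) \<partial>M)" for z
  have [measurable]: "k \<in> borel_measurable Q" unfolding k_def by measurable
  have k: "AE z in Q. k z = 1"
  proof (rule ergodic_AE_const[OF erg])
    fix g z assume g: "g \<in> carrier G" and z: "z \<in> space Q"
    have [measurable]: "R g z \<in> space Q" by (rule DQ(5)[OF g z])
    have "k (R g z) = (\<integral>\<^sup>+x. d (T g x, R g z) \<partial>M)"
      unfolding k_def by (rule nn_integral_measure_preserving[symmetric, OF D(3,4)[OF g]]) measurable
    also have "\<dots> = k z"
      unfolding k_def using d_inv[OF g _ z] by (intro nn_integral_cong)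
    finally show "k (R g z) = k z" .
  next
    have "(\<integral>\<^sup>+z. k z \<partial>Q) = (\<integral>\<^sup>+p. d p \<partial>(M \<Otimes>\<^sub>M Q))"
      unfolding k_def by (rule nn_integral_snd) measurable
    then show "(\<integral>\<^sup>+z. k z \<partial>Q) = 1" by (simp only: d_total)
  qed measurable
  define J where "J = density (M \<Otimes>\<^sub>M Q) d"
  have "J \<in> joinings G (M, T) (Q, R)"
    unfolding joinings.simps
  proof (intro CollectI conjI ballI)
    show "prob_space J"
      by (intro prob_spaceI) (simp add: J_def emeasure_density d_total cong: nn_integral_cong)
    show "sets J = sets (M \<Otimes>\<^sub>M Q)" by (simp add: J_def)
    show "distr J M fst = M"
    proof (rule measure_eqI)
      fix A assume "A \<in> sets (distr J M fst)"
      then have [measurable]: "A \<in> sets M" by simp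
      have "emeasure (distr J M fst) A = emeasure J (fst -` A \<inter> space J)"
        by (rule emeasure_distr) (simp_all add: J_def)
      also have "\<dots> = (\<integral>\<^sup>+p. d p * indicator (fst -` A \<inter> space (M \<Otimes>\<^sub>M Q)) p \<partial>(M \<Otimes>\<^sub>M Q))"
        unfolding J_def by (simp add: emeasure_density)
      also have "\<dots> = (\<integral>\<^sup>+p. d p * indicator A (fst p) \<partial>(M \<Otimes>\<^sub>M Q))"
        by (intro nn_integral_cong) (auto simp: indicator_def)
      also have "\<dots> = (\<integral>\<^sup>+x. \<integral>\<^sup>+z. d (x, z) * indicator A x \<partial>Q \<partial>M)"
        by (subst Q.nn_integral_fst[symmetric]) simp_all
      also have "\<dots> = (\<integral>\<^sup>+x. indicator A x \<partial>M)"
        by (intro nn_integral_cong) (simp add: nn_integral_multc d_fibre)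
      finally show "emeasure (distr J M fst) A = emeasure M A" by simp
    qed simp
    show "distr J Q snd = Q"
    proof (rule measure_eqI)
      fix A assume "A \<in> sets (distr J Q snd)"
      then have [measurable]: "A \<in> sets Q" by simp
      have "emeasure (distr J Q snd) A = emeasure J (snd -` A \<inter> space J)"
        by (rule emeasure_distr) (simp_all add: J_def)
      also have "\<dots> = (\<integral>\<^sup>+p. d p * indicator (snd -` A \<inter> space (M \<Otimes>\<^sub>M Q)) p \<partial>(M \<Otimes>\<^sub>M Q))"
        unfolding J_def by (simp add: emeasure_density)
      also have "\<dots> = (\<integral>\<^sup>+p. d p * indicator A (snd p) \<partial>(M \<Otimes>\<^sub>M Q))"
        by (intro nn_integral_cong) (auto simp: indicator_def)
      also have "\<dots> = (\<integral>\<^sup>+z. \<integral>\<^sup>+x. d (x, z) * indicator A z \<partial>M \<partial>Q)"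
        by (subst nn_integral_snd[symmetric]) simp_all
      also have "\<dots> = (\<integral>\<^sup>+z. k z * indicator A z \<partial>Q)"
        by (intro nn_integral_cong) (simp add: nn_integral_multc k_def)
      also have "\<dots> = (\<integral>\<^sup>+z. indicator A z \<partial>Q)"
        using k by (intro nn_integral_cong_AE) (auto elim!: eventually_mono)
      finally show "emeasure (distr J Q snd) A = emeasure Q A" by simp
    qed simp
    fix g assume g: "g \<in> carrier G"
    let ?g = "\<lambda>(x, z). (T g x, R g z)"
    have g_meas: "?g \<in> M \<Otimes>\<^sub>M Q \<rightarrow>\<^sub>M M \<Otimes>\<^sub>M Q" by (rule measurable_product_action[OF sys sysQ g])
    have sets_J: "sets J = sets (M \<Otimes>\<^sub>M Q)" by (simp add: J_def)
    have g_J: "?g \<in> J \<rightarrow>\<^sub>M J"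
      using g_meas by (simp only: measurable_cong_sets[OF sets_J sets_J])
    show "distr J J ?g = J"
    proof (rule measure_eqI)
      fix A assume "A \<in> sets (distr J J ?g)"
      then have A [measurable]: "A \<in> sets (M \<Otimes>\<^sub>M Q)" by (simp add: sets_J)
      have "emeasure (distr J J ?g) A = emeasure J (?g -` A \<inter> space J)"
        using A by (intro emeasure_distr[OF g_J]) (simp only: sets_J)
      also have "\<dots> = (\<integral>\<^sup>+p. d p * indicator (?g -` A \<inter> space (M \<Otimes>\<^sub>M Q)) p \<partial>(M \<Otimes>\<^sub>M Q))"
        unfolding J_def space_density
        by (rule emeasure_density[OF d_meas measurable_sets[OF g_meas A]])
      also have "\<dots> = (\<integral>\<^sup>+p. d (?g p) * indicator A (?g p) \<partial>(M \<Otimes>\<^sub>M Q))"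
        by (intro nn_integral_cong) (auto simp: indicator_def space_pair_measure d_inv[OF g])
      also have "\<dots> = (\<integral>\<^sup>+p. d p * indicator A p \<partial>(M \<Otimes>\<^sub>M Q))"
        by (rule nn_integral_measure_preserving[OF g_meas distr_product_action[OF sys sysQ g]]) measurable
      also have "\<dots> = emeasure J A" unfolding J_def by (simp add: emeasure_density)
      finally show "emeasure (distr J J ?g) A = emeasure J A" .
    qed simp
  qed
  then have "J = M \<Otimes>\<^sub>M Q" by (rule disjoint_systemsD[OF disj])
  then have "density (M \<Otimes>\<^sub>M Q) d = density (M \<Otimes>\<^sub>M Q) (\<lambda>_. 1)"
    by (simp add: J_def density_1)
  then have "AE p in M \<Otimes>\<^sub>M Q. d p = 1"
    by (intro P.density_unique) simp_all
  show thesis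
  proof
    show "(\<lambda>x. enn2real (F x) - 1) \<in> borel_measurable M" by measurable
    show "enn2real (F (T g x)) - 1 = enn2real (F x) - 1" if "g \<in> carrier G" "x \<in> space M" for g x
      using F_inv[OF that] by simp
    show "AE p in M \<Otimes>\<^sub>M Q. h p = enn2real (F (fst p)) - 1"
      using \<open>AE p in M \<Otimes>\<^sub>M Q. d p = 1\<close> AE_space
    proof eventually_elim
      case (elim p)
      then have x: "fst p \<in> space M" by (auto simp: space_pair_measure)
      have "H p = F (fst p)"
        using elim(1) by (simp add: d_def divide_eq_1_ennreal)
      moreover have "enn2real (H p) = 1 + h p" using h01[OF elim(2)] by (simp add: H_def)
      ultimately show ?case by simp
    qed
  qed
qed

subsection \<open>Ergodic components\<close>

text \<open>Only the sigma-algebra matters here; a measure is put on it later as the image of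
  \<open>M\<close> under the identity. Exact invariance is enough because the invariant functions
  constructed above are invariant at every point.\<close>

definition invariant_algebra :: "('g, 'm) monoid_scheme \<Rightarrow> 'a measure \<Rightarrow> ('g \<Rightarrow> 'a \<Rightarrow> 'a) \<Rightarrow> 'a measure" where
  "invariant_algebra G M T = sigma (space M) {A \<in> sets M. \<forall>g\<in>carrier G. T g -` A \<inter> space M = A}"

lemma space_invariant_algebra [simp]: "space (invariant_algebra G M T) = space M"
  unfolding invariant_algebra_def by (rule space_measure_of) (auto dest: sets.sets_into_space)

lemma sets_invariant_algebra:
  assumes "(M, T) \<in> pmp_systems G"
  shows "sets (invariant_algebra G M T) = {A \<in> sets M. \<forall>g\<in>carrier G. T g -` A \<inter> space M = A}"
proof -
  note D = pmp_systemsD[OF assms]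
  have "sigma_algebra (space M) {A \<in> sets M. \<forall>g\<in>carrier G. T g -` A \<inter> space M = A}"
    unfolding sigma_algebra_iff2
  proof (intro conjI ballI allI impI)
    show "{A \<in> sets M. \<forall>g\<in>carrier G. T g -` A \<inter> space M = A} \<subseteq> Pow (space M)"
      by (auto dest: sets.sets_into_space)
    show "space M - s \<in> {A \<in> sets M. \<forall>g\<in>carrier G. T g -` A \<inter> space M = A}"
      if "s \<in> {A \<in> sets M. \<forall>g\<in>carrier G. T g -` A \<inter> space M = A}" for s
    proof -
      have "T g -` (space M - s) \<inter> space M = space M - s" if g: "g \<in> carrier G" for g
      proof -
        have "T g -` s \<inter> space M = s" using \<open>s \<in> _\<close> g by blast
        then show ?thesis using D(5)[OF g] by blast
      qed
      then show ?thesis using that by blast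
    qed
    show "\<Union> (range A) \<in> {A \<in> sets M. \<forall>g\<in>carrier G. T g -` A \<inter> space M = A}"
      if "range A \<subseteq> {A \<in> sets M. \<forall>g\<in>carrier G. T g -` A \<inter> space M = A}" for A :: "nat \<Rightarrow> _"
    proof -
      have "T g -` \<Union> (range A) \<inter> space M = \<Union> (range A)" if g: "g \<in> carrier G" for g
      proof -
        have "T g -` A i \<inter> space M = A i" for i using \<open>range A \<subseteq> _\<close> g by blast
        then have "(\<Union>i. T g -` A i \<inter> space M) = (\<Union>i. A i)" by simp
        then show ?thesis by blast
      qed
      moreover have "\<Union> (range A) \<in> sets M" using that by (intro sets.countable_UN) auto
      ultimately show ?thesis by blast
    qed
  qed auto
  then show ?thesis
    unfolding invariant_algebra_def by (rule sigma_algebra.sets_measure_of_eq)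
qed

lemma measurable_invariant_algebra:
  assumes sys: "(M, T) \<in> pmp_systems G" and f: "f \<in> M \<rightarrow>\<^sub>M L"
    and inv: "\<And>g x. g \<in> carrier G \<Longrightarrow> x \<in> space M \<Longrightarrow> f (T g x) = f x"
  shows "f \<in> invariant_algebra G M T \<rightarrow>\<^sub>M L"
proof (rule measurableI)
  note D = pmp_systemsD[OF sys]
  show "f x \<in> space L" if "x \<in> space (invariant_algebra G M T)" for x
    using that measurable_space[OF f] by simp
  fix A assume "A \<in> sets L"
  then have "f -` A \<inter> space M \<in> sets M" using f by (rule measurable_sets[rotated])
  moreover have "T g -` (f -` A \<inter> space M) \<inter> space M = f -` A \<inter> space M" if "g \<in> carrier G" for g
    using inv[OF that] D(5)[OF that] by auto
  ultimately show "f -` A \<inter> space (invariant_algebra G M T) \<in> sets (invariant_algebra G M T)"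
    by (simp add: sets_invariant_algebra[OF sys])
qed

text \<open>Nonatomicity is inherited from the factor \<open>N\<close>: points with the same pair
  code have the same code in the second coordinate, so they lie over a null set.\<close>

lemma std_nonatomic_pair:
  assumes K: "prob_space K" and sets: "sets K = sets (M \<Otimes>\<^sub>M N)"
    and cM: "borel_coding M A \<phi> \<psi>" and cN: "borel_coding N B \<phi>' \<psi>'"
    and A: "AE w in K. fst w \<in> A" and snd: "distr K N snd = N"
    and B: "AE y in N. y \<in> B" and fib: "\<And>t. emeasure N {y \<in> B. \<phi>' y = t} = 0"
  shows "std_nonatomic_prob_space K"
proof (rule std_nonatomicI[OF K])
  note [measurable_cong] = sets
  note [measurable] = borel_codingD(1-3)[OF cN]
  let ?\<phi> = "\<lambda>p. pair_code (\<phi> (fst p), \<phi>' (snd p))"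
  show "borel_coding K (A \<times> B) ?\<phi> (\<lambda>t. (\<psi> (fst (pair_decode t)), \<psi>' (snd (pair_decode t))))"
    using borel_coding_pair[OF cM cN] borel_coding_cong[OF sets] by blast
  have snd_meas: "snd \<in> K \<rightarrow>\<^sub>M N" by measurable
  have "AE w in K. snd w \<in> B" by (rule AE_measure_preserving[OF snd_meas snd B])
  with A show "AE w in K. w \<in> A \<times> B" by eventually_elim (auto simp: mem_Times_iff)
  fix t
  let ?C = "{y \<in> B. \<phi>' y = snd (pair_decode t)}"
  have "?C = B \<inter> {y \<in> space N. \<phi>' y = snd (pair_decode t)}"
    using sets.sets_into_space[OF borel_codingD(1)[OF cN]] by auto
  then have C: "?C \<in> sets N" by simp
  have "emeasure K {w \<in> A \<times> B. ?\<phi> w = t} \<le> emeasure K (snd -` ?C \<inter> space K)"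
  proof (rule emeasure_mono)
    have "pair_decode t = (\<phi> (fst w), \<phi>' (snd w))" if "?\<phi> w = t" for w
      using that by (auto simp flip: that)
    then show "{w \<in> A \<times> B. ?\<phi> w = t} \<subseteq> snd -` ?C \<inter> space K"
      using sets.sets_into_space[OF borel_codingD(1)[OF cM]] sets.sets_into_space[OF borel_codingD(1)[OF cN]]
      by (force simp: sets_eq_imp_space_eq[OF sets] space_pair_measure)
  qed (rule measurable_sets[OF snd_meas C])
  also have "\<dots> = emeasure N ?C"
    using emeasure_distr[OF snd_meas C] by (simp only: snd)
  finally show "emeasure K {w \<in> A \<times> B. ?\<phi> w = t} = 0" by (simp add: fib)
qed

lemma product_in_pmp_systems:
  assumes G: "group G" and M: "(M, T) \<in> pmp_systems G" and N: "(N, S) \<in> pmp_systems G"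
  shows "product_system (M, T) (N, S) \<in> pmp_systems G"
proof -
  note DM = pmp_systemsD[OF M] and DN = pmp_systemsD[OF N]
  obtain A \<phi> \<psi> where cM: "borel_coding M A \<phi> \<psi>" and A: "AE x in M. x \<in> A"
    and "\<And>t. emeasure M {x \<in> A. \<phi> x = t} = 0"
    by (rule std_nonatomic_coding[OF DM(1)]) (rule that)
  obtain B \<phi>' \<psi>' where cN: "borel_coding N B \<phi>' \<psi>'" and B: "AE x in N. x \<in> B"
    and fib: "\<And>t. emeasure N {x \<in> B. \<phi>' x = t} = 0"
    by (rule std_nonatomic_coding[OF DN(1)]) (rule that)
  have "AE w in M \<Otimes>\<^sub>M N. fst w \<in> A"
    by (rule AE_measure_preserving[OF measurable_fst prob_space.distr_pair_fst[OF DN(2)] A])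
  then have "std_nonatomic_prob_space (M \<Otimes>\<^sub>M N)"
    by (rule std_nonatomic_pair[OF prob_space_pair[OF DM(2) DN(2)] refl cM cN _ _ B fib])
      (rule distr_pair_snd[OF DM(2) prob_space_imp_sigma_finite[OF DN(2)]])
  moreover have "group_action G (space (M \<Otimes>\<^sub>M N)) (\<lambda>g. restrict (\<lambda>(x, y). (T g x, S g y)) (space (M \<Otimes>\<^sub>M N)))"
    by (rule product_action[OF G M N]) (simp add: space_pair_measure)
  ultimately show ?thesis
    using measurable_product_action[OF M N] distr_product_action[OF M N]
    unfolding pmp_systems_def product_system.simps by blast
qed

text \<open>
  An invariant set is independent of the generating sets \<open>{\<phi> \<le> q}\<close>, since averaging the latter over
  the group does not change the probability of the intersection; hence it is independent of itself.
\<close>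

lemma zero_one_if_orbit_hull_limits:
  assumes K: "prob_space K" and c: "borel_coding K A \<phi> \<psi>" and A: "AE w in K. w \<in> A"
    and R: "\<And>g. g \<in> carrier G \<Longrightarrow> R g \<in> K \<rightarrow>\<^sub>M K"
    and inv: "\<And>g. g \<in> carrier G \<Longrightarrow> distr K K (R g) = K"
    and lim: "\<And>q. q \<in> \<rat> \<Longrightarrow> \<exists>c l. (\<forall>n. c n \<in> orbit_hull G R (indicator {w \<in> space K. \<phi> w \<le> q})) \<and>
      (AE w in K. (\<lambda>n. c n w) \<longlonglongrightarrow> l)"
    and B: "B \<in> sets K" and B_inv: "\<And>g. g \<in> carrier G \<Longrightarrow> R g -` B \<inter> space K = B"
  shows "measure K B = 0 \<or> measure K B = 1"
proof -
  interpret prob_space K by fact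
  note [measurable] = borel_codingD(1-3)[OF c] B
  define L where "L q = {w \<in> space K. \<phi> w \<le> q}" for q
  have [measurable]: "L q \<in> sets K" for q unfolding L_def by measurable
  have indep: "prob (B \<inter> L q) = prob B * prob (L q)" if "q \<in> \<rat>" for q
  proof -
    obtain c l where c: "\<And>n. c n \<in> orbit_hull G R (indicator (L q))"
      and l: "AE w in K. (\<lambda>n. c n w) \<longlonglongrightarrow> l"
      using lim[OF \<open>q \<in> \<rat>\<close>] unfolding L_def by blast
    have bd: "0 \<le> indicat_real (L q) w" "indicat_real (L q) w \<le> 1" for w
      by (auto simp: indicator_def)
    \<comment> \<open>The integrals of the averages over an invariant \<open>D\<close> do not depend
      on \<open>n\<close>, so they equal their limit. Taking the whole space for \<open>D\<close>
      identifies \<open>l\<close> as \<open>prob (L q)\<close>.\<close>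
    have int: "prob (D \<inter> L q) = prob D * l"
      if D [measurable]: "D \<in> sets K" and D_inv: "\<And>g. g \<in> carrier G \<Longrightarrow> R g -` D \<inter> space K = D" for D
    proof -
      have "(\<lambda>n. \<integral>w. indicat_real D w * c n w \<partial>K) \<longlonglongrightarrow> (\<integral>w. indicat_real D w * l \<partial>K)"
      proof (rule integral_dominated_convergence[where w="\<lambda>_. 1"])
        show "(\<lambda>w. indicat_real D w * c n w) \<in> borel_measurable K" for n
        proof -
          have [measurable]: "c n \<in> borel_measurable K"
            by (rule orbit_hull_measurable[OF c _ R]) measurable
          show ?thesis by measurable
        qed
        show "AE w in K. (\<lambda>n. indicat_real D w * c n w) \<longlonglongrightarrow> indicat_real D w * l"
          using l by eventually_elim (rule tendsto_mult_left)
        show "AE w in K. norm (indicat_real D w * c n w) \<le> 1" for n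
          using orbit_hull_bounds[OF c bd] by (intro AE_I2) (auto simp: indicator_def)
      qed (auto simp: integrable_real_mult_indicator)
      moreover have "(\<integral>w. indicat_real D w * c n w \<partial>K) = prob (D \<inter> L q)" for n
      proof -
        have "(\<integral>w. indicat_real D w * c n w \<partial>K) = (\<integral>w. indicat_real D w * indicat_real (L q) w \<partial>K)"
          by (rule orbit_hull_integral[OF c _ bd K R inv D D_inv]) measurable
        also have "\<dots> = (\<integral>w. indicat_real (D \<inter> L q) w \<partial>K)"
          by (simp add: indicator_inter_arith)
        finally show ?thesis by simp
      qed
      ultimately have "prob (D \<inter> L q) = (\<integral>w. indicat_real D w * l \<partial>K)"
        using LIMSEQ_const_iff by fastforce
      then show ?thesis by simp
    qed
    have "R g -` space K \<inter> space K = space K" if "g \<in> carrier G" for g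
      using measurable_space[OF R[OF that]] by auto
    then have "prob (space K \<inter> L q) = prob (space K) * l" by (intro int) auto
    then have "prob (L q) = l" by (simp add: prob_space L_def Int_absorb1)
    then show ?thesis using int[OF B B_inv] by simp
  qed
  \<comment> \<open>Independence says that the restriction of \<open>K\<close> to \<open>B\<close>
    and the multiple of \<open>K\<close> by \<open>prob B\<close> agree on the test sets. Hence they
    are equal, and evaluating both at \<open>B\<close> gives
    \<open>prob B = prob B * prob B\<close>.\<close>
  define K1 where "K1 = density K (indicator B)"
  define K2 where "K2 = density K (\<lambda>_. ennreal (prob B))"
  have K1: "emeasure K1 D = emeasure K (B \<inter> D)" if "D \<in> sets K" for D
  proof -
    have "emeasure K1 D = (\<integral>\<^sup>+w. indicator B w * indicator D w \<partial>K)"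
      unfolding K1_def using that by (intro emeasure_density) auto
    also have "\<dots> = (\<integral>\<^sup>+w. indicator (B \<inter> D) w \<partial>K)"
      by (intro nn_integral_cong) (auto simp: indicator_def)
    finally show ?thesis using that by simp
  qed
  have K2: "emeasure K2 D = ennreal (prob B) * emeasure K D" if "D \<in> sets K" for D
    unfolding K2_def using that by (subst emeasure_density) (auto simp: nn_integral_cmult_indicator)
  have "K1 = K2"
  proof (rule borel_coding_eqI[OF _ _ _ _ c])
    show "finite_measure K1" using K1[of "space K"] by (intro finite_measureI) (simp add: K1_def)
    show "finite_measure K2" using K2[of "space K"]
      by (intro finite_measureI) (simp add: K2_def emeasure_space_1)
    show "sets K1 = sets K" "sets K2 = sets K" by (simp_all add: K1_def K2_def)
    show "AE w in K1. w \<in> A" "AE w in K2. w \<in> A"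
      unfolding K1_def K2_def using A by (auto simp: AE_density)
    fix q :: real assume q: "q \<in> \<rat>"
    have "emeasure K1 (L q) = emeasure K2 (L q)"
      using indep[OF q] by (simp add: K1 K2 emeasure_eq_measure ennreal_mult)
    then show "emeasure K1 {w \<in> space K. \<phi> w \<le> q} = emeasure K2 {w \<in> space K. \<phi> w \<le> q}"
      by (simp add: L_def)
  qed
  then have "emeasure K B = ennreal (prob B) * emeasure K B"
    using K1[OF B] K2[OF B] by simp
  then have "prob B = prob B * prob B"
    by (simp add: emeasure_eq_measure flip: ennreal_mult)
  then show ?thesis by simp
qed

text \<open>Images of the fibre measures disintegrate the joint law of \<open>X\<close> and the
  image of \<open>e\<close>. Combined with \<open>semidirect_unique\<close>, this computes marginals
  and symmetries of the fibres from those of \<open>J\<close>.\<close>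

lemma semidirect_distr_image:
  assumes M: "prob_space M" and \<kappa>: "\<kappa> \<in> M \<rightarrow>\<^sub>M prob_algebra Y"
    and X [measurable]: "X \<in> J \<rightarrow>\<^sub>M M" and e [measurable]: "e \<in> J \<rightarrow>\<^sub>M Y"
    and eq: "distr J (M \<Otimes>\<^sub>M Y) (\<lambda>p. (X p, e p)) = semidirect M \<kappa> Y"
    and F [measurable]: "F \<in> Y \<rightarrow>\<^sub>M L"
  shows "semidirect M (\<lambda>x. distr (\<kappa> x) L F) L = distr J (M \<Otimes>\<^sub>M L) (\<lambda>p. (X p, F (e p)))"
  unfolding distr_semidirect[OF M \<kappa> F, symmetric] eq[symmetric]
  by (subst distr_distr) (simp_all add: comp_def)

text \<open>The coordinates are regrouped with \<open>N\<close> in front because the fibre measures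
  are to be read as joinings of \<open>N\<close> with ergodic systems on
  \<open>M \<times> Q\<close>.\<close>

lemma joining_of_product_is_product:
  fixes M :: "'a measure" and N :: "'b measure" and Q :: "'c measure"
  assumes G: "group G" "countable (carrier G)"
    and perpM: "(M, T) \<in> ergodic_perp G" and perpN: "(N, S) \<in> ergodic_perp G"
    and erg: "(Q, R) \<in> ergodic_systems G"
    and J: "J \<in> joinings G (product_system (M, T) (N, S)) (Q, R)"
  shows "distr J (N \<Otimes>\<^sub>M (M \<Otimes>\<^sub>M Q)) (\<lambda>p. (snd (fst p), (fst (fst p), snd p))) = N \<Otimes>\<^sub>M (M \<Otimes>\<^sub>M Q)"
proof -
  have sysM: "(M, T) \<in> pmp_systems G" and sysN: "(N, S) \<in> pmp_systems G"
    and sysQ: "(Q, R) \<in> pmp_systems G"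
    using perpM perpN erg unfolding ergodic_perp_def ergodic_systems_def by auto
  note DM = pmp_systemsD[OF sysM] and DN = pmp_systemsD[OF sysN] and DQ = pmp_systemsD[OF sysQ]
  interpret M: prob_space M by (rule DM)
  interpret N: prob_space N by (rule DN)
  interpret Q: prob_space Q by (rule DQ)

  \<comment> \<open>The spaces and the group actions on them\<close>
  define W where "W = M \<Otimes>\<^sub>M Q"
  define Y where "Y = N \<Otimes>\<^sub>M W"
  define TR where "TR g = (\<lambda>(x, z). (T g x, R g z))" for g
  define U where "U g = (\<lambda>(y, w). (S g y, TR g w))" for g
  define gJ where "gJ g = (\<lambda>(p, z). ((\<lambda>(x, y). (T g x, S g y)) p, R g z))" for g
  note J' = joiningsD[OF J[unfolded product_system.simps]]
  interpret J: prob_space J by (rule J')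
  interpret W: prob_space W unfolding W_def by (rule prob_space_pair[OF DM(2) DQ(2)])
  have sets_J [measurable_cong]: "sets J = sets ((M \<Otimes>\<^sub>M N) \<Otimes>\<^sub>M Q)" by (rule J')
  have space_J: "space J = (space M \<times> space N) \<times> space Q"
    using sets_eq_imp_space_eq[OF sets_J] by (simp add: space_pair_measure)
  have sets_W: "sets W = sets (M \<Otimes>\<^sub>M Q)" by (simp add: W_def)
  have spW: "space W = space M \<times> space Q" by (simp add: W_def space_pair_measure)
  have TR_W: "TR g \<in> W \<rightarrow>\<^sub>M W" if "g \<in> carrier G" for g
    unfolding TR_def W_def by (rule measurable_product_action[OF sysM sysQ that])
  have TR_inv: "distr W W (TR g) = W" if "g \<in> carrier G" for g
    unfolding TR_def W_def by (rule distr_product_action[OF sysM sysQ that])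
  have U_meas: "U g \<in> Y \<rightarrow>\<^sub>M Y" if "g \<in> carrier G" for g
  proof -
    note [measurable] = DN(3)[OF that] TR_W[OF that]
    show ?thesis unfolding U_def Y_def by measurable
  qed
  have gJ_J: "gJ g \<in> J \<rightarrow>\<^sub>M J" if "g \<in> carrier G" for g
  proof -
    note [measurable] = DN(3)[OF that] DM(3)[OF that] DQ(3)[OF that]
    show ?thesis unfolding gJ_def by measurable
  qed
  have gJ_inv: "distr J J (gJ g) = J" if "g \<in> carrier G" for g
    using J'(5)[OF that] by (simp add: gJ_def)

  \<comment> \<open>The marginal of \<open>J\<close> on \<open>M \<times> Q\<close>\<close>
  have fst_MN: "distr J (M \<Otimes>\<^sub>M N) fst = M \<Otimes>\<^sub>M N" by (rule J')
  define r where "r p = (fst (fst p), snd p)" for p :: "('a \<times> 'b) \<times> 'c"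
  have r_meas [measurable]: "r \<in> J \<rightarrow>\<^sub>M W" unfolding r_def W_def by measurable
  have marg_W: "distr J W r = W"
  proof -
    have "distr J W r \<in> joinings G (M, T) (Q, R)"
      unfolding joinings.simps
    proof (intro CollectI conjI ballI)
      show "prob_space (distr J W r)" by (rule J.prob_space_distr[OF r_meas])
      show "sets (distr J W r) = sets (M \<Otimes>\<^sub>M Q)" by (simp add: sets_W)
      have "distr (distr J W r) M fst = distr J M (fst \<circ> r)"
        by (rule distr_distr[OF _ r_meas]) (simp add: W_def)
      also have "fst \<circ> r = fst \<circ> fst" by (auto simp: r_def)
      also have "distr J M (fst \<circ> fst) = distr (distr J (M \<Otimes>\<^sub>M N) fst) M fst"
        by (rule distr_distr[symmetric]) measurable
      also have "\<dots> = M" unfolding fst_MN by (rule N.distr_pair_fst)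
      finally show "distr (distr J W r) M fst = M" .
      have "distr (distr J W r) Q snd = distr J Q (snd \<circ> r)"
        by (rule distr_distr[OF _ r_meas]) (simp add: W_def)
      also have "snd \<circ> r = snd" by (auto simp: r_def)
      finally show "distr (distr J W r) Q snd = Q" by (simp only: J'(4))
      fix g assume g: "g \<in> carrier G"
      have "distr (distr J W r) (distr J W r) (\<lambda>(x, z). (T g x, R g z)) = distr (distr J W r) W (TR g)"
        by (rule distr_cong) (simp_all add: TR_def)
      also have "\<dots> = distr J W (TR g \<circ> r)" by (rule distr_distr[OF TR_W[OF g] r_meas])
      also have "TR g \<circ> r = r \<circ> gJ g" by (auto simp: TR_def r_def gJ_def)
      also have "distr J W (r \<circ> gJ g) = distr (distr J J (gJ g)) W r"
        by (rule distr_distr[OF r_meas gJ_J[OF g], symmetric])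
      finally show "distr (distr J W r) (distr J W r) (\<lambda>(x, z). (T g x, R g z)) = distr J W r"
        by (simp only: gJ_inv[OF g])
    qed
    then show ?thesis
      unfolding W_def by (rule disjoint_systemsD[OF ergodic_perp_disjoint[OF G erg perpM]])
  qed

  \<comment> \<open>The invariant sigma-algebra of \<open>M\<close>, and codings of the
    factors\<close>
  define M' where "M' = distr M (invariant_algebra G M T) (\<lambda>x. x)"
  have sets_M': "sets M' = {A \<in> sets M. \<forall>g\<in>carrier G. T g -` A \<inter> space M = A}"
    by (simp add: M'_def sets_invariant_algebra[OF sysM])
  have space_M' [simp]: "space M' = space M" by (simp add: M'_def)
  have id_inv: "(\<lambda>x. x) \<in> M \<rightarrow>\<^sub>M invariant_algebra G M T"
    by (rule measurableI) (auto simp: sets_invariant_algebra[OF sysM])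
  then have id_M': "(\<lambda>x. x) \<in> M \<rightarrow>\<^sub>M M'" by (simp add: M'_def)
  have distr_id_M': "distr M M' (\<lambda>x. x) = M'"
    by (simp add: M'_def cong: distr_cong)
  have M': "prob_space M'" unfolding M'_def by (rule M.prob_space_distr[OF id_inv])
  interpret M': prob_space M' by (rule M')
  note fst_M' = measurable_compose[OF measurable_fst id_M']
  define e where "e p = (snd (fst p), r p)" for p :: "('a \<times> 'b) \<times> 'c"
  have e_meas [measurable]: "e \<in> J \<rightarrow>\<^sub>M Y" unfolding e_def Y_def by measurable
  define X where "X p = fst (fst p)" for p :: "('a \<times> 'b) \<times> 'c"
  have X_M: "X \<in> J \<rightarrow>\<^sub>M M" unfolding X_def by measurable
  have X_M' [measurable]: "X \<in> J \<rightarrow>\<^sub>M M'" using measurable_compose[OF X_M id_M'] by simp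
  \<comment> \<open>The coordinate in \<open>M\<close> occurs twice: inside \<open>e\<close> with
    its full information, and as the base coordinate, where only invariant sets can see it.\<close>
  define H where "H = distr J (M' \<Otimes>\<^sub>M Y) (\<lambda>p. (X p, e p))"
  obtain A \<phi> \<psi> where cM: "borel_coding M A \<phi> \<psi>" and A: "AE x in M. x \<in> A"
    and "\<And>t. emeasure M {x \<in> A. \<phi> x = t} = 0"
    by (rule std_nonatomic_coding[OF DM(1)]) (rule that)
  obtain B \<phi>\<^sub>1 \<psi>\<^sub>1 where cN: "borel_coding N B \<phi>\<^sub>1 \<psi>\<^sub>1" and B: "AE y in N. y \<in> B"
    and "\<And>t. emeasure N {y \<in> B. \<phi>\<^sub>1 y = t} = 0"
    by (rule std_nonatomic_coding[OF DN(1)]) (rule that)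
  obtain C \<phi>\<^sub>2 \<psi>\<^sub>2 where cQ: "borel_coding Q C \<phi>\<^sub>2 \<psi>\<^sub>2" and C: "AE z in Q. z \<in> C"
    and fib: "\<And>t. emeasure Q {z \<in> C. \<phi>\<^sub>2 z = t} = 0"
    by (rule std_nonatomic_coding[OF DQ(1)]) (rule that)
  obtain \<Phi> \<Psi> where cW: "borel_coding W (A \<times> C) \<Phi> \<Psi>"
    using borel_coding_pair[OF cM cQ] unfolding W_def by blast
  obtain \<Phi>' \<Psi>' where cY: "borel_coding Y (B \<times> (A \<times> C)) \<Phi>' \<Psi>'"
    using borel_coding_pair[OF cN cW] unfolding Y_def by blast

  \<comment> \<open>Concentration of \<open>J\<close> on the coded sets\<close>
  have X_distr: "distr J M X = M"
  proof -
    have "distr J M X = distr (distr J (M \<Otimes>\<^sub>M N) fst) M fst"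
      by (subst distr_distr) (auto simp: X_def[abs_def] comp_def)
    then show ?thesis by (simp only: fst_MN N.distr_pair_fst)
  qed
  have "AE p in J. X p \<in> A" by (rule AE_measure_preserving[OF X_M X_distr A])
  moreover have "AE p in J. snd (fst p) \<in> B"
  proof -
    have m: "(\<lambda>p. snd (fst p)) \<in> J \<rightarrow>\<^sub>M N" by measurable
    have "distr J N (\<lambda>p. snd (fst p)) = distr (distr J (M \<Otimes>\<^sub>M N) fst) N snd"
      by (subst distr_distr) (auto simp: comp_def)
    then have "distr J N (\<lambda>p. snd (fst p)) = N"
      by (simp only: fst_MN distr_pair_snd[OF DM(2) N.sigma_finite_measure_axioms])
    from AE_measure_preserving[OF m this B] show ?thesis .
  qed
  moreover have "AE p in J. snd p \<in> C"
  proof -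
    have m: "snd \<in> J \<rightarrow>\<^sub>M Q" by measurable
    show ?thesis by (rule AE_measure_preserving[OF m J'(4) C])
  qed
  ultimately have e_AE: "AE p in J. e p \<in> B \<times> (A \<times> C)"
    by eventually_elim (simp add: e_def r_def X_def)

  \<comment> \<open>Disintegration over the invariant sigma-algebra\<close>
  have prob_H: "prob_space H" unfolding H_def by (rule J.prob_space_distr) measurable
  have sets_H: "sets H = sets (M' \<Otimes>\<^sub>M Y)" by (simp add: H_def)
  have fst_H: "distr H M' fst = M'"
  proof -
    have "distr H M' fst = distr J M' X" unfolding H_def by (subst distr_distr) (simp_all add: comp_def)
    also have "\<dots> = distr (distr J M X) M' (\<lambda>x. x)"
      by (subst distr_distr[OF id_M' X_M]) (simp add: comp_def)
    finally show ?thesis by (simp only: X_distr distr_id_M')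
  qed
  have AE_H: "AE p in H. snd p \<in> B \<times> (A \<times> C)"
  proof -
    have [measurable]: "B \<times> (A \<times> C) \<in> sets Y" by (rule borel_codingD(1)[OF cY])
    show ?thesis unfolding H_def by (subst AE_distr_iff) (use e_AE in simp_all)
  qed
  obtain \<kappa> where \<kappa>: "\<kappa> \<in> M' \<rightarrow>\<^sub>M prob_algebra Y" and H: "H = semidirect M' \<kappa> Y"
    by (rule disintegration[OF prob_H sets_H fst_H cY AE_H]) (rule that)
  note \<kappa>D = kernelD[OF M' \<kappa>]
  have B'[measurable]: "B \<times> (A \<times> C) \<in> sets Y" by (rule borel_codingD(1)[OF cY])
  have \<kappa>_AE: "AE x in M'. AE y in \<kappa> x. y \<in> B \<times> (A \<times> C)"
    using AE_H unfolding H by (subst (asm) AE_semidirect[OF M' \<kappa>]) simp_all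
  note H_image = semidirect_distr_image[OF M' \<kappa> X_M' e_meas H[unfolded H_def]]
  have fst_Y [measurable]: "fst \<in> Y \<rightarrow>\<^sub>M N" and snd_Y [measurable]: "snd \<in> Y \<rightarrow>\<^sub>M W"
    by (simp_all add: Y_def)

  \<comment> \<open>Marginals of the fibre measures\<close>
  have marg_N: "AE x in M'. distr (\<kappa> x) N fst = N"
  proof -
    have "semidirect M' (\<lambda>x. distr (\<kappa> x) N fst) N = distr J (M' \<Otimes>\<^sub>M N) (\<lambda>p. (X p, fst (e p)))"
      by (rule H_image) measurable
    also have "\<dots> = distr (distr J (M \<Otimes>\<^sub>M N) fst) (M' \<Otimes>\<^sub>M N) (\<lambda>w. (fst w, snd w))"
    proof (subst distr_distr)
      show "(\<lambda>w. (fst w, snd w)) \<in> M \<Otimes>\<^sub>M N \<rightarrow>\<^sub>M M' \<Otimes>\<^sub>M N"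
        by (intro measurable_Pair fst_M' measurable_snd)
    qed (auto simp: comp_def X_def e_def)
    \<comment> \<open>The first two coordinates are independent under \<open>J\<close> by
      \<open>fst_MN\<close>, so the constant kernel \<open>N\<close> disintegrates the same joint
      law.\<close>
    also have "\<dots> = distr M M' (\<lambda>x. x) \<Otimes>\<^sub>M distr N N (\<lambda>y. y)"
      unfolding fst_MN using pair_measure_distr[OF id_M', of "\<lambda>y. y" N N] N.sigma_finite_measure_axioms
      by (simp add: id_def)
    also have "\<dots> = semidirect M' (\<lambda>_. N) N"
      by (simp add: distr_id_M' semidirect_const[OF M' DN(2)])
    finally have eq: "semidirect M' (\<lambda>_. N) N = semidirect M' (\<lambda>x. distr (\<kappa> x) N fst) N" ..
    have "AE x in M'. N = distr (\<kappa> x) N fst"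
    proof (rule semidirect_unique[OF M' cN _ _ eq])
      show "(\<lambda>_. N) \<in> M' \<rightarrow>\<^sub>M prob_algebra N"
        using DN(2) by (intro measurable_const) (simp add: space_prob_algebra)
    qed (simp_all add: B measurable_kernel_distr[OF M' \<kappa> fst_Y])
    then show ?thesis by eventually_elim simp
  qed

  have snd_snd_Y: "(\<lambda>y. snd (snd y)) \<in> Y \<rightarrow>\<^sub>M Q"
    unfolding Y_def W_def by measurable
  \<comment> \<open>The same argument with \<open>marg_W\<close> as the source of independence; this
    marginal will make the components nonatomic.\<close>
  have marg_Q: "AE x in M'. distr (\<kappa> x) Q (\<lambda>y. snd (snd y)) = Q"
  proof -
    have "semidirect M' (\<lambda>x. distr (\<kappa> x) Q (\<lambda>y. snd (snd y))) Q
        = distr J (M' \<Otimes>\<^sub>M Q) (\<lambda>p. (X p, snd (snd (e p))))"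
      by (rule H_image[OF snd_snd_Y])
    also have "\<dots> = distr (distr J W r) (M' \<Otimes>\<^sub>M Q) (\<lambda>w. (fst w, snd w))"
    proof (subst distr_distr)
      show "(\<lambda>w. (fst w, snd w)) \<in> W \<rightarrow>\<^sub>M M' \<Otimes>\<^sub>M Q"
        unfolding W_def by (intro measurable_Pair fst_M' measurable_snd)
    qed (auto simp: comp_def X_def e_def r_def)
    also have "\<dots> = distr M M' (\<lambda>x. x) \<Otimes>\<^sub>M distr Q Q (\<lambda>y. y)"
      unfolding marg_W unfolding W_def using pair_measure_distr[OF id_M', of "\<lambda>y. y" Q Q] Q.sigma_finite_measure_axioms
      by (simp add: id_def)
    also have "\<dots> = semidirect M' (\<lambda>_. Q) Q"
      by (simp add: distr_id_M' semidirect_const[OF M' DQ(2)])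
    finally have eq: "semidirect M' (\<lambda>_. Q) Q = semidirect M' (\<lambda>x. distr (\<kappa> x) Q (\<lambda>y. snd (snd y))) Q" ..
    have "AE x in M'. Q = distr (\<kappa> x) Q (\<lambda>y. snd (snd y))"
    proof (rule semidirect_unique[OF M' cQ _ _ eq])
      show "(\<lambda>_. Q) \<in> M' \<rightarrow>\<^sub>M prob_algebra Q"
        using DQ(2) by (intro measurable_const) (simp add: space_prob_algebra)
    qed (simp_all add: C measurable_kernel_distr[OF M' \<kappa> snd_snd_Y])
    then show ?thesis by eventually_elim simp
  qed

  \<comment> \<open>Invariance of the fibre measures\<close>
  have \<kappa>_inv: "AE x in M'. \<forall>g\<in>carrier G. distr (\<kappa> x) Y (U g) = \<kappa> x"
  proof (rule AE_ball_countable[THEN iffD2, OF G(2)], rule ballI)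
    fix g assume g: "g \<in> carrier G"
    note [measurable] = U_meas[OF g] gJ_J[OF g]
    have e_gJ: "e (gJ g p) = U g (e p)" for p
      by (auto simp: e_def gJ_def U_def TR_def r_def split: prod.split)
    have X_gJ: "X (gJ g p) = T g (X p)" for p
      by (auto simp: X_def gJ_def split: prod.split)
    have "H = distr (distr J J (gJ g)) (M' \<Otimes>\<^sub>M Y) (\<lambda>p. (X p, e p))"
      by (simp only: H_def gJ_inv[OF g])
    also have "\<dots> = distr J (M' \<Otimes>\<^sub>M Y) (\<lambda>p. (X (gJ g p), e (gJ g p)))"
      by (subst distr_distr) (simp_all add: comp_def)
    \<comment> \<open>The two maps differ only in the base coordinate, \<open>T g (X p)\<close>
      against \<open>X p\<close>, and the sets of \<open>M'\<close> cannot tell these apart.\<close>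
    also have "\<dots> = distr J (M' \<Otimes>\<^sub>M Y) (\<lambda>p. (X p, U g (e p)))"
    proof (rule measure_eqI_Times)
      have m1: "(\<lambda>p. (X (gJ g p), e (gJ g p))) \<in> J \<rightarrow>\<^sub>M M' \<Otimes>\<^sub>M Y"
        and m2: "(\<lambda>p. (X p, U g (e p))) \<in> J \<rightarrow>\<^sub>M M' \<Otimes>\<^sub>M Y" by measurable
      show "prob_space (distr J (M' \<Otimes>\<^sub>M Y) (\<lambda>p. (X (gJ g p), e (gJ g p))))"
        "prob_space (distr J (M' \<Otimes>\<^sub>M Y) (\<lambda>p. (X p, U g (e p))))"
        using m1 m2 by (auto intro: J.prob_space_distr)
      fix D E assume D: "D \<in> sets M'" and E: "E \<in> sets Y"
      have "T g x \<in> D \<longleftrightarrow> x \<in> D" if "x \<in> space M" for x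
        using D g that unfolding sets_M' by blast
      moreover have "X p \<in> space M" if "p \<in> space J" for p
        using that by (auto simp: X_def space_J)
      ultimately have "(\<lambda>p. (X (gJ g p), e (gJ g p))) -` (D \<times> E) \<inter> space J
          = (\<lambda>p. (X p, U g (e p))) -` (D \<times> E) \<inter> space J"
        by (auto simp: e_gJ X_gJ)
      then show "emeasure (distr J (M' \<Otimes>\<^sub>M Y) (\<lambda>p. (X (gJ g p), e (gJ g p)))) (D \<times> E)
          = emeasure (distr J (M' \<Otimes>\<^sub>M Y) (\<lambda>p. (X p, U g (e p)))) (D \<times> E)"
        using emeasure_distr[OF m1 pair_measureI[OF D E]] emeasure_distr[OF m2 pair_measureI[OF D E]] by simp
    qed simp_all
    also have "\<dots> = semidirect M' (\<lambda>x. distr (\<kappa> x) Y (U g)) Y"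
      by (rule H_image[symmetric]) measurable
    finally have eq: "semidirect M' \<kappa> Y = semidirect M' (\<lambda>x. distr (\<kappa> x) Y (U g)) Y"
      by (simp only: H)
    have "AE x in M'. \<kappa> x = distr (\<kappa> x) Y (U g)"
      by (rule semidirect_unique[OF M' cY \<kappa> measurable_kernel_distr[OF M' \<kappa> U_meas[OF g]] eq \<kappa>_AE])
    then show "AE x in M'. distr (\<kappa> x) Y (U g) = \<kappa> x" by eventually_elim simp
  qed

  \<comment> \<open>The components of \<open>M \<times> Q\<close>\<close>
  define K where "K x = distr (\<kappa> x) W snd" for x
  have K_kernel: "K \<in> M' \<rightarrow>\<^sub>M prob_algebra W"
    unfolding K_def by (rule measurable_kernel_distr[OF M' \<kappa> snd_Y])
  note KD = kernelD[OF M' K_kernel]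
  have fst_W_M' [measurable]: "fst \<in> W \<rightarrow>\<^sub>M M'" unfolding W_def by (rule fst_M')
  \<comment> \<open>\<open>K\<close> disintegrates the product measure on
    \<open>M \<times> Q\<close> over the invariant sets of \<open>M\<close>. A point of
    \<open>W\<close> contains its base coordinate, so the total measure sits on the graph of the
    projection.\<close>
  have K_semi: "semidirect M' K W = distr W (M' \<Otimes>\<^sub>M W) (\<lambda>w. (fst w, w))"
  proof -
    have "semidirect M' K W = distr J (M' \<Otimes>\<^sub>M W) (\<lambda>p. (X p, snd (e p)))"
      unfolding K_def by (rule H_image[OF snd_Y])
    also have "\<dots> = distr (distr J W r) (M' \<Otimes>\<^sub>M W) (\<lambda>w. (fst w, w))"
      by (subst distr_distr) (simp_all add: comp_def e_def X_def r_def)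
    finally show ?thesis by (simp only: marg_W)
  qed

  \<comment> \<open>Averages of the test sets converge to constants on almost every
    component\<close>
  have K_lim: "AE x in M'. \<forall>q\<in>\<rat>. \<exists>c l.
      (\<forall>n. c n \<in> orbit_hull G TR (indicator {w \<in> space W. \<Phi> w \<le> q})) \<and>
      (AE w in K x. (\<lambda>n. c n w) \<longlonglongrightarrow> l)"
  proof (rule AE_ball_countable[THEN iffD2, OF countable_rat], rule ballI)
    fix q :: real
    let ?L = "{w \<in> space W. \<Phi> w \<le> q}"
    note [measurable] = borel_codingD(2)[OF cW]
    have L: "?L \<in> sets W" by measurable
    have TR_one: "TR \<one>\<^bsub>G\<^esub> w = w" if "w \<in> space W" for w
      using that DM(6) DQ(6) by (auto simp: TR_def spW)
    have TR_mult: "TR (g \<otimes>\<^bsub>G\<^esub> h) w = TR g (TR h w)"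
      if "g \<in> carrier G" "h \<in> carrier G" "w \<in> space W" for g h w
      using that DM(7)[of g h] DQ(7)[of g h] by (auto simp: TR_def spW)
    obtain c h where c: "\<And>n. c n \<in> orbit_hull G TR (indicator ?L)" and h: "h \<in> borel_measurable W"
      "\<And>w. w \<in> space W \<Longrightarrow> 0 \<le> h w" "\<And>w. w \<in> space W \<Longrightarrow> h w \<le> 1"
      "\<And>g w. g \<in> carrier G \<Longrightarrow> w \<in> space W \<Longrightarrow> h (TR g w) = h w"
      and c_h: "AE w in W. (\<lambda>n. c n w) \<longlonglongrightarrow> h w"
      by (rule orbit_hull_invariant_limit[OF G W.prob_space_axioms TR_W TR_inv TR_one TR_mult,
            of "indicat_real ?L"]) (use L that in \<open>auto simp: indicator_def\<close>)
    have h_inv: "h (T g x, R g z) = h (x, z)" if "g \<in> carrier G" "x \<in> space M" "z \<in> space Q" for g x z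
      using h(4)[OF that(1), of "(x, z)"] that by (simp add: TR_def spW)
    obtain f where f: "f \<in> borel_measurable M"
      "\<And>g x. g \<in> carrier G \<Longrightarrow> x \<in> space M \<Longrightarrow> f (T g x) = f x"
      "AE w in M \<Otimes>\<^sub>M Q. h w = f (fst w)"
    proof (rule disjoint_invariant_function[OF sysM erg ergodic_perp_disjoint[OF G erg perpM]])
      show "h \<in> borel_measurable (M \<Otimes>\<^sub>M Q)" using h(1) by (simp only: W_def)
      show "0 \<le> h p" if "p \<in> space (M \<Otimes>\<^sub>M Q)" for p
        using h(2)[of p] that by (simp only: W_def)
      show "h p \<le> 1" if "p \<in> space (M \<Otimes>\<^sub>M Q)" for p
        using h(3)[of p] that by (simp only: W_def)
      show "h (T g x, R g z) = h (x, z)" if "g \<in> carrier G" "x \<in> space M" "z \<in> space Q" for g x z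
        by (rule h_inv[OF that])
    qed (rule that)
    \<comment> \<open>Invariance makes \<open>f\<close> a function on the base of the
      disintegration, so over the base point \<open>x\<close> it contributes the single value
      \<open>f x\<close>.\<close>
    have [measurable]: "f \<in> borel_measurable M'"
      unfolding M'_def measurable_distr_eq1
      by (rule measurable_invariant_algebra[OF sysM f(1)]) (rule f(2))
    have [measurable]: "c n \<in> borel_measurable W" for n
      by (rule orbit_hull_measurable[OF c _ TR_W]) (use L in simp)
    \<comment> \<open>Convergence to \<open>f\<close> is split into the Cauchy property and the
      value of \<open>lim\<close> to obtain a measurable condition, which can then be passed from
      the total measure to the fibres.\<close>
    define good where "good p \<longleftrightarrow> Cauchy (\<lambda>n. c n (snd p)) \<and> lim (\<lambda>n. c n (snd p)) = f (fst p)" for p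
    have good: "Measurable.pred (M' \<Otimes>\<^sub>M W) good" unfolding good_def by measurable
    have "AE w in W. good (fst w, w)"
      using c_h f(3)[folded W_def] by eventually_elim (auto simp: good_def LIMSEQ_imp_Cauchy limI)
    then have "AE p in semidirect M' K W. good p"
      unfolding K_semi using good by (subst AE_distr_iff) (simp_all add: pred_def)
    then have "AE x in M'. AE w in K x. good (x, w)"
      using AE_semidirect[OF M' K_kernel good] by simp
    then show "AE x in M'. \<exists>c l. (\<forall>n. c n \<in> orbit_hull G TR (indicator ?L)) \<and>
        (AE w in K x. (\<lambda>n. c n w) \<longlonglongrightarrow> l)"
    proof eventually_elim
      case (elim x)
      then have "AE w in K x. (\<lambda>n. c n w) \<longlonglongrightarrow> f x"
      proof eventually_elim
        case (elim w)
        then have "convergent (\<lambda>n. c n w)" "lim (\<lambda>n. c n w) = f x"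
          by (simp_all add: good_def real_Cauchy_convergent)
        then show ?case by (simp add: convergent_LIMSEQ_iff)
      qed
      with c show ?case by blast
    qed
  qed

  \<comment> \<open>Almost every fibre measure is a product\<close>
  have \<kappa>_product: "AE x in M'. \<kappa> x = N \<Otimes>\<^sub>M K x"
    using marg_N marg_Q \<kappa>_inv K_lim \<kappa>_AE AE_space
  proof eventually_elim
    \<comment> \<open>The group and the rationals are countable, so one and the same
      \<open>x\<close> satisfies invariance under all group elements and convergence for all test
      sets.\<close>
    case (elim x)
    then have x: "x \<in> space M'" by simp
    interpret Kx: prob_space "K x" by (rule KD(1)[OF x])
    have sets_\<kappa>: "sets (\<kappa> x) = sets Y" by (rule \<kappa>D(2)[OF x])
    have sets_K: "sets (K x) = sets W" and space_K: "space (K x) = space W" by (rule KD(2,3)[OF x])+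
    have snd_\<kappa>: "snd \<in> \<kappa> x \<rightarrow>\<^sub>M W" using snd_Y by (simp only: measurable_cong_sets[OF sets_\<kappa> refl])
    have TR_K: "TR g \<in> K x \<rightarrow>\<^sub>M K x" if "g \<in> carrier G" for g
      using TR_W[OF that] by (simp only: measurable_cong_sets[OF sets_K sets_K])
    have K_inv: "distr (K x) (K x) (TR g) = K x" if g: "g \<in> carrier G" for g
    proof -
      have U_\<kappa>: "U g \<in> \<kappa> x \<rightarrow>\<^sub>M Y" using U_meas[OF g] by (simp only: measurable_cong_sets[OF sets_\<kappa> refl])
      have "distr (K x) (K x) (TR g) = distr (K x) W (TR g)"
        by (rule distr_cong) (simp_all add: sets_K)
      also have "\<dots> = distr (\<kappa> x) W (TR g \<circ> snd)"
        unfolding K_def by (rule distr_distr[OF TR_W[OF g] snd_\<kappa>])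
      also have "TR g \<circ> snd = snd \<circ> U g" by (auto simp: U_def)
      also have "distr (\<kappa> x) W (snd \<circ> U g) = distr (distr (\<kappa> x) Y (U g)) W snd"
        by (rule distr_distr[OF snd_Y U_\<kappa>, symmetric])
      finally show ?thesis using elim(3) g by (simp add: K_def)
    qed
    have K_AE: "AE w in K x. w \<in> A \<times> C"
    proof -
      have "A \<times> C \<in> sets W" by (rule borel_codingD(1)[OF cW])
      then show ?thesis
        unfolding K_def using elim(5) by (subst AE_distr_iff[OF snd_\<kappa>]) (auto elim: eventually_mono)
    qed
    have cK: "borel_coding (K x) (A \<times> C) \<Phi> \<Psi>" using cW borel_coding_cong[OF sets_K] by blast
    have "std_nonatomic_prob_space (K x)"
    proof (rule std_nonatomic_pair[OF Kx.prob_space_axioms _ cM cQ _ _ C fib])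
      show "sets (K x) = sets (M \<Otimes>\<^sub>M Q)" by (simp add: sets_K W_def)
      show "AE w in K x. fst w \<in> A" using K_AE by eventually_elim auto
      have "distr (K x) Q snd = distr (\<kappa> x) Q (snd \<circ> snd)"
        unfolding K_def by (rule distr_distr[OF _ snd_\<kappa>]) (simp add: W_def)
      then show "distr (K x) Q snd = Q" using elim(2) by (simp add: comp_def)
    qed
    moreover have "group_action G (space (K x)) (\<lambda>g. restrict (TR g) (space (K x)))"
      unfolding TR_def by (rule product_action[OF G(1) sysM sysQ]) (simp add: space_K spW)
    ultimately have pmp: "(K x, TR) \<in> pmp_systems G"
      using TR_K K_inv unfolding pmp_systems_def by blast
    have zero_one: "measure (K x) D = 0 \<or> measure (K x) D = 1"
      if "D \<in> sets (K x)" "\<forall>g\<in>carrier G. TR g -` D \<inter> space (K x) = D" for D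
    proof (rule zero_one_if_orbit_hull_limits[OF Kx.prob_space_axioms cK K_AE TR_K K_inv])
      show "\<exists>c l. (\<forall>n. c n \<in> orbit_hull G TR (indicator {w \<in> space (K x). \<Phi> w \<le> q})) \<and>
          (AE w in K x. (\<lambda>n. c n w) \<longlonglongrightarrow> l)" if "q \<in> \<rat>" for q
        unfolding space_K by (rule bspec[OF elim(4) that])
      show "D \<in> sets (K x)" by fact
      show "TR g -` D \<inter> space (K x) = D" if "g \<in> carrier G" for g
        by (rule bspec[OF \<open>\<forall>g\<in>carrier G. TR g -` D \<inter> space (K x) = D\<close> that])
    qed
    with pmp have "(K x, TR) \<in> ergodic_systems G" unfolding ergodic_systems_def by blast
    then have disj: "disjoint_systems G (N, S) (K x, TR)"
      by (rule ergodic_perp_disjoint[OF G _ perpN])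
    have sets_NK: "sets (\<kappa> x) = sets (N \<Otimes>\<^sub>M K x)"
      unfolding sets_\<kappa> Y_def by (rule sets_pair_measure_cong) (simp_all add: sets_K)
    have "\<kappa> x \<in> joinings G (N, S) (K x, TR)"
      unfolding joinings.simps
    proof (intro CollectI conjI ballI)
      show "prob_space (\<kappa> x)" by (rule \<kappa>D(1)[OF x])
      show "sets (\<kappa> x) = sets (N \<Otimes>\<^sub>M K x)" by (rule sets_NK)
      show "distr (\<kappa> x) N fst = N" by (rule elim(1))
      show "distr (\<kappa> x) (K x) snd = K x"
        unfolding K_def by (rule distr_cong) simp_all
      fix g assume g: "g \<in> carrier G"
      have "distr (\<kappa> x) (\<kappa> x) (\<lambda>(y, w). (S g y, TR g w)) = distr (\<kappa> x) Y (U g)"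
        by (rule distr_cong) (simp_all add: sets_\<kappa> U_def)
      then show "distr (\<kappa> x) (\<kappa> x) (\<lambda>(y, w). (S g y, TR g w)) = \<kappa> x"
        using elim(3) g by simp
    qed
    with disj show "\<kappa> x = N \<Otimes>\<^sub>M K x" by (rule disjoint_systemsD)
  qed

  \<comment> \<open>Integration over the fibres\<close>
  have e_eq: "e = (\<lambda>p. (snd (fst p), (fst (fst p), snd p)))" by (auto simp: e_def r_def)
  have "N \<Otimes>\<^sub>M W = distr J Y e"
  proof (rule pair_measure_eqI[OF N.sigma_finite_measure_axioms W.sigma_finite_measure_axioms])
    show "sets (N \<Otimes>\<^sub>M W) = sets (distr J Y e)" by (simp add: Y_def)
    fix D E assume D: "D \<in> sets N" and E: "E \<in> sets W"
    have DE: "D \<times> E \<in> sets Y" unfolding Y_def using D E by (rule pair_measureI)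
    have K_W: "(\<integral>\<^sup>+x. emeasure (K x) E \<partial>M') = emeasure W E"
    proof -
      have "(\<integral>\<^sup>+x. emeasure (K x) E \<partial>M') = emeasure (semidirect M' K W) (space M' \<times> E)"
        by (rule emeasure_semidirect_space_Times[OF M' K_kernel E, symmetric])
      also have "\<dots> = emeasure W ((\<lambda>w. (fst w, w)) -` (space M' \<times> E) \<inter> space W)"
        unfolding K_semi by (rule emeasure_distr[OF _ pair_measureI[OF sets.top E]]) measurable
      also have "(\<lambda>w. (fst w, w)) -` (space M' \<times> E) \<inter> space W = E"
        using sets.sets_into_space[OF E] by (auto simp: spW)
      finally show ?thesis .
    qed
    have "emeasure (distr J Y e) (D \<times> E) = emeasure H (space M' \<times> (D \<times> E))"
    proof -
      have "emeasure H (space M' \<times> (D \<times> E))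
          = emeasure J ((\<lambda>p. (X p, e p)) -` (space M' \<times> (D \<times> E)) \<inter> space J)"
        unfolding H_def by (rule emeasure_distr[OF _ pair_measureI[OF sets.top DE]]) measurable
      also have "(\<lambda>p. (X p, e p)) -` (space M' \<times> (D \<times> E)) \<inter> space J = e -` (D \<times> E) \<inter> space J"
        by (auto simp: X_def space_J)
      also have "emeasure J \<dots> = emeasure (distr J Y e) (D \<times> E)"
        by (rule emeasure_distr[OF e_meas DE, symmetric])
      finally show ?thesis ..
    qed
    also have "\<dots> = (\<integral>\<^sup>+x. emeasure (\<kappa> x) (D \<times> E) \<partial>M')"
      unfolding H by (rule emeasure_semidirect_space_Times[OF M' \<kappa> DE])
    also have "\<dots> = (\<integral>\<^sup>+x. emeasure N D * emeasure (K x) E \<partial>M')"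
    proof (rule nn_integral_cong_AE)
      show "AE x in M'. emeasure (\<kappa> x) (D \<times> E) = emeasure N D * emeasure (K x) E"
        using \<kappa>_product AE_space
      proof eventually_elim
        case (elim x)
        interpret Kx: prob_space "K x" by (rule KD(1)[OF elim(2)])
        show ?case
          using D E KD(2)[OF elim(2)] by (subst elim(1)) (simp add: Kx.emeasure_pair_measure_Times)
      qed
    qed
    also have "\<dots> = emeasure N D * emeasure W E"
    proof -
      have "(\<lambda>x. emeasure (K x) E) \<in> borel_measurable M'"
        using measurable_emeasure_kernel[OF kernel_subprob[OF M' K_kernel] E] .
      then show ?thesis by (simp add: nn_integral_cmult K_W)
    qed
    finally show "emeasure N D * emeasure W E = emeasure (distr J Y e) (D \<times> E)" ..
  qed
  then show ?thesis by (simp add: e_eq Y_def W_def)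
qed

theorem theorem6p1:
  fixes G :: "('g, 'm) monoid_scheme"
    and M :: "'a measure" and T :: "'g \<Rightarrow> 'a \<Rightarrow> 'a"
    and N :: "'b measure" and S :: "'g \<Rightarrow> 'b \<Rightarrow> 'b"
  assumes "group G" and "countable (carrier G)"
    and "(M, T) \<in> ergodic_perp G"
    and "(N, S) \<in> ergodic_perp G"
  shows "product_system (M, T) (N, S) \<in> ergodic_perp G"
proof -
  have sysM: "(M, T) \<in> pmp_systems G" and sysN: "(N, S) \<in> pmp_systems G"
    using assms(3,4) unfolding ergodic_perp_def by auto
  have pmp: "product_system (M, T) (N, S) \<in> pmp_systems G"
    by (rule product_in_pmp_systems[OF assms(1) sysM sysN])
  have "disjoint_systems G (product_system (M, T) (N, S)) (Q, R)"
    if erg: "(Q, R) \<in> ergodic_systems G" for Q :: "real measure" and R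
  proof -
    have sysQ: "(Q, R) \<in> pmp_systems G" using erg unfolding ergodic_systems_def by auto
    let ?V = "N \<Otimes>\<^sub>M (M \<Otimes>\<^sub>M Q)" and ?J0 = "(M \<Otimes>\<^sub>M N) \<Otimes>\<^sub>M Q"
    define e where "e = (\<lambda>p :: ('a \<times> 'b) \<times> real. (snd (fst p), (fst (fst p), snd p)))"
    define e' where "e' = (\<lambda>p :: 'b \<times> ('a \<times> real). ((fst (snd p), fst p), snd (snd p)))"
    have e' [measurable]: "e' \<in> ?V \<rightarrow>\<^sub>M ?J0" unfolding e'_def by measurable
    \<comment> \<open>\<open>e'\<close> undoes the regrouping \<open>e\<close>, so every joining is
      the image of one fixed measure under \<open>e'\<close>. The product measure is itself a
      joining, hence it is this image, and no separate computation of the image is needed.\<close>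
    have J: "J = distr ?V ?J0 e'" if J: "J \<in> joinings G (product_system (M, T) (N, S)) (Q, R)" for J
    proof -
      have sets_J [measurable_cong]: "sets J = sets ?J0"
        using J unfolding product_system.simps by (rule joiningsD)
      have [measurable]: "e \<in> J \<rightarrow>\<^sub>M ?V" unfolding e_def by measurable
      have "distr ?V ?J0 e' = distr (distr J ?V e) ?J0 e'"
        unfolding e_def by (simp only: joining_of_product_is_product[OF assms erg J])
      also have "\<dots> = distr J ?J0 (e' \<circ> e)" by (rule distr_distr) measurable
      also have "e' \<circ> e = (\<lambda>p. p)" by (auto simp: e_def e'_def)
      also have "distr J ?J0 (\<lambda>p. p) = J" using sets_J[symmetric] by (rule distr_id2)
      finally show ?thesis ..
    qed
    have J0: "?J0 \<in> joinings G (product_system (M, T) (N, S)) (Q, R)"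
      unfolding product_system.simps
      by (rule product_in_joinings[OF pmp[unfolded product_system.simps] sysQ])
    have "J = ?J0" if "J \<in> joinings G (product_system (M, T) (N, S)) (Q, R)" for J
      by (rule trans[OF J[OF that] J[OF J0, symmetric]])
    with J0 have "joinings G (product_system (M, T) (N, S)) (Q, R) = {?J0}"
      by blast
    then show ?thesis
      unfolding disjoint_systems_def by (simp only: product_system.simps fst_conv)
  qed
  then have "\<forall>Z\<in>ergodic_systems G. disjoint_systems G (product_system (M, T) (N, S)) (Z :: ('g, real) system)"
    by (metis surj_pair)
  with pmp show ?thesis unfolding ergodic_perp_def by blast
qed

end
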